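(* Let $N\geq 2$ and let $\Omega\subset\mathbb{R}^N$ be a smooth bounded domain containing the origin. For any $0\leq\gamma<\gamma_1$, $0\leq\beta<N$ and $p>1$, $$\sup_{u\in W_0^{1,N}(\Omega),\ \int_\Omega F(\nabla u)^N\,\mathrm{d}x\leq1}\int_\Omega\frac{e^{\lambda_N(1-\frac{\beta}{N})|u|^{\frac{N}{N-1}}(1+\gamma\|u\|_p^N)^{\frac{1}{N-1}}}}{F^o(x)^\beta}\,\mathrm{d}x<+\infty.$$
   Context: $F:\mathbb{R}^N\to[0,+\infty)$ is a convex function of class $C^2(\mathbb{R}^N\setminus\{0\})$, even and positively homogeneous of degree 1, with $F(x)>0$ for $x\neq0$ and $\mathrm{Hess}(F^2)$ positive definite on $\mathbb{R}^N\setminus\{0\}$. $F^o(x):=\sup_{F(\xi)\leq1}\langle x,\xi\rangle$. $\kappa_N$ is the Lebesgue measure of $\{x:F^o(x)\leq1\}$ and $\lambda_N=N^{\frac{N}{N-1}}\kappa_N^{\frac{1}{N-1}}$. $\gamma_1:=\inf_{u\in W_0^{1,N}(\Omega)\setminus\{0\}}\frac{\int_\Omega F(\nabla u)^N\,\mathrm{d}x}{\|u\|_p^N}$, with $\|\cdot\|_p$ the $L^p(\Omega)$ norm. *)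

theory Defs
  imports "HOL-Analysis.Analysis"
begin

definition grad :: "('a::euclidean_space \<Rightarrow> real) \<Rightarrow> 'a \<Rightarrow> 'a" where
  "grad f x = (\<Sum>i\<in>Basis. frechet_derivative f (at x) i *\<^sub>R i)"

coinductive smooth_on :: "'a::euclidean_space set \<Rightarrow> ('a \<Rightarrow> real) \<Rightarrow> bool" for S where
  "\<lbrakk> \<forall>x\<in>S. f differentiable (at x);
     \<forall>i\<in>Basis. smooth_on S (\<lambda>x. frechet_derivative f (at x) i) \<rbrakk> \<Longrightarrow> smooth_on S f"

definition C2_on :: "'a::euclidean_space set \<Rightarrow> ('a \<Rightarrow> real) \<Rightarrow> bool" where
  "C2_on S f \<longleftrightarrow> (\<exists>(Df :: 'a \<Rightarrow> ('a \<Rightarrow>\<^sub>L real)) (D2f :: 'a \<Rightarrow> ('a \<Rightarrow>\<^sub>L ('a \<Rightarrow>\<^sub>L real))).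
      (\<forall>x\<in>S. (f has_derivative blinfun_apply (Df x)) (at x)) \<and>
      (\<forall>x\<in>S. (Df has_derivative blinfun_apply (D2f x)) (at x)) \<and>
      continuous_on S D2f)"

definition hessian_pos_def_on :: "'a::euclidean_space set \<Rightarrow> ('a \<Rightarrow> real) \<Rightarrow> bool" where
  "hessian_pos_def_on S g \<longleftrightarrow> (\<exists>(Dg :: 'a \<Rightarrow> ('a \<Rightarrow>\<^sub>L real)) (D2g :: 'a \<Rightarrow> ('a \<Rightarrow>\<^sub>L ('a \<Rightarrow>\<^sub>L real))).
      (\<forall>x\<in>S. (g has_derivative blinfun_apply (Dg x)) (at x)) \<and>
      (\<forall>x\<in>S. (Dg has_derivative blinfun_apply (D2g x)) (at x)) \<and>
      (\<forall>x\<in>S. \<forall>h. h \<noteq> 0 \<longrightarrow> blinfun_apply (blinfun_apply (D2g x) h) h > 0))"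

definition anisotropic_F :: "('a::euclidean_space \<Rightarrow> real) \<Rightarrow> bool" where
  "anisotropic_F F \<longleftrightarrow>
     (\<forall>x. F x \<ge> 0) \<and> convex_on UNIV F \<and> C2_on (- {0}) F \<and>
     (\<forall>x. F (- x) = F x) \<and> (\<forall>t x. t > 0 \<longrightarrow> F (t *\<^sub>R x) = t * F x) \<and>
     (\<forall>x. x \<noteq> 0 \<longrightarrow> F x > 0) \<and> hessian_pos_def_on (- {0}) (\<lambda>x. (F x)\<^sup>2)"

definition Fo :: "('a::euclidean_space \<Rightarrow> real) \<Rightarrow> 'a \<Rightarrow> real" where
  "Fo F x = (SUP \<xi>\<in>{\<xi>. F \<xi> \<le> 1}. x \<bullet> \<xi>)"

definition kappa :: "('a::euclidean_space \<Rightarrow> real) \<Rightarrow> real" where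
  "kappa F = measure lebesgue {x::'a. Fo F x \<le> 1}"

definition lambdaN :: "('a::euclidean_space \<Rightarrow> real) \<Rightarrow> real" where
  "lambdaN F = (let N = real DIM('a) in N powr (N / (N - 1)) * kappa F powr (1 / (N - 1)))"

definition smooth_bounded_domain :: "'a::euclidean_space set \<Rightarrow> bool" where
  "smooth_bounded_domain \<Omega> \<longleftrightarrow> open \<Omega> \<and> bounded \<Omega> \<and> connected \<Omega> \<and> \<Omega> \<noteq> {} \<and>
     (\<exists>\<rho>. smooth_on UNIV \<rho> \<and> \<Omega> = {x. \<rho> x < 0} \<and> (\<forall>x. \<rho> x = 0 \<longrightarrow> grad \<rho> x \<noteq> 0))"

definition test_fun :: "'a::euclidean_space set \<Rightarrow> ('a \<Rightarrow> real) \<Rightarrow> bool" where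
  "test_fun \<Omega> \<phi> \<longleftrightarrow> smooth_on UNIV \<phi> \<and> compact (closure {x. \<phi> x \<noteq> 0}) \<and>
      closure {x. \<phi> x \<noteq> 0} \<subseteq> \<Omega>"

text \<open>u belongs to W_0^{1,q}(Omega) with weak gradient Du: u, Du are measurable and there are
  test functions phi_k with phi_k \<rightarrow> u and grad phi_k \<rightarrow> Du in L^q(Omega).\<close>
definition W0 :: "real \<Rightarrow> 'a::euclidean_space set \<Rightarrow> ('a \<Rightarrow> real) \<Rightarrow> ('a \<Rightarrow> 'a) \<Rightarrow> bool" where
  "W0 q \<Omega> u Du \<longleftrightarrow> u \<in> borel_measurable lebesgue \<and> Du \<in> borel_measurable lebesgue \<and>
     (\<exists>\<phi>. (\<forall>k. test_fun \<Omega> (\<phi> k)) \<and>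
        ((\<lambda>k. \<integral>\<^sup>+ x\<in>\<Omega>. ennreal (\<bar>\<phi> k x - u x\<bar> powr q) \<partial>lebesgue) \<longlonglongrightarrow> 0) \<and>
        ((\<lambda>k. \<integral>\<^sup>+ x\<in>\<Omega>. ennreal (norm (grad (\<phi> k) x - Du x) powr q) \<partial>lebesgue) \<longlonglongrightarrow> 0))"

definition Lp_norm :: "real \<Rightarrow> 'a::euclidean_space set \<Rightarrow> ('a \<Rightarrow> real) \<Rightarrow> real" where
  "Lp_norm p \<Omega> u = enn2real (\<integral>\<^sup>+ x\<in>\<Omega>. ennreal (\<bar>u x\<bar> powr p) \<partial>lebesgue) powr (1 / p)"

definition gamma1 :: "('a::euclidean_space \<Rightarrow> real) \<Rightarrow> 'a set \<Rightarrow> real \<Rightarrow> real" where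
  "gamma1 F \<Omega> p = Inf {(\<integral>x\<in>\<Omega>. F (Du x) ^ DIM('a) \<partial>lebesgue) / Lp_norm p \<Omega> u ^ DIM('a) | u Du.
       W0 (real DIM('a)) \<Omega> u Du \<and> \<not> (AE x in lebesgue. x \<in> \<Omega> \<longrightarrow> u x = 0)}"

end

theory Submission
  imports Defs "HOL-Real_Asymp.Real_Asymp"
begin

text \<open>
  Blow-up analysis is avoided. For a test function \<open>\<phi>\<close> put \<open>m t = |{|\<phi>| \<ge> t}|\<close>, \<open>T = - ln m\<close> and
  let \<open>e t\<close> be the energy of the truncation of \<open>|\<phi>|\<close> at height \<open>t\<close>. The Brunn--Minkowski inequality for
  superlevel sets and small Wulff shapes gives the sharp capacity estimate
  \<open>\<lambda>\<^sub>N\<^bsup>N-1\<^esup> (b - a)\<^bsup>N\<^esup> \<le> (e b - e a) (T b - T a)\<^bsup>N-1\<^esup>\<close>, without any rearrangement.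

  The main point is that this survives, up to a constant \<open>C\<close>, when the lower order term is subtracted:
  \<open>\<lambda>\<^sub>N\<^bsup>N-1\<^esup> b\<^bsup>N\<^esup> \<le> (e b - \<gamma>' \<parallel>min |\<phi>| b\<parallel>\<^bsup>N\<^esup>) (T b + C)\<^bsup>N-1\<^esup>\<close> for \<open>\<gamma>' < \<gamma>\<^sub>1\<close>. Cut at the level
  \<open>s = M \<parallel>min |\<phi>| b\<parallel>\<close> with \<open>M\<close> large. Below \<open>s\<close> the strict inequality \<open>\<gamma>' < \<gamma>\<^sub>1\<close> leaves a positive energy,
  above \<open>s\<close> the set is small, and the function differs from a truncated logarithm only at the cost
  of additional energy; the loss caused by cutting is absorbed by Young's inequality.

  As in the argument of Adams and Garsia, it follows that the levels \<open>t\<^sub>k\<close> at which the exponent equals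
  \<open>k\<close> satisfy \<open>T t\<^sub>k - k \<le> \<tau>\<close> for at most \<open>A \<tau> + B\<close> integers \<open>k\<close>, which bounds the integral for test
  functions. Fatou's lemma transfers the bound to \<open>W\<^sub>0\<^bsup>1,N\<^esup>\<close>.
\<close>

section \<open>The Brunn--Minkowski inequality\<close>

text \<open>The obstacle is that the factor 1 + \<gamma> \<parallel>u\<parallel>^N enlarges a
  critical exponent by an amount depending on the whole function, so the sharp capacity estimate
  alone leaves no room for it. The room comes from (1 + x)(1 - x) \<le> 1 with x = \<gamma>
  \<parallel>u\<parallel>^N: it is enough that the energy below a level, diminished by x, still
  controls the level with the sharp constant. The gap between \<gamma> and \<gamma>' pays for
  splitting the norm at the level, and the part of the norm above the level costs at most half of
  the energy q not yet used. The other half survives as a factor 1 - q/2; a level with small T - k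
  therefore leaves little energy for all higher ones, which beyond an initial stretch confines such
  levels to a short window.

  A constant C added to T is a harmless loss, since it changes the integral by a bounded factor.
  Lengthening T by C gains the relative amount C/T, so an error must be of this order to be
  absorbed; in the unit b/T the errors caused by the cut are.\<close>

abbreviation msum :: "'a::euclidean_space set \<Rightarrow> 'a set \<Rightarrow> 'a set"
  where "msum A B \<equiv> (\<Union>x\<in>A. \<Union>y\<in>B. {x + y})"

text \<open>The number is an upper bound rather than the exact count, so that a set may be cut by a
  halfspace without recounting. The boxes are open; the pieces of hyperplanes lost by cutting have
  measure zero.\<close>

definition box_union :: "nat \<Rightarrow> 'a::euclidean_space set \<Rightarrow> bool" where
  "box_union n A \<longleftrightarrow> (\<exists>D. finite D \<and> card D \<le> n \<and> pairwise disjnt D \<and>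
     (\<forall>X\<in>D. X \<noteq> {} \<and> (\<exists>a b. X = box a b)) \<and> \<Union>D = A)"

lemma box_union_open: "box_union n A \<Longrightarrow> open A"
  unfolding box_union_def by (auto intro!: open_Union)

lemma box_union_bounded: "box_union n A \<Longrightarrow> bounded A"
  unfolding box_union_def by (auto intro!: bounded_Union)

lemma measure_lborel_mono:
  "open A \<Longrightarrow> open B \<Longrightarrow> bounded (B::'a::euclidean_space set) \<Longrightarrow> A \<subseteq> B \<Longrightarrow> measure lborel A \<le> measure lborel B"
  by (rule measure_mono_fmeasurable) (auto intro!: fmeasurableI emeasure_bounded_finite)

lemma measure_lborel_open_pos:
  fixes A :: "'a::euclidean_space set"
  assumes "open A" "A \<noteq> {}" "bounded A"
  shows "0 < measure lborel A"
proof -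
  have "\<not> negligible A" using assms(1,2) by (rule open_not_negligible)
  hence "emeasure lborel A \<noteq> 0"
    using assms(1) by (auto simp: negligible_iff_null_sets null_sets_def)
  moreover have "emeasure lborel A < \<infinity>" using assms(3) by (rule emeasure_bounded_finite)
  ultimately show ?thesis by (simp add: measure_def enn2real_positive_iff zero_less_iff_neq_zero)
qed

section \<open>Cutting unions of boxes by coordinate hyperplanes\<close>

lemma box_Int_halfspace_less:
  fixes a b :: "'a::euclidean_space"
  assumes "i \<in> Basis"
  shows "\<exists>c d. box a b \<inter> {x. x \<bullet> i < s} = box c d"
proof -
  let ?d = "b + (min (b \<bullet> i) s - b \<bullet> i) *\<^sub>R i"
  have "?d \<bullet> j = (if j = i then min (b \<bullet> i) s else b \<bullet> j)" if "j \<in> Basis" for j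
    using that assms by (simp add: inner_add_left inner_Basis)
  hence "x \<in> box a b \<inter> {x. x \<bullet> i < s} \<longleftrightarrow> x \<in> box a ?d" for x
    using assms by (auto simp: mem_box)
  thus ?thesis by blast
qed

lemma box_Int_halfspace_greater:
  fixes a b :: "'a::euclidean_space"
  assumes "i \<in> Basis"
  shows "\<exists>c d. box a b \<inter> {x. s < x \<bullet> i} = box c d"
proof -
  let ?d = "a + (max (a \<bullet> i) s - a \<bullet> i) *\<^sub>R i"
  have "?d \<bullet> j = (if j = i then max (a \<bullet> i) s else a \<bullet> j)" if "j \<in> Basis" for j
    using that assms by (simp add: inner_add_left inner_Basis)
  hence "x \<in> box a b \<inter> {x. s < x \<bullet> i} \<longleftrightarrow> x \<in> box ?d b" for x
    using assms by (auto simp: mem_box)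
  thus ?thesis by blast
qed

text \<open>Intersecting with a halfspace turns a box into a box or into the empty set, so the count
  never grows, and it drops when some box misses the halfspace. This drop drives the induction of
  Hadwiger and Ohmann.\<close>

lemma box_union_Int:
  assumes "finite D" "pairwise disjnt D" "\<forall>X\<in>D. X \<noteq> {} \<and> (\<exists>a b. X = box a b)"
    and H: "\<And>a b. \<exists>c d. box a b \<inter> H = box c d"
  shows "box_union (card D) (\<Union>D \<inter> H)"
    and "X \<in> D \<Longrightarrow> X \<inter> H = {} \<Longrightarrow> box_union (card D - 1) (\<Union>D \<inter> H)"
proof -
  have gen: "box_union (card E) (\<Union>D \<inter> H)" if E: "E \<subseteq> D" "\<Union>D \<inter> H = \<Union>E \<inter> H" for E
  proof -
    have fin: "finite E" using E assms(1) finite_subset by blast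
    let ?E = "(\<lambda>X. X \<inter> H) ` E - {{}}"
    have "card ?E \<le> card ((\<lambda>X. X \<inter> H) ` E)" by (rule card_mono) (use fin in auto)
    also have "\<dots> \<le> card E" by (rule card_image_le[OF fin])
    finally have "card ?E \<le> card E" .
    moreover have "pairwise disjnt ?E"
    proof (rule pairwiseI)
      fix U V assume "U \<in> ?E" "V \<in> ?E" "U \<noteq> V"
      then obtain X Y where XY: "X \<in> E" "Y \<in> E" "U = X \<inter> H" "V = Y \<inter> H" "X \<noteq> Y" by blast
      hence "disjnt X Y" using assms(2) E(1) by (meson pairwiseD subsetD)
      thus "disjnt U V" using XY by (auto simp: disjnt_def)
    qed
    moreover have "\<forall>X\<in>?E. X \<noteq> {} \<and> (\<exists>a b. X = box a b)"
    proof
      fix U assume "U \<in> ?E"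
      then obtain X where X: "X \<in> E" "U = X \<inter> H" "U \<noteq> {}" by blast
      then obtain a b where "X = box a b" using assms(3) E(1) by blast
      thus "U \<noteq> {} \<and> (\<exists>a b. U = box a b)" using H X by auto
    qed
    moreover have "\<Union>?E = \<Union>D \<inter> H" unfolding E(2) by blast
    moreover have "finite ?E" using fin by blast
    ultimately show ?thesis unfolding box_union_def by blast
  qed
  show "box_union (card D) (\<Union>D \<inter> H)" by (rule gen) auto
  assume X: "X \<in> D" "X \<inter> H = {}"
  have "box_union (card (D - {X})) (\<Union>D \<inter> H)" by (rule gen) (use X in auto)
  thus "box_union (card D - 1) (\<Union>D \<inter> H)" using X assms(1) by simp
qed

lemma null_hyperplane:
  fixes i :: "'a::euclidean_space"
  assumes "i \<in> Basis"
  shows "{x. x \<bullet> i = s} \<in> null_sets lborel"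
proof -
  have "negligible {x. i \<bullet> x = s}" using assms by (intro negligible_hyperplane) auto
  hence "{x. i \<bullet> x = s} \<in> null_sets lebesgue" by (simp add: negligible_iff_null_sets)
  moreover have "{x. i \<bullet> x = s} \<in> sets lborel" by measurable
  ultimately show ?thesis
    by (simp add: null_sets_def inner_commute)
qed

lemma measure_split_hyperplane:
  fixes A :: "'a::euclidean_space set"
  assumes "i \<in> Basis" "open A" "bounded A"
  shows "measure lborel A = measure lborel (A \<inter> {x. x \<bullet> i < s}) + measure lborel (A \<inter> {x. s < x \<bullet> i})"
proof -
  let ?L = "A \<inter> {x. x \<bullet> i < s}" and ?R = "A \<inter> {x. s < x \<bullet> i}" and ?Z = "A \<inter> {x. x \<bullet> i = s}"
  have op: "open ?L" "open ?R" 
    using assms(2) by (auto intro!: open_Int open_Collect_less continuous_intros)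
  have b: "bounded ?L" "bounded ?R" using assms(3) by (meson bounded_Int)+
  have mL: "?L \<in> fmeasurable lborel" "?R \<in> fmeasurable lborel"
    using op b by (auto intro!: fmeasurableI emeasure_bounded_finite)
  have Z: "?Z \<in> null_sets lborel"
    by (rule null_sets_subset[OF null_hyperplane[OF assms(1), of s]]) (use assms(2) in auto)
  have "measure lborel A = measure lborel ((?L \<union> ?R) \<union> ?Z)" by (rule arg_cong[where f="measure lborel"]) auto
  also have "\<dots> = measure lborel (?L \<union> ?R)"
    by (rule measure_Un_null_set) (use op Z in auto)
  also have "\<dots> = measure lborel ?L + measure lborel ?R"
    by (rule measure_Un_AE[OF _ mL]) (auto)
  finally show ?thesis .
qed

text \<open>The measure below the hyperplane depends continuously on its position because
  hyperplanes are null (dominated convergence); it vanishes far to one side and is full far to the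
  other. It serves to cut the second set in the same proportion as the first.\<close>

lemma measure_halfspace_IVT:
  fixes B :: "'a::euclidean_space set"
  assumes i: "i \<in> Basis" and B: "open B" "bounded B" and \<theta>: "0 \<le> \<theta>" "\<theta> \<le> 1"
  shows "\<exists>r. measure lborel (B \<inter> {x. x \<bullet> i < r}) = \<theta> * measure lborel B"
proof -
  define f where "f r = measure lborel (B \<inter> {x. x \<bullet> i < r})" for r
  obtain M where M: "\<And>x. x \<in> B \<Longrightarrow> norm x \<le> M" using B(2) bounded_iff by blast
  have bi: "\<bar>x \<bullet> i\<bar> \<le> \<bar>M\<bar>" if "x \<in> B" for x
    using Basis_le_norm[OF i, of x] M[OF that] by linarith
  have fi: "f r = (\<integral>x. indicator (B \<inter> {x. x \<bullet> i < r}) x \<partial>lborel)" for r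
    unfolding f_def by simp
  have emB: "emeasure lborel B < \<infinity>" using B(2) by (rule emeasure_bounded_finite)
  have "isCont f r" for r
  proof (rule continuous_at_sequentiallyI)
    fix u assume u: "u \<longlonglongrightarrow> r"
    show "(\<lambda>n. f (u n)) \<longlonglongrightarrow> f r"
      unfolding fi
    proof (rule integral_dominated_convergence[where w="indicator B"])
      show "integrable lborel (indicator B :: 'a \<Rightarrow> real)" using emB B(1) by simp
      have "AE x in lborel. x \<bullet> i \<noteq> r" using AE_not_in[OF null_hyperplane[OF i, of r]] by simp
      thus "AE x in lborel. (\<lambda>n. indicator (B \<inter> {x. x \<bullet> i < u n}) x :: real) \<longlonglongrightarrow> indicator (B \<inter> {x. x \<bullet> i < r}) x"
      proof eventually_elim
        case (elim x)
        have "\<forall>\<^sub>F n in sequentially. indicator (B \<inter> {x. x \<bullet> i < u n}) x = (indicator (B \<inter> {x. x \<bullet> i < r}) x :: real)"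
        proof (cases "x \<bullet> i < r")
          case True
          have "\<forall>\<^sub>F n in sequentially. x \<bullet> i < u n" using order_tendstoD(1)[OF u True] .
          thus ?thesis by eventually_elim (use True in \<open>auto simp: indicator_def\<close>)
        next
          case False
          hence "r < x \<bullet> i" using elim by simp
          hence "\<forall>\<^sub>F n in sequentially. u n < x \<bullet> i" using order_tendstoD(2)[OF u] by blast
          thus ?thesis by eventually_elim (use False in \<open>auto simp: indicator_def\<close>)
        qed
        thus ?case by (rule tendsto_eventually)
      qed
    next
      have [measurable]: "B \<in> sets borel" using B(1) by simp
      show "indicator (B \<inter> {x. x \<bullet> i < r}) \<in> borel_measurable lborel"
        "\<And>n. indicator (B \<inter> {x. x \<bullet> i < u n}) \<in> borel_measurable lborel"
        by measurable
    qed (auto simp: indicator_def)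
  qed
  hence cont: "continuous_on {-\<bar>M\<bar> - 1..\<bar>M\<bar> + 1} f" by (simp add: continuous_at_imp_continuous_on)
  have e1: "B \<inter> {x. x \<bullet> i < - \<bar>M\<bar> - 1} = {}" using bi by fastforce
  have e2: "B \<inter> {x. x \<bullet> i < \<bar>M\<bar> + 1} = B" using bi by fastforce
  have f1: "f (-\<bar>M\<bar> - 1) = 0" unfolding f_def e1 by simp
  have f2: "f (\<bar>M\<bar> + 1) = measure lborel B" unfolding f_def e2 by simp
  have "\<exists>r. -\<bar>M\<bar> - 1 \<le> r \<and> r \<le> \<bar>M\<bar> + 1 \<and> f r = \<theta> * measure lborel B"
    by (rule IVT') (use cont f1 f2 \<theta> in \<open>auto simp: mult_left_le_one_le\<close>)
  thus ?thesis unfolding f_def by blast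
qed

text \<open>AM-GM for the factors \<open>x i / (x i + y i)\<close> and again for
  \<open>y i / (x i + y i)\<close>: the two arithmetic means add up to 1.\<close>

lemma box_root_superadditive:
  fixes x y :: "'i \<Rightarrow> real"
  assumes "finite I" "I \<noteq> {}" "\<And>i. i \<in> I \<Longrightarrow> 0 < x i" "\<And>i. i \<in> I \<Longrightarrow> 0 < y i"
  shows "root (card I) (\<Prod>i\<in>I. x i) + root (card I) (\<Prod>i\<in>I. y i) \<le> root (card I) (\<Prod>i\<in>I. x i + y i)"
proof -
  let ?n = "card I"
  have n: "?n > 0" using assms by (simp add: card_gt_0_iff)
  have P: "(\<Prod>i\<in>I. x i + y i) > 0" by (rule prod_pos) (use assms in \<open>auto intro: add_pos_pos\<close>)
  have gm: "root ?n (\<Prod>i\<in>I. z i / (x i + y i)) \<le> (\<Sum>i\<in>I. z i / (x i + y i) / ?n)"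
    if z: "\<And>i. i \<in> I \<Longrightarrow> 0 < z i" for z
  proof -
    have pos: "0 < z i / (x i + y i)" if "i \<in> I" for i
      using assms(3,4) z that by (auto intro!: divide_pos_pos add_pos_pos)
    have "(\<Prod>i\<in>I. z i / (x i + y i)) powr (1 / ?n) \<le> (\<Sum>i\<in>I. z i / (x i + y i) / ?n)"
      by (rule arith_geom_mean[OF assms(1,2)]) (use pos in \<open>simp add: less_imp_le\<close>)
    moreover have "(\<Prod>i\<in>I. z i / (x i + y i)) > 0" by (rule prod_pos) (use pos in auto)
    ultimately show ?thesis using n by (simp add: root_powr_inverse inverse_eq_divide)
  qed
  have "root ?n (\<Prod>i\<in>I. x i / (x i + y i)) + root ?n (\<Prod>i\<in>I. y i / (x i + y i))
      \<le> (\<Sum>i\<in>I. x i / (x i + y i) / ?n) + (\<Sum>i\<in>I. y i / (x i + y i) / ?n)"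
    by (intro add_mono gm) (use assms in auto)
  also have "\<dots> = (\<Sum>i\<in>I. 1 / ?n)"
    unfolding sum.distrib[symmetric]
  proof (rule sum.cong)
    fix i assume "i \<in> I"
    hence "x i + y i > 0" using assms by (auto intro: add_pos_pos)
    thus "x i / (x i + y i) / ?n + y i / (x i + y i) / ?n = 1 / ?n"
      by (simp add: add_divide_distrib[symmetric])
  qed simp
  also have "\<dots> = 1" using n by simp
  finally have *: "root ?n (\<Prod>i\<in>I. x i) / root ?n (\<Prod>i\<in>I. x i + y i) + root ?n (\<Prod>i\<in>I. y i) / root ?n (\<Prod>i\<in>I. x i + y i) \<le> 1"
    by (simp add: prod_dividef real_root_divide)
  have "root ?n (\<Prod>i\<in>I. x i + y i) > 0" using P n by simp
  thus ?thesis using * by (simp add: add_divide_distrib[symmetric])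
qed

section \<open>Minkowski sums of boxes and of finite unions of boxes\<close>

lemma open_msum: "open A \<Longrightarrow> open (msum A B)"
  by (rule open_sums) auto

lemma bounded_msum: "bounded A \<Longrightarrow> bounded B \<Longrightarrow> bounded (msum A B)"
  by (rule bounded_sums)

lemma msum_commute: "msum A B = msum B A"
  by (auto simp: add.commute)

lemma box_msum_superset:
  fixes a b c d :: "'a::euclidean_space"
  assumes "box a b \<noteq> {}" "box c d \<noteq> {}"
  shows "box (a + c) (b + d) \<subseteq> msum (box a b) (box c d)"
proof
  fix z assume z: "z \<in> box (a + c) (b + d)"
  have ab: "a \<bullet> i < b \<bullet> i" "c \<bullet> i < d \<bullet> i" if "i \<in> Basis" for i
    using assms that by (auto simp: box_ne_empty)
  \<comment> \<open>The relative position of \<open>z\<close> in the large box, coordinate by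
    coordinate; each summand is taken at the same relative position in its own box.\<close>
  define t where "t i = ((z - (a + c)) \<bullet> i) / ((b + d - (a + c)) \<bullet> i)" for i
  have den: "(b + d - (a + c)) \<bullet> i > 0" if "i \<in> Basis" for i
    using ab[OF that] by (simp add: inner_simps)
  have t: "0 < t i" "t i < 1" if "i \<in> Basis" for i
    using den[OF that] z that unfolding t_def by (auto simp: mem_box inner_simps)
  define x where "x = (\<Sum>i\<in>Basis. (a \<bullet> i + t i * (b \<bullet> i - a \<bullet> i)) *\<^sub>R i)"
  have x: "x \<bullet> i = a \<bullet> i + t i * (b \<bullet> i - a \<bullet> i)" if "i \<in> Basis" for i
    using that unfolding x_def by simp
  have "x \<in> box a b"
    unfolding mem_box
  proof
    fix i :: 'a assume i: "i \<in> Basis"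
    have "t i * (b \<bullet> i - a \<bullet> i) < 1 * (b \<bullet> i - a \<bullet> i)"
      using t[OF i] ab[OF i] by (intro mult_strict_right_mono) auto
    moreover have "0 < t i * (b \<bullet> i - a \<bullet> i)" using t[OF i] ab[OF i] by simp
    ultimately show "a \<bullet> i < x \<bullet> i \<and> x \<bullet> i < b \<bullet> i" using x[OF i] by simp
  qed
  moreover have "z - x \<in> box c d"
    unfolding mem_box
  proof
    fix i :: 'a assume i: "i \<in> Basis"
    have "t i * ((b + d - (a + c)) \<bullet> i) = (z - (a + c)) \<bullet> i"
      unfolding t_def using den[OF i] by simp
    hence "(z - x) \<bullet> i = c \<bullet> i + t i * (d \<bullet> i - c \<bullet> i)"
      using x[OF i] by (simp add: inner_simps algebra_simps)
    moreover have "t i * (d \<bullet> i - c \<bullet> i) < 1 * (d \<bullet> i - c \<bullet> i)"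
      using t[OF i] ab[OF i] by (intro mult_strict_right_mono) auto
    moreover have "0 < t i * (d \<bullet> i - c \<bullet> i)" using t[OF i] ab[OF i] by simp
    ultimately show "c \<bullet> i < (z - x) \<bullet> i \<and> (z - x) \<bullet> i < d \<bullet> i" by simp
  qed
  ultimately have "x + (z - x) \<in> msum (box a b) (box c d)" by blast
  thus "z \<in> msum (box a b) (box c d)" by simp
qed

lemma Brunn_Minkowski_box:
  fixes a b c d :: "'a::euclidean_space"
  assumes "box a b \<noteq> {}" "box c d \<noteq> {}"
  shows "(root DIM('a) (measure lborel (box a b)) + root DIM('a) (measure lborel (box c d))) ^ DIM('a)
    \<le> measure lborel (msum (box a b) (box c d))"
proof -
  have ab: "a \<bullet> i < b \<bullet> i" "c \<bullet> i < d \<bullet> i" if "i \<in> Basis" for i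
    using assms that by (auto simp: box_ne_empty)
  have m: "measure lborel (box u v) = (\<Prod>i\<in>Basis. (v - u) \<bullet> i)" if "\<And>i. i \<in> Basis \<Longrightarrow> u \<bullet> i < v \<bullet> i" for u v :: 'a
    using that by (subst measure_lborel_box_eq) (auto intro: less_imp_le)
  have sum: "(b + d - (a + c)) \<bullet> i = (b - a) \<bullet> i + (d - c) \<bullet> i" for i by (simp add: inner_simps)
  have "root DIM('a) (\<Prod>i\<in>Basis. (b - a) \<bullet> i) + root DIM('a) (\<Prod>i\<in>Basis. (d - c) \<bullet> i) \<le> root DIM('a) (\<Prod>i\<in>Basis. (b - a) \<bullet> i + (d - c) \<bullet> i)"
    by (rule box_root_superadditive) (use ab in \<open>auto simp: inner_simps\<close>)
  hence "root DIM('a) (measure lborel (box a b)) + root DIM('a) (measure lborel (box c d)) \<le> root DIM('a) (measure lborel (box (a + c) (b + d)))"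
    using ab by (subst (1 2 3) m) (auto simp: inner_add_left sum intro: add_strict_mono)
  hence "(root DIM('a) (measure lborel (box a b)) + root DIM('a) (measure lborel (box c d))) ^ DIM('a)
    \<le> root DIM('a) (measure lborel (box (a + c) (b + d))) ^ DIM('a)"
    by (intro power_mono) auto
  also have "\<dots> = measure lborel (box (a + c) (b + d))" by (simp add: real_root_pow_pos2)
  also have "\<dots> \<le> measure lborel (msum (box a b) (box c d))"
    by (intro measure_lborel_mono box_msum_superset assms open_msum bounded_msum) auto
  finally show ?thesis .
qed

text \<open>The argument of Hadwiger and Ohmann: a hyperplane that separates two boxes of one set
  leaves fewer boxes on each side, and a parallel hyperplane cuts the other set in the same
  proportion \<theta>. The sums of corresponding halves lie on opposite sides of a third parallel
  hyperplane, so their measures add; by homogeneity the two induction hypotheses contribute the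
  claim with weights \<theta> and 1 - \<theta>.\<close>

lemma Brunn_Minkowski_boxes:
  fixes A B :: "'a::euclidean_space set"
  assumes "box_union n A" "box_union m B" "A \<noteq> {}" "B \<noteq> {}"
  shows "(root DIM('a) (measure lborel A) + root DIM('a) (measure lborel B)) ^ DIM('a) \<le> measure lborel (msum A B)"
  using assms
proof (induction "n + m" arbitrary: n m A B rule: less_induct)
  case less
  \<comment> \<open>Stated for an arbitrary pair of sets, so that either of the two given sets can
    be the one that is cut between its boxes.\<close>
  have step: "(root DIM('a) (measure lborel A) + root DIM('a) (measure lborel B)) ^ DIM('a) \<le> measure lborel (msum A B)"
    if DA: "finite D" "pairwise disjnt D" "\<forall>X\<in>D. X \<noteq> {} \<and> (\<exists>a b. X = box a b)" "\<Union>D = A" "X1 \<in> D" "X2 \<in> D" "X1 \<noteq> X2"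
      "card D + m' \<le> n + m" and B: "box_union m' B" "B \<noteq> {}" for D X1 X2 m' and A B :: "'a set"
  proof -
    obtain a b c d where X: "X1 = box a b" "X2 = box c d" using DA by meson
    have ne: "X1 \<noteq> {}" "X2 \<noteq> {}" using DA by auto
    have "X1 \<inter> X2 = {}" using DA by (meson disjnt_def pairwiseD)
    then obtain i where i: "i \<in> Basis" "b \<bullet> i \<le> c \<bullet> i \<or> d \<bullet> i \<le> a \<bullet> i"
      using ne unfolding X disjoint_interval box_ne_empty by (meson not_le)
    obtain s Y1 Y2 where Y: "Y1 \<in> D" "Y2 \<in> D" "Y1 \<subseteq> {x. x \<bullet> i < s}" "Y2 \<subseteq> {x. s < x \<bullet> i}"
    proof (cases "b \<bullet> i \<le> c \<bullet> i")
      case True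
      have "X1 \<subseteq> {x. x \<bullet> i < b \<bullet> i}" "X2 \<subseteq> {x. b \<bullet> i < x \<bullet> i}"
        unfolding X using True i by (auto simp: mem_box intro: le_less_trans)
      thus ?thesis using that DA by blast
    next
      case False
      hence "d \<bullet> i \<le> a \<bullet> i" using i by simp
      hence "X2 \<subseteq> {x. x \<bullet> i < d \<bullet> i}" "X1 \<subseteq> {x. d \<bullet> i < x \<bullet> i}"
        unfolding X using i by (auto simp: mem_box intro: le_less_trans)
      thus ?thesis using that DA by blast
    qed
    have Yne: "Y1 \<noteq> {}" "Y2 \<noteq> {}" using Y DA by auto
    let ?L = "\<lambda>r. {x. x \<bullet> i < r}" and ?R = "\<lambda>r. {x. r < x \<bullet> i}"
    have opA: "open A" "bounded A" "open B" "bounded B"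
    proof -
      have "box_union (card D) A" unfolding box_union_def using DA by blast
      thus "open A" "bounded A" using box_union_open box_union_bounded by auto
    qed (use B box_union_open box_union_bounded in auto)
    have oh: "open (?L r)" "open (?R r)" for r by (auto intro!: open_Collect_less continuous_intros)
    have A1: "box_union (card D - 1) (A \<inter> ?L s)"
      using box_union_Int(2)[OF DA(1-3), of "?L s" Y2] box_Int_halfspace_less[OF i(1)] Y DA(4) by fastforce
    have A2: "box_union (card D - 1) (A \<inter> ?R s)"
      using box_union_Int(2)[OF DA(1-3), of "?R s" Y1] box_Int_halfspace_greater[OF i(1)] Y DA(4) by fastforce
    have Ane: "A \<inter> ?L s \<noteq> {}" "A \<inter> ?R s \<noteq> {}" using Y Yne DA(4) by blast+
    let ?mu = "measure (lborel :: 'a measure)"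
    have mA: "?mu A = ?mu (A \<inter> ?L s) + ?mu (A \<inter> ?R s)" by (rule measure_split_hyperplane) (use i opA in auto)
    have pos: "?mu (A \<inter> ?L s) > 0" "?mu (A \<inter> ?R s) > 0"
      using Ane opA oh by (auto intro!: measure_lborel_open_pos intro: bounded_Int)
    define \<theta> where "\<theta> = ?mu (A \<inter> ?L s) / ?mu A"
    have \<theta>: "0 < \<theta>" "\<theta> < 1" "?mu (A \<inter> ?L s) = \<theta> * ?mu A" "?mu (A \<inter> ?R s) = (1 - \<theta>) * ?mu A"
      using pos mA unfolding \<theta>_def by (auto simp: field_simps)
    obtain r where r: "?mu (B \<inter> ?L r) = \<theta> * ?mu B"
      using measure_halfspace_IVT[OF i(1) opA(3,4), of \<theta>] \<theta> by auto
    have r': "?mu (B \<inter> ?R r) = (1 - \<theta>) * ?mu B"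
      using measure_split_hyperplane[OF i(1) opA(3,4), of r] r by (simp add: algebra_simps)
    have mB: "?mu B > 0" using B opA measure_lborel_open_pos by blast
    have Bne: "B \<inter> ?L r \<noteq> {}" "B \<inter> ?R r \<noteq> {}"
    proof -
      have "?mu (B \<inter> ?L r) \<noteq> 0" "?mu (B \<inter> ?R r) \<noteq> 0" unfolding r r' using \<theta> mB by auto
      thus "B \<inter> ?L r \<noteq> {}" "B \<inter> ?R r \<noteq> {}" by auto
    qed
    have B1: "box_union m' (B \<inter> ?L r)" and B2: "box_union m' (B \<inter> ?R r)"
    proof -
      obtain E where E: "finite E" "card E \<le> m'" "pairwise disjnt E" "\<forall>X\<in>E. X \<noteq> {} \<and> (\<exists>a b. X = box a b)" "\<Union>E = B"
        using B(1) unfolding box_union_def by blast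
      have "box_union (card E) (B \<inter> ?L r)" "box_union (card E) (B \<inter> ?R r)"
        using box_union_Int(1)[OF E(1,3,4), of "?L r"] box_union_Int(1)[OF E(1,3,4), of "?R r"]
          box_Int_halfspace_less[OF i(1)] box_Int_halfspace_greater[OF i(1)] E(5) by fastforce+
      thus "box_union m' (B \<inter> ?L r)" "box_union m' (B \<inter> ?R r)"
        using E(2) unfolding box_union_def by (meson order_trans)+
    qed
    have cD: "card D > 0" using DA(1,5) by (auto simp: card_gt_0_iff)
    have lt: "(card D - 1) + m' < n + m" using cD DA(8) by linarith
    let ?N = "DIM('a)"
    have scale: "(root ?N (t * x) + root ?N (t * y)) ^ ?N = t * (root ?N x + root ?N y) ^ ?N" if "t \<ge> 0" for t x y :: real
      using that by (simp add: real_root_mult distrib_left[symmetric] power_mult_distrib real_root_pow_pos2 del: distrib_left_numeral)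
    have \<theta>': "0 \<le> 1 - \<theta>" using \<theta> by simp
    have 1: "\<theta> * (root ?N (?mu A) + root ?N (?mu B)) ^ ?N \<le> ?mu (msum (A \<inter> ?L s) (B \<inter> ?L r))"
      using less.hyps[OF lt A1 B1 Ane(1) Bne(1)] unfolding \<theta>(3) r scale[OF less_imp_le[OF \<theta>(1)]] .
    have 2: "(1 - \<theta>) * (root ?N (?mu A) + root ?N (?mu B)) ^ ?N \<le> ?mu (msum (A \<inter> ?R s) (B \<inter> ?R r))"
      using less.hyps[OF lt A2 B2 Ane(2) Bne(2)] unfolding \<theta>(4) r' scale[OF \<theta>'] .
    have sub: "msum (A \<inter> ?L s) (B \<inter> ?L r) \<subseteq> msum A B \<inter> ?L (s + r)" "msum (A \<inter> ?R s) (B \<inter> ?R r) \<subseteq> msum A B \<inter> ?R (s + r)"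
      by (auto simp: inner_add_left intro: add_strict_mono)
    have o: "open (msum A B)" "bounded (msum A B)" using opA open_msum bounded_msum by auto
    have "(root ?N (?mu A) + root ?N (?mu B)) ^ ?N \<le> ?mu (msum (A \<inter> ?L s) (B \<inter> ?L r)) + ?mu (msum (A \<inter> ?R s) (B \<inter> ?R r))"
      using 1 2 by (simp add: algebra_simps)
    also have "\<dots> \<le> ?mu (msum A B \<inter> ?L (s + r)) + ?mu (msum A B \<inter> ?R (s + r))"
      by (intro add_mono measure_lborel_mono sub open_msum open_Int o oh opA) (use o in \<open>auto intro: bounded_Int\<close>)
    also have "\<dots> = ?mu (msum A B)"
      using measure_split_hyperplane[OF i(1) o] by simp
    finally show ?thesis .
  qed
  obtain D where D: "finite D" "card D \<le> n" "pairwise disjnt D" "\<forall>X\<in>D. X \<noteq> {} \<and> (\<exists>a b. X = box a b)" "\<Union>D = A"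
    using less.prems(1) unfolding box_union_def by blast
  obtain E where E: "finite E" "card E \<le> m" "pairwise disjnt E" "\<forall>X\<in>E. X \<noteq> {} \<and> (\<exists>a b. X = box a b)" "\<Union>E = B"
    using less.prems(2) unfolding box_union_def by blast
  obtain X1 where X1: "X1 \<in> D" using less.prems(3) D(5) by blast
  obtain Y1 where Y1: "Y1 \<in> E" using less.prems(4) E(5) by blast
  show ?case
  proof (cases "\<exists>X2\<in>D. X2 \<noteq> X1")
    case True
    then obtain X2 where "X2 \<in> D" "X1 \<noteq> X2" by blast
    thus ?thesis using step[OF D(1,3-5) X1, of X2 m B] D(2) less.prems by simp
  next
    case nD: False
    show ?thesis
    proof (cases "\<exists>Y2\<in>E. Y2 \<noteq> Y1")
      case True
      then obtain Y2 where "Y2 \<in> E" "Y1 \<noteq> Y2" by blast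
      thus ?thesis using step[OF E(1,3-5) Y1, of Y2 n A] E(2) less.prems msum_commute[of A B] by (simp add: add.commute)
    next
      case False
      have "A = X1" "B = Y1" using nD False X1 Y1 D(5) E(5) by blast+
      moreover obtain a b c d where "X1 = box a b" "Y1 = box c d" using D(4) E(4) X1 Y1 by meson
      ultimately show ?thesis using Brunn_Minkowski_box[of a b c d] less.prems by simp
    qed
  qed
qed

text \<open>An open set is a countable union of closed boxes. Finitely many of them almost exhaust
  its measure; subdividing them into nonoverlapping boxes and discarding the faces gives disjoint
  open boxes without loss of measure.\<close>

lemma open_inner_box_union:
  fixes S :: "'a::euclidean_space set"
  assumes "open S" "bounded S" "\<epsilon> > 0"
  shows "\<exists>n A. box_union n A \<and> A \<subseteq> S \<and> measure lborel S - \<epsilon> < measure lborel A"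
proof -
  let ?mu = "measure (lborel :: 'a measure)"
  obtain \<D> where \<D>: "countable \<D>" "\<D> \<subseteq> Pow S" "\<And>X. X \<in> \<D> \<Longrightarrow> \<exists>a b. X = cbox a b" "\<Union>\<D> = S"
    using open_countable_Union_open_cbox[OF assms(1)] by metis
  obtain \<F> where \<F>: "finite \<F>" "\<F> \<subseteq> \<D>" "?mu S - \<epsilon> < ?mu (\<Union>\<F>)"
  proof (cases "\<D> = {}")
    case True
    thus ?thesis using that[of "{}"] \<D>(4) assms(3) by simp
  next
    case False
    let ?f = "from_nat_into \<D>"
    let ?U = "\<lambda>n. \<Union>i\<le>n. ?f i"
    have fD: "?f i \<in> \<D>" for i using False by (rule from_nat_into)
    have cb: "?f i \<in> sets lborel" for i using \<D>(3)[OF fD[of i]] by auto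
    have "(\<lambda>n. ?mu (?U n)) \<longlonglongrightarrow> ?mu (\<Union>n. ?U n)"
    proof (rule Lim_measure_incseq)
      show "range ?U \<subseteq> sets lborel" using cb by auto
      show "incseq ?U" by (intro incseq_SucI UN_mono) auto
      have "(\<Union>n. ?U n) \<subseteq> S" using fD \<D>(2) by blast
      hence "emeasure lborel (\<Union>n. ?U n) \<le> emeasure lborel S" using assms(1) by (intro emeasure_mono) auto
      thus "emeasure lborel (\<Union>n. ?U n) \<noteq> \<infinity>" using emeasure_bounded_finite[OF assms(2)] by (auto simp: top_unique)
    qed
    moreover have "(\<Union>n. ?U n) = S"
    proof -
      have "range ?f = \<D>" using False \<D>(1) by (rule range_from_nat_into)
      hence "(\<Union>n. ?f n) = S" using \<D>(4) by auto
      thus ?thesis by auto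
    qed
    ultimately have "(\<lambda>n. ?mu (?U n)) \<longlonglongrightarrow> ?mu S" by simp
    hence "\<forall>\<^sub>F n in sequentially. ?mu S - \<epsilon> < ?mu (?U n)" using assms(3) by (intro order_tendstoD) auto
    then obtain n where "?mu S - \<epsilon> < ?mu (?U n)" by (meson eventually_sequentially order_refl)
    thus ?thesis using that[of "?f ` {..n}"] fD by auto
  qed
  obtain p where p: "p division_of (\<Union>\<F>)"
    using elementary_unions_intervals[OF \<F>(1)] \<D>(3) \<F>(2) by (metis subsetD)
  define E where "E = interior ` p - {{}}"
  have fp: "finite p" using p by auto
  have ib: "\<exists>a b. X = cbox a b \<and> interior X = box a b" if "X \<in> p" for X
    using division_ofD(4)[OF p that] interior_cbox by blast
  have "finite E" using fp unfolding E_def by auto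
  moreover have "pairwise disjnt E"
  proof (rule pairwiseI)
    fix U V assume "U \<in> E" "V \<in> E" "U \<noteq> V"
    then obtain X Y where "X \<in> p" "Y \<in> p" "U = interior X" "V = interior Y" "X \<noteq> Y" unfolding E_def by blast
    thus "disjnt U V" using division_ofD(5)[OF p] by (auto simp: disjnt_def)
  qed
  moreover have "\<forall>X\<in>E. X \<noteq> {} \<and> (\<exists>a b. X = box a b)" using ib unfolding E_def by auto
  ultimately have bu: "box_union (card E) (\<Union>E)" unfolding box_union_def by blast
  have UE: "\<Union>E = (\<Union>X\<in>p. interior X)" unfolding E_def by auto
  have "\<Union>E \<subseteq> \<Union>p" unfolding UE using interior_subset by blast
  also have "\<Union>p \<subseteq> S" using division_ofD(6)[OF p] \<F>(2) \<D>(2) by blast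
  finally have sub: "\<Union>E \<subseteq> S" .
  have "(\<Union>X\<in>p. frontier X) \<in> null_sets lebesgue"
    unfolding negligible_iff_null_sets[symmetric]
  proof (intro negligible_Union)
    show "finite (frontier ` p)" using fp by simp
    fix T assume "T \<in> frontier ` p"
    then obtain X where "X \<in> p" "T = frontier X" by blast
    obtain a b where "X = cbox a b" using ib[OF \<open>X \<in> p\<close>] by blast
    thus "negligible T" using \<open>T = frontier X\<close> negligible_convex_frontier[OF convex_box(1)] by simp
  qed
  moreover have "(\<Union>X\<in>p. frontier X) \<in> sets lborel"
    using fp by (auto intro!: sets.finite_UN)
  ultimately have null: "(\<Union>X\<in>p. frontier X) \<in> null_sets lborel" by (simp add: null_sets_def)
  have "measure lborel (\<Union>\<F>) \<le> measure lborel (\<Union>E \<union> (\<Union>X\<in>p. frontier X))"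
  proof (rule measure_mono_fmeasurable)
    show "\<Union>\<F> \<subseteq> \<Union>E \<union> (\<Union>X\<in>p. frontier X)"
    proof
      fix x assume "x \<in> \<Union>\<F>"
      hence "x \<in> \<Union>p" using division_ofD(6)[OF p] by simp
      then obtain X where X: "X \<in> p" "x \<in> X" by blast
      hence "x \<in> interior X \<or> x \<in> frontier X"
        using closure_subset unfolding frontier_def by blast
      thus "x \<in> \<Union>E \<union> (\<Union>X\<in>p. frontier X)" unfolding UE using X(1) by blast
    qed
    show "\<Union>\<F> \<in> sets lborel"
    proof (rule sets.finite_Union[OF \<F>(1)], rule subsetI)
      fix X assume "X \<in> \<F>"
      then obtain a b where "X = cbox a b" using \<F>(2) \<D>(3) by blast
      thus "X \<in> sets lborel" by simp
    qed
    show "\<Union>E \<union> (\<Union>X\<in>p. frontier X) \<in> fmeasurable lborel"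
      using box_union_open[OF bu] box_union_bounded[OF bu] null
      by (intro fmeasurable.Un[OF fmeasurableI fmeasurableI_null_sets[OF null]] emeasure_bounded_finite) auto
  qed
  also have "\<dots> = measure lborel (\<Union>E)"
    by (rule measure_Un_null_set) (use box_union_open[OF bu] null in auto)
  finally show ?thesis using bu sub \<F>(3) by (meson less_le_trans)
qed

theorem Brunn_Minkowski_open:
  fixes A B :: "'a::euclidean_space set"
  assumes "open A" "bounded A" "A \<noteq> {}" "open B" "bounded B" "B \<noteq> {}"
  shows "(root DIM('a) (measure lborel A) + root DIM('a) (measure lborel B)) ^ DIM('a) \<le> measure lborel (msum A B)"
proof -
  let ?mu = "measure (lborel :: 'a measure)"
  have pos: "?mu A > 0" "?mu B > 0" using assms measure_lborel_open_pos by auto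
  have "(root DIM('a) (?mu A - \<epsilon>) + root DIM('a) (?mu B - \<epsilon>)) ^ DIM('a) \<le> ?mu (msum A B)"
    if \<epsilon>: "0 < \<epsilon>" "\<epsilon> < ?mu A" "\<epsilon> < ?mu B" for \<epsilon>
  proof -
    obtain n U where U: "box_union n U" "U \<subseteq> A" "?mu A - \<epsilon> < ?mu U"
      using open_inner_box_union[OF assms(1,2) \<epsilon>(1)] by blast
    obtain m V where V: "box_union m V" "V \<subseteq> B" "?mu B - \<epsilon> < ?mu V"
      using open_inner_box_union[OF assms(4,5) \<epsilon>(1)] by blast
    have ne: "U \<noteq> {}" "V \<noteq> {}" using U V \<epsilon> by auto
    have "(root DIM('a) (?mu A - \<epsilon>) + root DIM('a) (?mu B - \<epsilon>)) ^ DIM('a) \<le> (root DIM('a) (?mu U) + root DIM('a) (?mu V)) ^ DIM('a)"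
      using U V \<epsilon> by (intro power_mono add_mono) auto
    also have "\<dots> \<le> ?mu (msum U V)" by (rule Brunn_Minkowski_boxes) (use U V ne in auto)
    also have "\<dots> \<le> ?mu (msum A B)"
      using box_union_open[OF U(1)] assms U V by (intro measure_lborel_mono open_msum bounded_msum) auto
    finally show ?thesis .
  qed
  hence "\<forall>\<^sub>F \<epsilon> in at_right 0. (root DIM('a) (?mu A - \<epsilon>) + root DIM('a) (?mu B - \<epsilon>)) ^ DIM('a) \<le> ?mu (msum A B)"
    using pos by (auto simp: eventually_at_right_field intro!: exI[of _ "min (?mu A) (?mu B)"])
  moreover have "((\<lambda>\<epsilon>. (root DIM('a) (?mu A - \<epsilon>) + root DIM('a) (?mu B - \<epsilon>)) ^ DIM('a)) \<longlongrightarrow>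
      (root DIM('a) (?mu A - 0) + root DIM('a) (?mu B - 0)) ^ DIM('a)) (at_right 0)"
    by (intro tendsto_intros)
  ultimately show ?thesis
    using tendsto_upperbound[of _ _ "at_right (0::real)"] by force
qed

section \<open>Distribution profiles\<close>

lemma power_tangent_le:
  fixes t A :: real
  assumes "0 \<le> t" "0 \<le> A"
  shows "A ^ n + real n * A ^ (n - 1) * (t - A) \<le> t ^ n"
proof (induction n)
  case (Suc n)
  show ?case
  proof (cases n)
    case (Suc k)
    have "A ^ Suc n + real (Suc n) * A ^ n * (t - A) + real n * A ^ (n - 1) * (t - A)\<^sup>2
        = t * (A ^ n + real n * A ^ (n - 1) * (t - A))"
      unfolding Suc by (simp add: algebra_simps power2_eq_square)
    also have "\<dots> \<le> t * t ^ n" using Suc.IH assms by (intro mult_left_mono)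
    finally show ?thesis using assms by (simp add: add_increasing2 le_diff_eq) (smt (verit) mult_nonneg_nonneg of_nat_0_le_iff zero_le_power zero_le_power2)
  qed simp
qed simp

text \<open>The term \<open>B ^ n\<close> beyond the tangent line is what converts a deviation from
  a chord into extra energy in \<open>broken_line_excess\<close>.\<close>

lemma power_add_ge:
  fixes A B :: real
  assumes "0 \<le> A" "0 \<le> B" "2 \<le> n"
  shows "A ^ n + real n * A ^ (n - 1) * B + B ^ n \<le> (A + B) ^ n"
  using assms(3)
proof (induction n rule: dec_induct)
  case base
  show ?case by (simp add: power2_eq_square algebra_simps)
next
  case (step n)
  then obtain k where k: "n = Suc k" by (metis Suc_le_D numeral_2_eq_2)
  have "A ^ Suc n + real (Suc n) * A ^ n * B + B ^ Suc n + (A * B ^ n + real n * A ^ (n - 1) * B\<^sup>2)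
     = (A + B) * (A ^ n + real n * A ^ (n - 1) * B + B ^ n)"
    unfolding k by (simp add: algebra_simps power2_eq_square)
  also have "\<dots> \<le> (A + B) * (A + B) ^ n" using step assms by (intro mult_left_mono) auto
  finally have "A ^ Suc n + real (Suc n) * A ^ n * B + B ^ Suc n + (A * B ^ n + real n * A ^ (n - 1) * B\<^sup>2) \<le> (A + B) ^ Suc n"
    by simp
  moreover have "0 \<le> A * B ^ n + real n * A ^ (n - 1) * B\<^sup>2" using assms by simp
  ultimately show ?case by (simp only: diff_Suc_1)
qed

text \<open>A crude Young inequality with an explicit constant. Beyond the threshold 1 + Q / c both
  t \<ge> Q / c and t \<ge> 1 hold, so that Q t \<le> c t^2 \<le> c t^n.\<close>

lemma young_power:
  fixes c Q t :: real
  assumes "0 < c" "0 \<le> Q" "0 \<le> t" "2 \<le> n"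
  shows "Q * t \<le> c * t ^ n + Q * (1 + Q / c)"
proof (cases "t \<le> 1 + Q / c")
  case True
  hence "Q * t \<le> Q * (1 + Q / c)" using assms by (intro mult_left_mono)
  thus ?thesis using assms by (smt (verit) mult_nonneg_nonneg zero_le_power)
next
  case False
  have q: "0 \<le> Q / c" using assms by simp
  hence t: "1 \<le> t" "Q / c \<le> t" using False by linarith+
  have "Q \<le> c * t" using t(2) assms by (simp add: field_simps)
  hence "Q * t \<le> c * t * t" using assms by (intro mult_right_mono) auto
  also have "\<dots> = c * t ^ 2" by (simp add: power2_eq_square)
  also have "\<dots> \<le> c * t ^ n" using assms t by (intro mult_left_mono power_increasing) auto
  finally show ?thesis using assms q by (smt (verit) mult_nonneg_nonneg)
qed

text \<open>Convexity of the power at the points x / (1 - \<theta>) and y / \<theta> with weights 1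
  - \<theta> and \<theta>. For small \<theta> the first coefficient is close to 1, which is how a
  strict inequality between constants is spent; for the best \<theta> it yields Minkowski's
  inequality.\<close>

lemma powr_add_split:
  fixes x y \<theta> p :: real
  assumes "0 \<le> x" "0 \<le> y" "0 < \<theta>" "\<theta> < 1" "1 \<le> p"
  shows "(x + y) powr p \<le> x powr p / (1 - \<theta>) powr (p - 1) + y powr p / \<theta> powr (p - 1)"
proof -
  have one: "1 \<le> 1 / z powr (p - 1)" if "0 < z" "z < 1" for z
    using that assms by (simp add: powr_le1)
  consider "x = 0" | "y = 0" | "0 < x" "0 < y" using assms by fastforce
  thus ?thesis
  proof cases
    case 1
    have "y powr p * 1 \<le> y powr p * (1 / \<theta> powr (p - 1))" by (intro mult_left_mono one) (use assms in auto)
    thus ?thesis using 1 assms by simp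
  next
    case 2
    have "x powr p * 1 \<le> x powr p * (1 / (1 - \<theta>) powr (p - 1))" by (intro mult_left_mono one) (use assms in auto)
    thus ?thesis using 2 assms by simp
  next
    case 3
    have "((1 - (1 - \<theta>)) *\<^sub>R (y / \<theta>) + (1 - \<theta>) *\<^sub>R (x / (1 - \<theta>))) powr p
       \<le> (1 - (1 - \<theta>)) * (y / \<theta>) powr p + (1 - \<theta>) * (x / (1 - \<theta>)) powr p"
      by (rule convex_onD[OF powr_convex[OF assms(5)]]) (use 3 assms in auto)
    moreover have "(1 - (1 - \<theta>)) *\<^sub>R (y / \<theta>) + (1 - \<theta>) *\<^sub>R (x / (1 - \<theta>)) = x + y" using assms by simp
    moreover have "z * (w / z) powr p = w powr p / z powr (p - 1)" if "0 < z" "0 < w" for z w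
      using that by (simp add: powr_divide powr_diff)
    ultimately show ?thesis using 3 assms by (simp add: add.commute)
  qed
qed

lemma power_add_split:
  fixes x y \<theta> :: real
  assumes "0 \<le> x" "0 \<le> y" "0 < \<theta>" "\<theta> < 1" "1 \<le> n"
  shows "(x + y) ^ n \<le> x ^ n / (1 - \<theta>) ^ (n - 1) + y ^ n / \<theta> ^ (n - 1)"
proof -
  have 1: "z powr real n = z ^ n" if "0 \<le> z" for z :: real using that assms(5) by (simp add: powr_realpow')
  have 2: "z powr (real n - 1) = z ^ (n - 1)" if "0 < z" for z :: real
    using that assms(5) by (subst powr_realpow[symmetric]) (auto simp: of_nat_diff)
  show ?thesis using powr_add_split[of x y \<theta> "real n"] assms by (simp add: 1 2)
qed

lemma ex_split_parameter:
  fixes x y :: real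
  assumes "0 < x" "x < y" "1 \<le> n"
  shows "\<exists>\<theta>. 0 < \<theta> \<and> \<theta> < 1 \<and> x / (1 - \<theta>) ^ (n - 1) \<le> y"
proof -
  \<comment> \<open>Chosen so that Bernoulli's inequality gives (1 - \<theta>)^(n-1) \<ge> 1 - (n-1)
    \<theta> \<ge> x / y.\<close>
  define \<theta> where "\<theta> = (1 - x / y) / real n"
  have r: "0 < x / y" "x / y < 1" using assms by auto
  have n: "real n \<ge> 1" using assms by simp
  have th: "0 < \<theta>" "\<theta> < 1"
    unfolding \<theta>_def using r n by (auto simp: field_simps)
  have "x / y \<le> 1 - real (n - 1) * \<theta>"
  proof -
    have "real (n - 1) * \<theta> \<le> real n * \<theta>" using th by (intro mult_right_mono) auto
    also have "\<dots> = 1 - x / y" unfolding \<theta>_def using n by simp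
    finally show ?thesis by simp
  qed
  also have "\<dots> = 1 + real (n - 1) * (- \<theta>)" by simp
  also have "\<dots> \<le> (1 + (- \<theta>)) ^ (n - 1)" by (rule Bernoulli_inequality) (use th in auto)
  finally have "x / y \<le> (1 - \<theta>) ^ (n - 1)" by simp
  hence "x / (1 - \<theta>) ^ (n - 1) \<le> y" using th assms by (simp add: field_simps)
  thus ?thesis using th by blast
qed

text \<open>By the capacity estimate an edge of horizontal length \<open>x\<close> (a difference of
  logarithms of the measure) and height \<open>z\<close> costs energy at least
  \<open>L * z ^ n / x ^ (n - 1)\<close>. If the intermediate point lies above the chord, the two
  edges cost more than the chord: expand both at the slope \<open>A\<close> of the chord; the linear
  terms cancel and the term \<open>B ^ n\<close> of the steeper edge remains. So the height above
  the chord is controlled by the excess energy.\<close>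

lemma broken_line_excess:
  fixes L x x2 z z2 e1 e2 :: real
  assumes "2 \<le> n" "0 < L" "0 < x" "0 < x2" "0 \<le> z" "0 \<le> z2"
    and e1: "L * z ^ n \<le> e1 * x ^ (n - 1)" and e2: "L * z2 ^ n \<le> e2 * x2 ^ (n - 1)"
    and z: "(z + z2) / (x + x2) * x < z"
  shows "L * (z - (z + z2) / (x + x2) * x) ^ n \<le> (e1 + e2 - L * (z + z2) ^ n / (x + x2) ^ (n - 1)) * x ^ (n - 1)"
proof -
  define A where "A = (z + z2) / (x + x2)"
  define B where "B = (z - A * x) / x"
  have X: "x + x2 > 0" using assms by simp
  have A: "A \<ge> 0" unfolding A_def using assms by simp
  have B: "B > 0" unfolding B_def using z assms by (simp add: A_def)
  have zx: "z = x * (A + B)" unfolding B_def using assms by (simp add: field_simps)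
  have Z: "z + z2 = A * (x + x2)" unfolding A_def using X by simp
  have pw: "y * t ^ n * y ^ (n - 1) = (y * t) ^ n" for y t :: real
    using assms(1) by (cases n) (auto simp: power_mult_distrib)
  have pwd: "y * t ^ n = (y * t) ^ n / y ^ (n - 1)" if "y > 0" for y t :: real
    using pw[of y t] that by (simp add: field_simps)
  have 1: "L * x * (A ^ n + n * A ^ (n - 1) * B + B ^ n) \<le> e1"
  proof -
    have "L * x * (A ^ n + n * A ^ (n - 1) * B + B ^ n) \<le> L * x * (A + B) ^ n"
      using power_add_ge[of A B n] A B assms by (intro mult_left_mono) auto
    also have "\<dots> = L * (z ^ n / x ^ (n - 1))" unfolding zx using pwd[of x "A + B"] assms(3) by (simp add: mult.assoc)
    also have "\<dots> \<le> e1" using e1 assms by (simp add: field_simps)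
    finally show ?thesis .
  qed
  have 2: "L * x2 * (A ^ n + n * A ^ (n - 1) * (z2 / x2 - A)) \<le> e2"
  proof -
    have "L * x2 * (A ^ n + n * A ^ (n - 1) * (z2 / x2 - A)) \<le> L * x2 * (z2 / x2) ^ n"
      using power_tangent_le[of "z2 / x2" A n] A assms by (intro mult_left_mono) auto
    also have "\<dots> = L * (z2 ^ n / x2 ^ (n - 1))" using pwd[of x2 "z2 / x2"] assms(4) by (simp add: mult.assoc)
    also have "\<dots> \<le> e2" using e2 assms by (simp add: field_simps)
    finally show ?thesis .
  qed
  \<comment> \<open>Both edges together rise as far as the chord: what the first gains over it, the
    second loses.\<close>
  have 3: "x2 * (z2 / x2 - A) = - (x * B)"
    using zx Z assms by (simp add: right_diff_distrib) (simp add: algebra_simps)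
  have "L * x2 * (A ^ n + n * A ^ (n - 1) * (z2 / x2 - A)) = L * x2 * A ^ n + L * n * A ^ (n - 1) * (x2 * (z2 / x2 - A))"
    by (simp add: algebra_simps)
  also have "\<dots> = L * x2 * A ^ n - L * n * A ^ (n - 1) * (x * B)" unfolding 3 by simp
  finally have "L * x * (A ^ n + n * A ^ (n - 1) * B + B ^ n) + (L * x2 * A ^ n - L * n * A ^ (n - 1) * (x * B)) \<le> e1 + e2"
    using 1 2 by linarith
  moreover have "L * x * (A ^ n + n * A ^ (n - 1) * B + B ^ n) + (L * x2 * A ^ n - L * n * A ^ (n - 1) * (x * B))
      = L * ((x + x2) * A ^ n) + L * (x * B ^ n)" by (simp add: algebra_simps)
  moreover have "(x + x2) * A ^ n = (z + z2) ^ n / (x + x2) ^ (n - 1)" using pwd[OF X, of A] Z by (simp add: mult.commute)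
  ultimately have "L * (x * B ^ n) \<le> e1 + e2 - L * (z + z2) ^ n / (x + x2) ^ (n - 1)" by simp
  hence "L * (x * B ^ n) * x ^ (n - 1) \<le> (e1 + e2 - L * (z + z2) ^ n / (x + x2) ^ (n - 1)) * x ^ (n - 1)"
    using assms by (intro mult_right_mono) auto
  moreover have "L * (x * B ^ n) * x ^ (n - 1) = L * (x * B) ^ n" using pw[of x B] by (simp add: mult.assoc)
  moreover have "x * B = z - A * x" unfolding B_def using assms by simp
  ultimately have "L * (z - A * x) ^ n \<le> (e1 + e2 - L * (z + z2) ^ n / (x + x2) ^ (n - 1)) * x ^ (n - 1)"
    by metis
  thus ?thesis unfolding A_def .
qed

text \<open>
  For a test function \<open>\<phi>\<close>, \<open>m t\<close> is the measure of \<open>{|\<phi>| \<ge> t}\<close>, \<open>e t\<close> the energy of \<open>min |\<phi>| t\<close>, \<open>nm t\<close> the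
  \<open>L\<^sup>p\<close> norm of \<open>min |\<phi>| t\<close> and \<open>wn s b\<close> that of the positive part of \<open>min |\<phi>| b - s\<close>; \<open>L\<close> stands for
  \<open>\<lambda>\<^sub>N\<^bsup>N-1\<^esup>\<close>, \<open>g\<close> for \<open>\<gamma>\<^sub>1\<close> and \<open>V\<close> for the measure of the domain. Stating these properties abstractly makes
  the constants below visibly independent of \<open>\<phi>\<close>.
\<close>
definition profile :: "nat \<Rightarrow> real \<Rightarrow> real \<Rightarrow> real \<Rightarrow> real \<Rightarrow> real \<Rightarrow> (real \<Rightarrow> real) \<Rightarrow> (real \<Rightarrow> real)
    \<Rightarrow> (real \<Rightarrow> real) \<Rightarrow> (real \<Rightarrow> real \<Rightarrow> real) \<Rightarrow> bool" where
  "profile N L g p D V m e nm wn \<longleftrightarrow>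
    (\<forall>s t. 0 \<le> s \<longrightarrow> s \<le> t \<longrightarrow> m t \<le> m s \<and> e s \<le> e t) \<and>
    (\<forall>t\<ge>0. 0 \<le> m t \<and> m t \<le> V \<and> 0 \<le> e t \<and> e t \<le> 1 \<and> 0 \<le> nm t \<and> g * nm t ^ N \<le> e t) \<and>
    (\<forall>a b. 0 \<le> a \<longrightarrow> a < b \<longrightarrow> 0 < m b \<longrightarrow> L * (b - a) ^ N \<le> (e b - e a) * (ln (m a) - ln (m b)) ^ (N - 1)) \<and>
    (\<forall>s b. 0 \<le> s \<longrightarrow> s \<le> b \<longrightarrow> nm b \<le> nm s + wn s b \<and> m s * s powr p \<le> nm b powr p \<and> 0 \<le> wn s b) \<and>
    (\<forall>s b A H. 0 \<le> s \<longrightarrow> s < b \<longrightarrow> 0 < A \<longrightarrow> 0 < H \<longrightarrow> (\<forall>c. s \<le> c \<longrightarrow> c \<le> b \<longrightarrow> m c \<le> A * exp (- ((c - s) / H)))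
       \<longrightarrow> wn s b \<le> D * A powr (1 / p) * H)"

lemma profileD:
  assumes "profile N L g p D V m e nm wn"
  shows "\<And>s t. 0 \<le> s \<Longrightarrow> s \<le> t \<Longrightarrow> m t \<le> m s" "\<And>s t. 0 \<le> s \<Longrightarrow> s \<le> t \<Longrightarrow> e s \<le> e t"
    "\<And>t. 0 \<le> t \<Longrightarrow> 0 \<le> m t" "\<And>t. 0 \<le> t \<Longrightarrow> m t \<le> V" "\<And>t. 0 \<le> t \<Longrightarrow> 0 \<le> e t" "\<And>t. 0 \<le> t \<Longrightarrow> e t \<le> 1"
    "\<And>t. 0 \<le> t \<Longrightarrow> 0 \<le> nm t" "\<And>t. 0 \<le> t \<Longrightarrow> g * nm t ^ N \<le> e t"
    "\<And>a b. 0 \<le> a \<Longrightarrow> a < b \<Longrightarrow> 0 < m b \<Longrightarrow> L * (b - a) ^ N \<le> (e b - e a) * (ln (m a) - ln (m b)) ^ (N - 1)"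
    "\<And>s b. 0 \<le> s \<Longrightarrow> s \<le> b \<Longrightarrow> nm b \<le> nm s + wn s b" "\<And>s b. 0 \<le> s \<Longrightarrow> s \<le> b \<Longrightarrow> m s * s powr p \<le> nm b powr p"
    "\<And>s b. 0 \<le> s \<Longrightarrow> s \<le> b \<Longrightarrow> 0 \<le> wn s b"
    "\<And>s b A H. 0 \<le> s \<Longrightarrow> s < b \<Longrightarrow> 0 < A \<Longrightarrow> 0 < H \<Longrightarrow> (\<And>c. s \<le> c \<Longrightarrow> c \<le> b \<Longrightarrow> m c \<le> A * exp (- ((c - s) / H)))
       \<Longrightarrow> wn s b \<le> D * A powr (1 / p) * H"
proof -
  note c = assms[unfolded profile_def]
  note c1 = c[THEN conjunct1] and c2 = c[THEN conjunct2, THEN conjunct1] and c3 = c[THEN conjunct2, THEN conjunct2, THEN conjunct1]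
    and c4 = c[THEN conjunct2, THEN conjunct2, THEN conjunct2, THEN conjunct1]
    and c5 = c[THEN conjunct2, THEN conjunct2, THEN conjunct2, THEN conjunct2]
  show "\<And>s t. 0 \<le> s \<Longrightarrow> s \<le> t \<Longrightarrow> m t \<le> m s" "\<And>s t. 0 \<le> s \<Longrightarrow> s \<le> t \<Longrightarrow> e s \<le> e t"
    using c1 by blast+
  show "\<And>t. 0 \<le> t \<Longrightarrow> 0 \<le> m t" "\<And>t. 0 \<le> t \<Longrightarrow> m t \<le> V" "\<And>t. 0 \<le> t \<Longrightarrow> 0 \<le> e t" "\<And>t. 0 \<le> t \<Longrightarrow> e t \<le> 1"
    "\<And>t. 0 \<le> t \<Longrightarrow> 0 \<le> nm t" "\<And>t. 0 \<le> t \<Longrightarrow> g * nm t ^ N \<le> e t"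
    using c2 by blast+
  show "\<And>a b. 0 \<le> a \<Longrightarrow> a < b \<Longrightarrow> 0 < m b \<Longrightarrow> L * (b - a) ^ N \<le> (e b - e a) * (ln (m a) - ln (m b)) ^ (N - 1)"
    using c3 by blast
  show "\<And>s b. 0 \<le> s \<Longrightarrow> s \<le> b \<Longrightarrow> nm b \<le> nm s + wn s b" "\<And>s b. 0 \<le> s \<Longrightarrow> s \<le> b \<Longrightarrow> m s * s powr p \<le> nm b powr p"
    "\<And>s b. 0 \<le> s \<Longrightarrow> s \<le> b \<Longrightarrow> 0 \<le> wn s b"
    using c4 by blast+
  show "\<And>s b A H. 0 \<le> s \<Longrightarrow> s < b \<Longrightarrow> 0 < A \<Longrightarrow> 0 < H \<Longrightarrow> (\<And>c. s \<le> c \<Longrightarrow> c \<le> b \<Longrightarrow> m c \<le> A * exp (- ((c - s) / H)))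
       \<Longrightarrow> wn s b \<le> D * A powr (1 / p) * H"
    using c5 by blast
qed

text \<open>All quantities are measured in the natural units \<open>b / P\<close>, in which the claim is Young's inequality.\<close>
lemma green_algebra:
  fixes b P X Z a y A s M D1 c1 c3 L C R1 :: real
  assumes n: "2 \<le> n" and pos: "0 < L" "0 < b" "0 < X" "0 < c1" "c1 \<le> 1" "0 < c3" "0 \<le> M" "0 \<le> D1" "0 \<le> a" "0 \<le> y" "0 \<le> C"
    and X: "c1 * P \<le> X" "X \<le> P - C" and A: "A = Z / X" "0 \<le> Z" "Z = b - s" "0 \<le> s"
    and s: "s \<le> M * a + D1 * (A + y)"
    and R1: "R1 = (1 / c1) ^ (n - 1)"
    and C: "real n * R1 * L * M * (1 + real n * R1 * L * M / c3) + real n * R1 * L * D1 / c1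
       + real n * R1 * L * D1 * (1 + real n * R1 * L * D1 / (L / 2)) + L / 2 / c1 ^ n \<le> L * C"
    and E: "c3 * a ^ n + L * y ^ n / 2 + L * Z ^ n / X ^ (n - 1) - L / 2 * A ^ n \<le> E"
  shows "L * b ^ n \<le> E * P ^ (n - 1)"
proof -
  define Q1 Q2 where "Q1 = real n * R1 * L * M" and "Q2 = real n * R1 * L * D1"
  have P: "P > 0" using X pos by linarith
  have R1pos: "R1 > 0" unfolding R1 using pos by simp
  have Q: "Q1 \<ge> 0" "Q2 \<ge> 0" unfolding Q1_def Q2_def using R1pos pos by auto
  \<comment> \<open>The length \<open>X\<close> falls short of \<open>P\<close> by at least
    \<open>C\<close>, so exchanging it for \<open>P\<close> gains the relative amount
    \<open>C / P\<close>. This gain, L * C * b^n / P, has to cover all losses.\<close>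
  define R where "R = (P / X) ^ (n - 1)"
  have PX: "1 + C / P \<le> P / X"
  proof -
    have "(1 + C / P) * X \<le> (1 + C / P) * (P - C)" using X pos P by (intro mult_left_mono) auto
    also have "\<dots> \<le> P" using P pos by (simp add: field_simps)
    finally show ?thesis using pos by (simp add: field_simps)
  qed
  have CP: "0 \<le> C / P" using pos P by simp
  have R: "1 + C / P \<le> R"
  proof -
    have "(P / X) ^ 1 \<le> R" unfolding R_def using PX CP n by (intro power_increasing) auto
    thus ?thesis using PX by simp
  qed
  have "P / X \<le> 1 / c1" using X pos by (simp add: field_simps)
  hence RR1: "R \<le> R1" unfolding R_def R1 using P pos by (intro power_mono) auto
  define a' y' A' where "a' = a * P / b" and "y' = y * P / b" and "A' = A * P / b"
  have nn: "0 \<le> a'" "0 \<le> y'" "0 \<le> A'" unfolding a'_def y'_def A'_def using pos P A by auto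
  \<comment> \<open>In the new units the slope \<open>A\<close> is bounded by a constant, so its
    terms go directly into the condition on \<open>C\<close>; the other two quantities are handled
    by \<open>young_power\<close>.\<close>
  have A'1: "A' \<le> 1 / c1"
  proof -
    have "A' = (Z / b) * (P / X)" unfolding A'_def A(1) by simp
    also have "\<dots> \<le> 1 * (1 / c1)" by (rule mult_mono) (use A pos P \<open>P / X \<le> 1 / c1\<close> in auto)
    finally show ?thesis by simp
  qed
  have unit: "v ^ n * P ^ (n - 1) = b ^ n / P * (v * P / b) ^ n" "b ^ (n - 1) * v = b ^ n / P * (v * P / b)" for v
  proof -
    obtain k where k: "n = Suc k" using n by (cases n) auto
    show "v ^ n * P ^ (n - 1) = b ^ n / P * (v * P / b) ^ n" "b ^ (n - 1) * v = b ^ n / P * (v * P / b)"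
      unfolding k using P pos by (simp_all add: field_simps power_mult_distrib)
  qed
  \<comment> \<open>Lowering the height from \<open>b\<close> to \<open>b - s\<close> costs at most
    the linear term of the tangent at \<open>b\<close>.\<close>
  have Zn: "b ^ n - n * b ^ (n - 1) * s \<le> Z ^ n"
    using power_tangent_le[of Z b n] A pos by (simp add: right_diff_distrib)
  have main: "b ^ n * (1 + C / P) - n * R1 * (b ^ (n - 1) * s) \<le> Z ^ n * R"
  proof -
    have "b ^ n * (1 + C / P) \<le> b ^ n * R" using R pos by (intro mult_left_mono) auto
    moreover have "n * (b ^ (n - 1) * s) * R \<le> n * (b ^ (n - 1) * s) * R1" using RR1 pos A by (intro mult_left_mono) auto
    moreover have "(b ^ n - n * b ^ (n - 1) * s) * R \<le> Z ^ n * R" using Zn R CP by (intro mult_right_mono) auto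
    ultimately show ?thesis by (simp add: algebra_simps)
  qed
  have sb: "n * R1 * L * (b ^ (n - 1) * s) \<le> b ^ n / P * (Q1 * a' + Q2 * A' + Q2 * y')"
  proof -
    have "n * R1 * L * (b ^ (n - 1) * s) \<le> n * R1 * L * (b ^ (n - 1) * (M * a + D1 * (A + y)))"
      using s R1pos pos by (intro mult_left_mono) auto
    also have "\<dots> = Q1 * (b ^ (n - 1) * a) + Q2 * (b ^ (n - 1) * A) + Q2 * (b ^ (n - 1) * y)"
      unfolding Q1_def Q2_def by (simp add: algebra_simps)
    also have "\<dots> = b ^ n / P * (Q1 * a' + Q2 * A' + Q2 * y')"
      unfolding unit a'_def y'_def A'_def by (simp add: algebra_simps)
    finally show ?thesis .
  qed
  have y1: "Q1 * a' \<le> c3 * a' ^ n + Q1 * (1 + Q1 / c3)" by (rule young_power) (use pos Q nn n in auto)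
  have y2: "Q2 * y' \<le> L / 2 * y' ^ n + Q2 * (1 + Q2 / (L / 2))" by (rule young_power) (use pos Q nn n in auto)
  have y3: "Q2 * A' \<le> Q2 / c1" using mult_left_mono[OF A'1 Q(2)] by simp
  have y4: "L / 2 * A' ^ n \<le> L / 2 / c1 ^ n"
  proof -
    have "A' ^ n \<le> (1 / c1) ^ n" using A'1 nn by (intro power_mono)
    thus ?thesis using pos by (simp add: power_divide field_simps)
  qed
  have "0 \<le> L * C + c3 * a' ^ n - Q1 * a' + L / 2 * y' ^ n - Q2 * y' - Q2 * A' - L / 2 * A' ^ n"
    using y1 y2 y3 y4 C unfolding Q1_def[symmetric] Q2_def[symmetric] by linarith
  hence "0 \<le> b ^ n / P * (L * C + c3 * a' ^ n - Q1 * a' + L / 2 * y' ^ n - Q2 * y' - Q2 * A' - L / 2 * A' ^ n)"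
    using P pos by (intro mult_nonneg_nonneg) auto
  hence fin: "0 \<le> L * (b ^ n * (C / P)) - b ^ n / P * (Q1 * a' + Q2 * A' + Q2 * y') + c3 * (a ^ n * P ^ (n - 1))
        + L / 2 * (y ^ n * P ^ (n - 1)) - L / 2 * (A ^ n * P ^ (n - 1))"
    unfolding unit a'_def[symmetric] y'_def[symmetric] A'_def[symmetric] by (simp add: algebra_simps)
  have ZR: "Z ^ n / X ^ (n - 1) * P ^ (n - 1) = Z ^ n * R" unfolding R_def by (simp add: power_divide)
  have "L * b ^ n \<le> L * (b ^ n * (1 + C / P) - n * R1 * (b ^ (n - 1) * s)) + c3 * (a ^ n * P ^ (n - 1))
        + L / 2 * (y ^ n * P ^ (n - 1)) - L / 2 * (A ^ n * P ^ (n - 1))"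
    using fin sb by (simp add: algebra_simps)
  also have "\<dots> \<le> L * (Z ^ n * R) + c3 * (a ^ n * P ^ (n - 1))
        + L / 2 * (y ^ n * P ^ (n - 1)) - L / 2 * (A ^ n * P ^ (n - 1))"
    using main pos by (intro add_right_mono diff_right_mono mult_left_mono) auto
  also have "\<dots> = (c3 * a ^ n + L * y ^ n / 2 + L * Z ^ n / X ^ (n - 1) - L / 2 * A ^ n) * P ^ (n - 1)"
    unfolding ZR[symmetric] by (simp add: algebra_simps)
  also have "\<dots> \<le> E * P ^ (n - 1)" using E P by (intro mult_right_mono) auto
  finally show ?thesis .
qed

text \<open>If the energy exceeds the required amount by the factor 1 / \<theta>, the subtraction is
  harmless. Otherwise the energy is of order \<open>b ^ N / PP ^ (N - 1)\<close> at most; this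
  forces the cut level below \<open>b / 2\<close> and makes the logarithm above the cut comparable
  with the whole. There the function is compared with the logarithm of constant slope, up to an
  excess \<open>\<delta>\<close>, and \<open>green_algebra\<close> balances gains and
  losses.\<close>

lemma truncated_energy_lower_bound:
  fixes g' g L p D V :: real
  assumes N: "2 \<le> N" and pos: "0 < L" "0 < g'" "g' < g" "1 < p" "0 \<le> D" "0 < V"
  shows "\<exists>C\<ge>1. \<forall>m e nm wn b. profile N L g p D V m e nm wn \<longrightarrow> 0 < b \<longrightarrow> 0 < m b \<longrightarrow>
    1 \<le> C - ln (m b) \<and> L * b ^ N \<le> (e b - g' * nm b ^ N) * (C - ln (m b)) ^ (N - 1)"
proof -
  \<comment> \<open>The fraction of the energy that survives the subtraction in any case, by the
    inequality with the constant \<open>g\<close>.\<close>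
  define \<theta> where "\<theta> = 1 - g' / g"
  define K where "K = L / \<theta>"
  define c1 where "c1 = \<theta> / 2 ^ N"
  define g2 where "g2 = (g' + g) / 2"
  define c3 where "c3 = g - g2"
  have g: "g > 0" using pos by simp
  have \<theta>: "0 < \<theta>" "\<theta> < 1" unfolding \<theta>_def using pos g by auto
  have K: "K > 0" unfolding K_def using pos \<theta> by simp
  have c1: "0 < c1" "c1 \<le> 1"
  proof -
    show "0 < c1" unfolding c1_def using \<theta> by simp
    have "(1::real) \<le> 2 ^ N" by simp
    hence "\<theta> \<le> 2 ^ N" using \<theta> by linarith
    thus "c1 \<le> 1" unfolding c1_def by simp
  qed
  have g2: "g' < g2" "g2 < g" and c3: "c3 > 0" unfolding c3_def g2_def using pos by auto
  obtain \<eta> where \<eta>: "0 < \<eta>" "\<eta> < 1" "g' / (1 - \<eta>) ^ (N - 1) \<le> g2"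
    using ex_split_parameter[of g' g2 N] pos g2 N by auto
  define C2 where "C2 = g' / \<eta> ^ (N - 1)"
  have C2: "C2 > 0" unfolding C2_def using pos \<eta> by simp
  define D1 where "D1 = D * exp 1"
  have D1: "D1 \<ge> 0" unfolding D1_def using pos by simp
  \<comment> \<open>Above the level \<open>M * v\<close> the set has measure at most
    \<open>M powr (- p)\<close>, which puts a factor 1 / M into the norm of the part above.
    \<open>M\<close> is so large that the N-th power of this norm, with its coefficient
    \<open>C2\<close>, costs at most \<open>L / 2 * A ^ N + \<delta> / 2\<close>.\<close>
  define M where "M = max 1 (2 ^ (N + 1) * C2 * D1 ^ N / L)"
  have M: "M \<ge> 1" unfolding M_def by simp
  have CM: "C2 * (D1 / M) ^ N * 2 ^ N \<le> L / 2"
  proof -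
    have "2 ^ (N + 1) * C2 * D1 ^ N / L \<le> M" unfolding M_def by simp
    also have "M \<le> M ^ N" using M N by (simp add: self_le_power)
    finally have "2 * (2 ^ N * C2 * D1 ^ N) \<le> M ^ N * L" using pos by (simp add: field_simps)
    moreover have "M ^ N > 0" using M by simp
    ultimately show ?thesis by (simp add: power_divide field_simps)
  qed
  define R1 where "R1 = (1 / c1) ^ (N - 1)"
  define C0 where "C0 = real N * R1 * L * M * (1 + real N * R1 * L * M / c3) + real N * R1 * L * D1 / c1
       + real N * R1 * L * D1 * (1 + real N * R1 * L * D1 / (L / 2)) + L / 2 / c1 ^ N"
  \<comment> \<open>Once \<open>PP\<close> is at least \<open>P0\<close>, the norm is so small
    against \<open>b\<close> that the cut level is at most \<open>b / 2\<close>; the summands of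
    \<open>C\<close> other than the first ensure that \<open>PP\<close> is this large.\<close>
  define P0 where "P0 = 1 + 2 ^ N * M ^ N * K / g"
  define C where "C = max 1 (C0 / L) + \<bar>ln V\<bar> + P0"
  have P0: "P0 \<ge> 1" unfolding P0_def using M K g by simp
  have C: "C \<ge> 1" "C - ln V \<ge> P0" "C0 / L \<le> C" unfolding C_def using P0 by linarith+
  have LC: "C0 \<le> L * C" using C(3) pos by (simp add: field_simps)
  have "1 \<le> C - ln (m b) \<and> L * b ^ N \<le> (e b - g' * nm b ^ N) * (C - ln (m b)) ^ (N - 1)"
    if prof: "profile N L g p D V m e nm wn" and b: "0 < b" "0 < m b" for m e nm wn b
  proof -
    note P = profileD[OF prof]
    define PP where "PP = C - ln (m b)"
    have "ln (m b) \<le> ln V" using P(4)[of b] b by (simp)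
    hence PP: "PP \<ge> P0" unfolding PP_def using C by linarith
    hence PP1: "PP \<ge> 1" using P0 by linarith
    define v where "v = nm b"
    have v: "v \<ge> 0" "g * v ^ N \<le> e b" unfolding v_def using P(7,8)[of b] b by auto
    have low: "\<theta> * e b \<le> e b - g' * v ^ N"
    proof -
      have "g' / g * (g * v ^ N) \<le> g' / g * e b" using v pos g by (intro mult_left_mono) auto
      thus ?thesis unfolding \<theta>_def using g by (simp add: algebra_simps)
    qed
    have "L * b ^ N \<le> (e b - g' * v ^ N) * PP ^ (N - 1)"
    proof (cases "L * b ^ N \<le> \<theta> * e b * PP ^ (N - 1)")
      case True
      also have "\<theta> * e b * PP ^ (N - 1) \<le> (e b - g' * v ^ N) * PP ^ (N - 1)"
        using low PP1 by (intro mult_right_mono) auto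
      finally show ?thesis .
    next
      case False
      hence eb: "e b * PP ^ (N - 1) < K * b ^ N" unfolding K_def using \<theta> by (simp add: field_simps)
      define s where "s = M * v"
      have s0: "s \<ge> 0" unfolding s_def using M v by simp
      have "s ^ N \<le> (b / 2) ^ N"
      proof -
        have "PP \<le> PP ^ (N - 1)" using PP1 N by (intro self_le_power) auto
        hence "2 ^ N * M ^ N * K / g \<le> PP ^ (N - 1)" using PP unfolding P0_def by linarith
        hence h: "2 ^ N * M ^ N * K \<le> PP ^ (N - 1) * g" using g by (simp add: field_simps)
        have pw: "PP ^ (N - 1) > 0" using PP1 by simp
        have "(2 * s) ^ N * g * PP ^ (N - 1) = 2 ^ N * M ^ N * (g * v ^ N) * PP ^ (N - 1)"
          unfolding s_def by (simp add: power_mult_distrib)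
        also have "\<dots> \<le> 2 ^ N * M ^ N * e b * PP ^ (N - 1)" using v M PP1 by (intro mult_right_mono mult_left_mono) auto
        also have "\<dots> \<le> 2 ^ N * M ^ N * (K * b ^ N)"
          using eb M by (simp add: mult.assoc)
        also have "\<dots> \<le> PP ^ (N - 1) * g * b ^ N" using h b by (simp add: mult.assoc[symmetric])
        finally have "(2 * s) ^ N \<le> b ^ N" using pw g by (simp add: mult.commute mult.left_commute)
        thus ?thesis by (simp add: power_divide power_mult_distrib field_simps)
      qed
      hence sb2: "s \<le> b / 2" by (rule power_mono_iff[THEN iffD1, rotated 3]) (use s0 b N in auto)
      hence sb: "s < b" using b by linarith
      have mb: "m c > 0" if "0 \<le> c" "c \<le> b" for c using P(1)[of c b] that b by linarith
      have vpos: "v > 0"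
      proof (rule ccontr)
        assume "\<not> v > 0"
        hence "m b * b powr p \<le> 0" using P(11)[of b b] b v unfolding v_def by simp
        moreover have "m b * b powr p > 0" using b by simp
        ultimately show False by linarith
      qed
      \<comment> \<open>Chebyshev's inequality at the cut level. Its consequence
        \<open>ln (m s) \<le> 0\<close> makes the logarithm above \<open>s\<close> shorter than
        \<open>PP\<close> by at least \<open>C\<close>, which is the gain exploited in
        \<open>green_algebra\<close>.\<close>
      have ms: "m s \<le> M powr (- p)"
      proof -
        have "m s * s powr p \<le> v powr p" using P(11)[of s b] s0 sb v_def by simp
        hence "m s * M powr p * v powr p \<le> 1 * v powr p" unfolding s_def using M v by (simp add: powr_mult mult.assoc)
        hence "m s * M powr p \<le> 1" using vpos by (simp add: mult_le_cancel_right)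
        thus ?thesis using M by (simp add: powr_minus field_simps)
      qed
      have "M powr (- p) \<le> 1" using M pos by (simp add: powr_le_one_le powr_minus ge_one_powr_ge_zero inverse_le_1_iff)
      hence lns: "ln (m s) \<le> 0" using ms mb[of s] s0 sb by simp
      define X where "X = ln (m s) - ln (m b)"
      define Z where "Z = b - s"
      have Z: "Z \<ge> b / 2" "Z > 0" unfolding Z_def using sb2 b by auto
      have X0: "X \<ge> 0" unfolding X_def using P(1)[of s b] s0 sb b by simp
      have XC: "X \<le> PP - C" unfolding X_def PP_def using lns by simp
      have cap: "L * Z ^ N \<le> (e b - e s) * X ^ (N - 1)" unfolding Z_def X_def using P(9)[of s b] s0 sb b by simp
      have es: "0 \<le> e s" "e s \<le> e b" using P(5)[of s] P(2)[of s b] s0 sb by auto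
      have X1: "c1 * PP \<le> X"
      proof -
        have "L * (b / 2) ^ N \<le> L * Z ^ N" using Z b pos by (intro mult_left_mono power_mono) auto
        also have "\<dots> \<le> e b * X ^ (N - 1)"
          using cap es X0 by (smt (verit) mult_right_mono zero_le_power)
        finally have "L * (b / 2) ^ N * PP ^ (N - 1) \<le> e b * PP ^ (N - 1) * X ^ (N - 1)"
          using PP1 by (simp add: mult_right_mono mult.assoc mult.left_commute)
        also have "\<dots> \<le> K * b ^ N * X ^ (N - 1)" using eb X0 by (intro mult_right_mono) auto
        finally have "b ^ N * (c1 * PP ^ (N - 1)) \<le> b ^ N * X ^ (N - 1)"
          unfolding K_def c1_def using pos \<theta> by (simp add: power_divide field_simps)
        hence "c1 * PP ^ (N - 1) \<le> X ^ (N - 1)" using b by simp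
        moreover have "c1 ^ (N - 1) \<le> c1 ^ 1" using c1 N by (intro power_decreasing) auto
        ultimately have "(c1 * PP) ^ (N - 1) \<le> X ^ (N - 1)"
          using PP1 by (smt (verit) mult_right_mono power_mult_distrib power_one_right zero_le_power)
        thus ?thesis by (rule power_mono_iff[THEN iffD1, rotated 3]) (use X0 N PP1 c1 in auto)
      qed
      have "0 < c1 * PP" using c1 PP1 by (intro mult_pos_pos) linarith+
      hence Xpos: "X > 0" using X1 by linarith
      define A where "A = Z / X"
      have A: "A > 0" unfolding A_def using Z Xpos by simp
      \<comment> \<open>The energy spent between \<open>s\<close> and \<open>b\<close> beyond that
        of the logarithmic profile of constant slope \<open>A\<close> with the same end points;
        \<open>y\<close> is the slope whose N-th power corresponds to it.\<close>
      define \<delta> where "\<delta> = e b - e s - L * Z ^ N / X ^ (N - 1)"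
      have \<delta>: "\<delta> \<ge> 0" unfolding \<delta>_def using cap Xpos by (simp add: field_simps)
      define y where "y = root N (\<delta> / L)"
      have y: "y \<ge> 0" "L * y ^ N = \<delta>"
        unfolding y_def using \<delta> pos N by (auto simp: real_root_pow_pos2)
      define H where "H = A + y"
      have H: "H > 0" unfolding H_def using A y by simp
      \<comment> \<open>A point below the chord from \<open>s\<close> to \<open>b\<close> decays at
        least at rate 1 / A; a point above it is paid for by the excess, through
        \<open>broken_line_excess\<close>. The factor \<open>exp 1\<close> comes from enlarging
        \<open>x\<close> to \<open>x + 1\<close>.\<close>
      have decay: "m c \<le> m s * exp 1 * exp (- ((c - s) / H))" if c: "s \<le> c" "c \<le> b" for c
      proof -
        define x where "x = ln (m s) - ln (m c)"
        define z where "z = c - s"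
        have mc: "m c > 0" "m s > 0" using mb[of c] mb[of s] c s0 by auto
        have x0: "x \<ge> 0" unfolding x_def using P(1)[of s c] c s0 mc by simp
        have "z \<le> H * (x + 1)"
        proof (cases "z \<le> A * x")
          case True
          also have "A * x \<le> H * (x + 1)" using A x0 y unfolding H_def by (intro mult_mono) auto
          finally show ?thesis .
        next
          case zA: False
          have z0: "z > 0" using zA A x0 by (smt (verit) mult_nonneg_nonneg)
          have "c \<noteq> b"
          proof
            assume "c = b"
            hence "z = Z" "x = X" unfolding z_def Z_def x_def X_def by auto
            thus False using zA unfolding A_def using Xpos by simp
          qed
          hence cb: "c < b" using c by simp
          have sc: "s < c" using z0 unfolding z_def by simp
          define x2 where "x2 = X - x"
          define z2 where "z2 = Z - z"
          have z2: "z2 > 0" unfolding z2_def Z_def z_def using cb by simp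
          have x2e: "x2 = ln (m c) - ln (m b)" unfolding x2_def x_def X_def by simp
          have x20: "x2 \<ge> 0" unfolding x2e using P(1)[of c b] cb s0 sc b by simp
          have cap1: "L * z ^ N \<le> (e c - e s) * x ^ (N - 1)"
            unfolding z_def x_def using P(9)[of s c] s0 sc mc by simp
          have cap2: "L * z2 ^ N \<le> (e b - e c) * x2 ^ (N - 1)"
            unfolding z2_def Z_def z_def x2e using P(9)[of c b] s0 sc cb b by simp
          have xp: "x > 0"
          proof (rule ccontr)
            assume "\<not> x > 0"
            hence "L * z ^ N \<le> 0" using cap1 x0 N by (simp add: zero_power)
            moreover have "L * z ^ N > 0" using pos z0 by simp
            ultimately show False by linarith
          qed
          have x2p: "x2 > 0"
          proof (rule ccontr)
            assume "\<not> x2 > 0"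
            hence "L * z2 ^ N \<le> 0" using cap2 x20 N by (simp add: zero_power)
            moreover have "L * z2 ^ N > 0" using pos z2 by simp
            ultimately show False by linarith
          qed
          have sums: "z + z2 = Z" "x + x2 = X" unfolding z2_def x2_def by auto
          have "(z + z2) / (x + x2) * x < z" using zA unfolding sums A_def by simp
          from broken_line_excess[OF N pos(1) xp x2p less_imp_le[OF z0] less_imp_le[OF z2] cap1 cap2 this]
          have "L * (z - A * x) ^ N \<le> \<delta> * x ^ (N - 1)"
            unfolding sums A_def \<delta>_def by (simp add: algebra_simps)
          also have "\<dots> = L * (y ^ N * x ^ (N - 1))" using y(2) by (simp add: mult.assoc)
          finally have "(z - A * x) ^ N \<le> y ^ N * x ^ (N - 1)" using pos by simp
          \<comment> \<open>Raising the degree from N - 1 to N makes the N-th root linear in the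
            logarithm; the shift by 1 keeps this valid for small \<open>x\<close>.\<close>
          also have "\<dots> \<le> y ^ N * (x + 1) ^ N"
          proof -
            have "x ^ (N - 1) \<le> (x + 1) ^ (N - 1)" using xp by (intro power_mono) auto
            also have "\<dots> \<le> (x + 1) ^ N" using xp by (intro power_increasing) auto
            finally show ?thesis using y by (intro mult_left_mono) auto
          qed
          finally have "(z - A * x) ^ N \<le> (y * (x + 1)) ^ N" by (simp add: power_mult_distrib)
          hence "z - A * x \<le> y * (x + 1)"
            by (rule power_mono_iff[THEN iffD1, rotated 3]) (use zA y xp N in auto)
          moreover have "A * x \<le> A * (x + 1)" using A by simp
          ultimately show ?thesis unfolding H_def by (simp add: distrib_right)
        qed
        hence "z / H - 1 \<le> x" using H by (simp add: field_simps)
        have "m c = m s * exp (- x)" unfolding x_def using mc by (simp add: exp_diff)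
        also have "\<dots> \<le> m s * exp (1 - z / H)" using \<open>z / H - 1 \<le> x\<close> mc by simp
        also have "\<dots> = m s * exp 1 * exp (- (z / H))" by (simp add: exp_diff exp_minus field_simps)
        finally show ?thesis unfolding z_def .
      qed
      define w where "w = wn s b"
      have w0: "w \<ge> 0" unfolding w_def using P(12)[of s b] s0 sb by simp
      have wle: "w \<le> D1 / M * H"
      proof -
        have "w \<le> D * (m s * exp 1) powr (1 / p) * H"
          unfolding w_def by (rule P(13)) (use s0 sb H mb[of s] decay in auto)
        also have "\<dots> \<le> D * (exp 1 / M) * H"
        proof (intro mult_right_mono mult_left_mono)
          have "(m s * exp 1) powr (1 / p) \<le> (M powr (- p) * exp 1) powr (1 / p)"
            using ms mb[of s] s0 sb pos by (intro powr_mono2) auto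
          also have "\<dots> = M powr (- 1) * exp 1 powr (1 / p)"
            using pos by (simp add: powr_mult powr_powr)
          also have "\<dots> \<le> M powr (- 1) * exp 1 powr 1" using pos by (intro mult_left_mono powr_mono) auto
          also have "\<dots> = exp 1 / M" using M by (simp add: powr_minus field_simps)
          finally show "(m s * exp 1) powr (1 / p) \<le> exp 1 / M" .
        qed (use pos H in auto)
        finally show ?thesis unfolding D1_def by simp
      qed
      define a where "a = nm s"
      have a: "a \<ge> 0" "g * a ^ N \<le> e s" unfolding a_def using P(7,8)[of s] s0 by auto
      have va: "v \<le> a + w" unfolding v_def a_def w_def using P(10)[of s b] s0 sb by simp
      \<comment> \<open>The cross terms of the splitting use up half of the gap between
        \<open>g'\<close> and \<open>g\<close>; the other half, \<open>c3\<close>, remains as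
        positive energy below the cut.\<close>
      have vN: "g' * v ^ N \<le> g2 * a ^ N + C2 * w ^ N"
      proof -
        have "v ^ N \<le> (a + w) ^ N" using va v by (intro power_mono)
        also have "\<dots> \<le> a ^ N / (1 - \<eta>) ^ (N - 1) + w ^ N / \<eta> ^ (N - 1)"
          by (rule power_add_split) (use a w0 \<eta> N in auto)
        finally have "g' * v ^ N \<le> g' * (a ^ N / (1 - \<eta>) ^ (N - 1) + w ^ N / \<eta> ^ (N - 1))"
          using pos by (intro mult_left_mono) auto
        also have "\<dots> = g' / (1 - \<eta>) ^ (N - 1) * a ^ N + C2 * w ^ N" unfolding C2_def by (simp add: algebra_simps)
        also have "\<dots> \<le> g2 * a ^ N + C2 * w ^ N" using \<eta>(3) a by (intro add_right_mono mult_right_mono) auto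
        finally show ?thesis .
      qed
      have wN: "C2 * w ^ N \<le> L / 2 * A ^ N + \<delta> / 2"
      proof -
        have "w ^ N \<le> (D1 / M * H) ^ N" using wle w0 by (intro power_mono)
        hence "w ^ N \<le> (D1 / M) ^ N * H ^ N" unfolding power_mult_distrib .
        hence "C2 * w ^ N \<le> C2 * ((D1 / M) ^ N * H ^ N)" using C2 by (intro mult_left_mono) auto
        hence "C2 * w ^ N \<le> C2 * (D1 / M) ^ N * H ^ N" by (simp only: mult.assoc)
        also have "\<dots> \<le> C2 * (D1 / M) ^ N * (2 ^ N * (A ^ N + y ^ N))"
        proof (intro mult_left_mono)
          have "H ^ N \<le> (2 * max A y) ^ N" unfolding H_def using A y by (intro power_mono) auto
          also have "\<dots> = 2 ^ N * (max A y) ^ N" by (simp add: power_mult_distrib)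
          also have "\<dots> \<le> 2 ^ N * (A ^ N + y ^ N)" using A y by (auto simp: max_def)
          finally show "H ^ N \<le> 2 ^ N * (A ^ N + y ^ N)" .
        qed (use C2 D1 M in auto)
        also have "\<dots> = (C2 * (D1 / M) ^ N * 2 ^ N) * (A ^ N + y ^ N)" by (simp add: mult.assoc)
        also have "\<dots> \<le> L / 2 * (A ^ N + y ^ N)" using CM A y by (intro mult_right_mono) auto
        finally show ?thesis using y(2) by (simp add: algebra_simps)
      qed
      show ?thesis
      proof (rule green_algebra[where s=s and M=M and ?D1.0=D1 and A=A and y=y and a=a and ?c1.0=c1 and ?c3.0=c3 and C=C and X=X and Z=Z and ?R1.0=R1, OF N pos(1) b(1) Xpos c1 c3])
        show "s \<le> M * a + D1 * (A + y)"
        proof -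
          have "s \<le> M * (a + w)" unfolding s_def using va M by (intro mult_left_mono) auto
          also have "M * w \<le> M * (D1 / M * H)" using wle M by (intro mult_left_mono) auto
          hence "M * (a + w) \<le> M * a + D1 * H" using M by (simp add: distrib_left)
          finally show ?thesis unfolding H_def .
        qed
        show "c3 * a ^ N + L * y ^ N / 2 + L * Z ^ N / X ^ (N - 1) - L / 2 * A ^ N \<le> e b - g' * v ^ N"
        proof -
          have "c3 * a ^ N = g * a ^ N - g2 * a ^ N" unfolding c3_def by (simp add: algebra_simps)
          moreover have "L * Z ^ N / X ^ (N - 1) = e b - e s - \<delta>" unfolding \<delta>_def by simp
          ultimately show ?thesis using a vN wN y(2) by linarith
        qed
        show "real N * R1 * L * M * (1 + real N * R1 * L * M / c3) + real N * R1 * L * D1 / c1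
          + real N * R1 * L * D1 * (1 + real N * R1 * L * D1 / (L / 2)) + L / 2 / c1 ^ N \<le> L * C"
          using LC unfolding C0_def .
      qed (use M D1 a y C X1 XC A_def Z Z_def s0 R1_def in auto)
    qed
    thus ?thesis using PP1 unfolding PP_def v_def by simp
  qed
  thus ?thesis using C(1) by blast
qed

text \<open>Group the terms by \<open>d\<close> rounded up: group j has at most
  \<open>A * j + B\<close> members, each at most exp (\<sigma> - \<sigma> j). The resulting series
  depends on \<sigma>, \<open>A\<close> and \<open>B\<close> alone.\<close>

lemma sum_exp_le_of_counting:
  fixes \<sigma> A B :: real
  assumes "0 < \<sigma>" "0 \<le> A" "0 \<le> B"
  shows "\<exists>Q. \<forall>(d :: nat \<Rightarrow> real) K. finite K \<longrightarrow> (\<forall>k\<in>K. 0 \<le> d k) \<longrightarrow>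
    (\<forall>j::nat. real (card {k\<in>K. d k \<le> real j}) \<le> A * real j + B) \<longrightarrow> (\<Sum>k\<in>K. exp (- (\<sigma> * d k))) \<le> Q"
proof -
  define h where "h j = (A * real j + B) * (exp \<sigma> * exp (- \<sigma>) ^ j)" for j
  have "norm (exp (- \<sigma>)) < 1" using assms by simp
  hence g: "summable (\<lambda>j. exp (- \<sigma>) ^ j)" by (rule summable_geometric)
  have "summable (\<lambda>j. real (Suc j) * exp (- \<sigma>) ^ j)"
    using geometric_deriv_sums[of "exp (- \<sigma>)"] \<open>norm (exp (- \<sigma>)) < 1\<close> by (auto simp: sums_iff)
  from summable_diff[OF this g] have "summable (\<lambda>j. real j * exp (- \<sigma>) ^ j)" by (simp add: algebra_simps)
  hence "summable (\<lambda>j. (A * exp \<sigma>) * (real j * exp (- \<sigma>) ^ j) + (B * exp \<sigma>) * exp (- \<sigma>) ^ j)"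
    using g by (intro summable_add summable_mult)
  hence sm: "summable h" unfolding h_def by (simp add: algebra_simps)
  have h0: "0 \<le> h j" for j unfolding h_def using assms by simp
  show ?thesis
  proof (intro exI[of _ "suminf h"] allI impI)
    fix d :: "nat \<Rightarrow> real" and K
    assume K: "finite K" "\<forall>k\<in>K. 0 \<le> d k" and cnt: "\<forall>j::nat. real (card {k\<in>K. d k \<le> real j}) \<le> A * real j + B"
    let ?g = "\<lambda>k. nat \<lceil>d k\<rceil>"
    have "(\<Sum>k\<in>K. exp (- (\<sigma> * d k))) = (\<Sum>j\<in>?g ` K. \<Sum>k\<in>{k\<in>K. ?g k = j}. exp (- (\<sigma> * d k)))"
      by (rule sum.image_gen[OF K(1)])
    also have "\<dots> \<le> (\<Sum>j\<in>?g ` K. h j)"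
    proof (rule sum_mono)
      fix j
      have "(\<Sum>k\<in>{k\<in>K. ?g k = j}. exp (- (\<sigma> * d k))) \<le> (\<Sum>k\<in>{k\<in>K. ?g k = j}. exp \<sigma> * exp (- \<sigma>) ^ j)"
      proof (rule sum_mono)
        fix k assume "k \<in> {k \<in> K. ?g k = j}"
        hence k: "k \<in> K" "?g k = j" by auto
        have "0 \<le> \<lceil>d k\<rceil>" using k K(2) by (simp add: less_le_trans[of "-1" 0])
        hence "real j = of_int \<lceil>d k\<rceil>" using k(2) by (metis of_nat_nat of_int_of_nat_eq)
        hence "real j - 1 \<le> d k" by linarith
        hence "\<sigma> * (real j - 1) \<le> \<sigma> * d k" using assms by (intro mult_left_mono) auto
        hence "exp (- (\<sigma> * d k)) \<le> exp (\<sigma> + real j * (- \<sigma>))" by (simp add: algebra_simps)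
        also have "\<dots> = exp \<sigma> * exp (- \<sigma>) ^ j" by (simp only: exp_add exp_of_nat_mult)
        finally show "exp (- (\<sigma> * d k)) \<le> exp \<sigma> * exp (- \<sigma>) ^ j" .
      qed
      also have "\<dots> = real (card {k\<in>K. ?g k = j}) * (exp \<sigma> * exp (- \<sigma>) ^ j)" by simp
      also have "\<dots> \<le> h j"
        unfolding h_def
      proof (rule mult_right_mono)
        have "card {k\<in>K. ?g k = j} \<le> card {k\<in>K. d k \<le> real j}"
        proof (rule card_mono)
          show "{k\<in>K. ?g k = j} \<subseteq> {k\<in>K. d k \<le> real j}"
            using real_nat_ceiling_ge by auto
        qed (use K(1) in simp)
        thus "real (card {k\<in>K. ?g k = j}) \<le> A * real j + B" using cnt[rule_format, of j] by linarith
      qed simp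
      finally show "(\<Sum>k\<in>{k\<in>K. ?g k = j}. exp (- (\<sigma> * d k))) \<le> h j" .
    qed
    also have "\<dots> \<le> suminf h" by (rule sum_le_suminf[OF sm]) (use K(1) h0 in auto)
    finally show "(\<Sum>k\<in>K. exp (- (\<sigma> * d k))) \<le> suminf h" .
  qed
qed

text \<open>With u = k / l this comes down to u \<le> ((1 + u) / 2)^2. Up to a scaling the two roots
  are the levels of the exponents k and l, so it bounds from below how far apart in height they
  are.\<close>

lemma root_power_diff_ge:
  fixes k l :: real
  assumes n: "2 \<le> n" and kl: "0 < k" "k < l"
  shows "((l - k) / 2) ^ n \<le> l * (root n (l ^ (n - 1)) - root n (k ^ (n - 1))) ^ n"
proof -
  define u where "u = k / l"
  have u: "0 < u" "u < 1" unfolding u_def using kl by auto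
  have "u ^ (n - 1) \<le> ((1 + u) / 2) ^ n"
  proof -
    have "u ^ (n - 1) = u * u ^ (n - 2)" using n by (metis Suc_diff_Suc diff_Suc_1 less_le_trans numeral_2_eq_2 power_Suc lessI Suc_1)
    also have "\<dots> \<le> ((1 + u) / 2) ^ 2 * ((1 + u) / 2) ^ (n - 2)"
    proof (rule mult_mono)
      have "0 \<le> (1 - u)\<^sup>2" by simp
      thus "u \<le> ((1 + u) / 2) ^ 2" by (simp add: power2_eq_square field_simps)
      show "u ^ (n - 2) \<le> ((1 + u) / 2) ^ (n - 2)" using u by (intro power_mono) auto
    qed (use u in auto)
    also have "\<dots> = ((1 + u) / 2) ^ n" using n by (metis le_add_diff_inverse power_add)
    finally show ?thesis .
  qed
  hence "root n (u ^ (n - 1)) \<le> root n (((1 + u) / 2) ^ n)" using n by simp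
  hence ru: "root n (u ^ (n - 1)) \<le> (1 + u) / 2" using n u by (simp add: real_root_power_cancel)
  define F where "F = root n (l ^ (n - 1))"
  have F: "F > 0" unfolding F_def using n kl by simp
  have "root n (k ^ (n - 1)) = root n (l ^ (n - 1) * u ^ (n - 1))"
    unfolding u_def using kl by (simp add: power_divide)
  also have "\<dots> = F * root n (u ^ (n - 1))" unfolding F_def by (simp add: real_root_mult)
  also have "\<dots> \<le> F * ((1 + u) / 2)" using ru F by (intro mult_left_mono) auto
  finally have "F * ((1 - u) / 2) \<le> F - root n (k ^ (n - 1))" by (simp add: field_simps)
  hence "(F * ((1 - u) / 2)) ^ n \<le> (F - root n (k ^ (n - 1))) ^ n" using F u by (intro power_mono) auto
  hence "l * (F * ((1 - u) / 2)) ^ n \<le> l * (F - root n (k ^ (n - 1))) ^ n" using kl by (intro mult_left_mono) auto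
  moreover have "l * (F * ((1 - u) / 2)) ^ n = ((l - k) / 2) ^ n"
  proof -
    have "F ^ n = l ^ (n - 1)" unfolding F_def using n kl by (simp add: real_root_pow_pos2)
    moreover have "l * l ^ (n - 1) = l ^ n" using n by (cases n) auto
    ultimately have "l * (F * t) ^ n = (l * t) ^ n" for t
      by (simp only: power_mult_distrib mult.assoc[symmetric])
    hence "l * (F * ((1 - u) / 2)) ^ n = (l * ((1 - u) / 2)) ^ n" .
    also have "l * ((1 - u) / 2) = (l - k) / 2" unfolding u_def using kl by (simp add: field_simps)
    finally show ?thesis .
  qed
  ultimately show ?thesis unfolding F_def by simp
qed

text \<open>The energy left above \<open>b\<close> limits how slowly the measure can decay there,
  hence the norm of the part above \<open>b\<close>; the smallness of \<open>m b\<close> supplies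
  the factor 1 / G.\<close>

lemma tail_norm_bound:
  assumes prof: "profile N L g p D V m e nm wn" and N: "2 \<le> N" and pos: "0 < L" "1 < p" "0 \<le> D"
    and b: "0 \<le> b" "b < Bm" "0 < m b" "m b \<le> (1 / G) powr p" "0 < G"
  shows "L * wn b Bm ^ N \<le> (D * exp 1 / G) ^ N * (1 - e b)"
proof (rule field_le_epsilon)
  note P = profileD[OF prof]
  fix \<epsilon> :: real assume \<epsilon>: "0 < \<epsilon>"
  define D' where "D' = D * exp 1 / G"
  have D': "D' \<ge> 0" unfolding D'_def using pos b by simp
  \<comment> \<open>The energy left may be 0, while the decay length \<open>H\<close> has to be
    positive; the enlargement contributes at most \<epsilon> in the end.\<close>
  define q where "q = 1 - e b + \<epsilon> / (D' ^ N + 1)"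
  have D1: "D' ^ N + 1 > 0" using D' by (simp add: add_nonneg_pos)
  have eb: "e b \<le> 1" using P(6)[of b] b by simp
  have q: "q > 0" "1 - e b \<le> q" unfolding q_def using \<epsilon> eb D1 by (auto intro: add_nonneg_pos)
  define H where "H = root N (q / L)"
  have H: "H > 0" "L * H ^ N = q" unfolding H_def using q pos N by (auto simp: real_root_pow_pos2)
  have w0: "0 \<le> wn b Bm" using P(12)[of b Bm] b by simp
  have decay: "m c \<le> m b * exp 1 * exp (- ((c - b) / H))" if c: "b \<le> c" "c \<le> Bm" for c
  proof (cases "m c > 0 \<and> b < c")
    case True
    define x where "x = ln (m b) - ln (m c)"
    have x: "x \<ge> 0" unfolding x_def using P(1)[of b c] c b True by simp
    have "L * (c - b) ^ N \<le> (e c - e b) * x ^ (N - 1)" unfolding x_def using P(9)[of b c] b c True by simp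
    also have "\<dots> \<le> q * x ^ (N - 1)" using P(6)[of c] b c q x by (intro mult_right_mono) auto
    also have "\<dots> \<le> q * (1 + x) ^ N"
    proof (intro mult_left_mono)
      have "x ^ (N - 1) \<le> (1 + x) ^ (N - 1)" using x by (intro power_mono) auto
      also have "\<dots> \<le> (1 + x) ^ N" using x by (intro power_increasing) auto
      finally show "x ^ (N - 1) \<le> (1 + x) ^ N" .
    qed (use q in auto)
    also have "\<dots> = L * (H * (1 + x)) ^ N" using H(2) by (simp add: power_mult_distrib mult.assoc)
    finally have "(c - b) ^ N \<le> (H * (1 + x)) ^ N" using pos by simp
    hence "c - b \<le> H * (1 + x)"
      by (rule power_mono_iff[THEN iffD1, rotated 3]) (use c H x N in auto)
    hence xz: "(c - b) / H - 1 \<le> x" using H by (simp add: field_simps)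
    have "m c = m b * exp (- x)" unfolding x_def using True b by (simp add: exp_diff)
    also have "\<dots> \<le> m b * exp (1 - (c - b) / H)" using xz b by simp
    also have "\<dots> = m b * exp 1 * exp (- ((c - b) / H))" by (simp add: exp_diff exp_minus field_simps)
    finally show ?thesis .
  next
    case False
    show ?thesis
    proof (cases "m c > 0")
      case True
      hence "c = b" using False c by simp
      thus ?thesis using b by simp
    next
      case False
      have "0 \<le> m b * exp 1 * exp (- ((c - b) / H))" using b by simp
      thus ?thesis using False by linarith
    qed
  qed
  have "wn b Bm \<le> D * (m b * exp 1) powr (1 / p) * H"
    by (rule P(13)) (use b H decay in auto)
  also have "\<dots> \<le> D * (exp 1 / G) * H"
  proof (intro mult_right_mono mult_left_mono)
    have "(m b * exp 1) powr (1 / p) \<le> ((1 / G) powr p * exp 1) powr (1 / p)"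
      using b pos by (intro powr_mono2) auto
    also have "\<dots> = (1 / G) powr 1 * exp 1 powr (1 / p)"
      using pos by (simp add: powr_mult powr_powr)
    also have "\<dots> \<le> (1 / G) powr 1 * exp 1 powr 1" using pos by (intro mult_left_mono powr_mono) auto
    also have "\<dots> = exp 1 / G" using b by simp
    finally show "(m b * exp 1) powr (1 / p) \<le> exp 1 / G" .
  qed (use pos H in auto)
  finally have "wn b Bm ^ N \<le> (D' * H) ^ N" unfolding D'_def using w0 by (intro power_mono) auto
  hence "L * wn b Bm ^ N \<le> L * (D' * H) ^ N" using pos by (intro mult_left_mono) auto
  also have "\<dots> = D' ^ N * q" using H(2) by (simp add: power_mult_distrib mult.left_commute)
  also have "\<dots> \<le> D' ^ N * (1 - e b) + \<epsilon>"
    unfolding q_def using \<epsilon> D1 by (simp add: field_simps)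
  finally show "L * wn b Bm ^ N \<le> (D * exp 1 / G) ^ N * (1 - e b) + \<epsilon>" unfolding D'_def .
qed

text \<open>The height at which the exponent, without its factor 1 - \<beta>/N, equals
  \<open>r\<close>, where \<Lambda> stands for
  \<open>lambdaN F ^ (N - 1) * (1 + \<gamma> * S ^ N)\<close> with \<open>S\<close> the norm: the
  equation is raised to the power N - 1 and solved.\<close>

definition level :: "nat \<Rightarrow> real \<Rightarrow> real \<Rightarrow> real" where
  "level N \<Lambda> r = root N (r ^ (N - 1) / \<Lambda>)"

text \<open>Write T = C - ln m at the level of r. Beyond an initial stretch r \<le> T, and the
  energy left there is at most of order (T - r) / r (\<open>stepA\<close>). With so little energy
  left, two levels with small T - r cannot be far apart (\<open>stepB\<close>). Hence O(1 + \<tau>)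
  integers have a deficit of at most \<tau>, and the summands are, up to a constant, exp (- \<sigma>
  times the deficit).\<close>

lemma profile_exp_sum_bounded:
  fixes \<gamma> g L p D V \<sigma> :: real
  assumes N: "2 \<le> N" and pos: "0 < L" "0 \<le> \<gamma>" "\<gamma> < g" "1 < p" "0 \<le> D" "0 < V" "0 < \<sigma>"
  shows "\<exists>Q. \<forall>m e nm wn Bm n. profile N L g p D V m e nm wn \<longrightarrow> 0 < Bm \<longrightarrow> (\<forall>t\<ge>Bm. m t = 0) \<longrightarrow>
    (\<Sum>k=1..n. (m (level N (L * (1 + \<gamma> * nm Bm ^ N)) (real k)) * exp (real k)) powr \<sigma>) \<le> Q"
proof -
  define g' where "g' = (\<gamma> + g) / 2"
  have g': "0 < g'" "\<gamma> < g'" "g' < g" unfolding g'_def using pos by auto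
  obtain C where C: "C \<ge> 1" and CK: "\<And>m e nm wn b. profile N L g p D V m e nm wn \<Longrightarrow> 0 < b \<Longrightarrow> 0 < m b \<Longrightarrow>
    1 \<le> C - ln (m b) \<and> L * b ^ N \<le> (e b - g' * nm b ^ N) * (C - ln (m b)) ^ (N - 1)"
    using truncated_energy_lower_bound[OF N pos(1) g'(1,3) pos(4-6)] by blast
  \<comment> \<open>The midpoint of \<open>\<gamma>\<close> and \<open>g'\<close> in place of
    \<open>\<gamma>\<close> keeps the argument of \<open>ex_split_parameter\<close> positive also
    when \<open>\<gamma>\<close> = 0.\<close>
  obtain \<eta> where \<eta>: "0 < \<eta>" "\<eta> < 1" "(\<gamma> + g') / 2 / (1 - \<eta>) ^ (N - 1) \<le> g'"
    using ex_split_parameter[of "(\<gamma> + g') / 2" g' N] pos g' N by auto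
  have \<eta>': "\<gamma> / (1 - \<eta>) ^ (N - 1) \<le> g'"
  proof -
    have "\<gamma> / (1 - \<eta>) ^ (N - 1) \<le> (\<gamma> + g') / 2 / (1 - \<eta>) ^ (N - 1)"
      using g' \<eta> by (intro divide_right_mono) auto
    thus ?thesis using \<eta>(3) by linarith
  qed
  \<comment> \<open>So large that, once the measure is below \<open>m0\<close>, the part of the norm
    above a level costs at most half of the energy left there.\<close>
  define G where "G = 1 + 2 * (\<gamma> / \<eta> ^ (N - 1)) * (D * exp 1) ^ N / L"
  have G: "G \<ge> 1" unfolding G_def using pos \<eta> by simp
  define m0 where "m0 = (1 / G) powr p"
  have m0: "m0 > 0" unfolding m0_def using G by simp
  \<comment> \<open>As long as the measure exceeds \<open>m0\<close>, the logarithm accumulated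
    since height 0 is at most \<open>W\<close>; since \<open>\<alpha>\<close> is at most 2, the
    exponent is then at most 2 * W. So every level beyond 2 * W has small measure.\<close>
  define W where "W = \<bar>ln V - ln m0\<bar>"
  have W: "0 \<le> W" unfolding W_def by simp
  define C6 where "C6 = 2 ^ N * (4 * (real N - 1)) * 2 ^ (N - 1)"
  have C6: "C6 \<ge> 1"
  proof -
    have "1 * 1 \<le> (2::real) ^ N * 2 ^ (N - 1)" by (intro mult_mono) auto
    moreover have "1 \<le> 4 * (real N - 1)" using N by simp
    ultimately have "1 * 1 \<le> (2 ^ N * 2 ^ (N - 1)) * (4 * (real N - 1))" by (intro mult_mono) auto
    thus ?thesis unfolding C6_def by (simp add: mult.commute mult.left_commute)
  qed
  \<comment> \<open>Shifts all deficits to nonnegative values, including those of the small levels,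
    where only the bound \<open>V\<close> for the measure is at hand.\<close>
  define C7 where "C7 = C + \<bar>ln V\<bar> + 2 * W"
  have C7: "C7 \<ge> 0" unfolding C7_def W_def using C by simp
  define A where "A = 4 * C6"
  define B where "B = 2 * W + 4 * C6 * C + 3"
  have AB: "A \<ge> 0" "B \<ge> 0" unfolding A_def B_def W_def using C6 C by auto
  obtain Q where Q: "\<And>(d :: nat \<Rightarrow> real) K. finite K \<Longrightarrow> (\<forall>k\<in>K. 0 \<le> d k) \<Longrightarrow>
    (\<forall>j::nat. real (card {k\<in>K. d k \<le> real j}) \<le> A * real j + B) \<Longrightarrow> (\<Sum>k\<in>K. exp (- (\<sigma> * d k))) \<le> Q"
    using sum_exp_le_of_counting[OF pos(7) AB] by blast
  have "(\<Sum>k=1..n. (m (level N (L * (1 + \<gamma> * nm Bm ^ N)) (real k)) * exp (real k)) powr \<sigma>) \<le> exp (\<sigma> * C7) * Q"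
    if prof: "profile N L g p D V m e nm wn" and Bm: "0 < Bm" "\<forall>t\<ge>Bm. m t = 0" for m e nm wn Bm n
  proof -
    note P = profileD[OF prof]
    define S where "S = nm Bm ^ N"
    define \<alpha> where "\<alpha> = 1 + \<gamma> * S"
    have S: "0 \<le> S" "g * S \<le> 1" unfolding S_def using P(6,7,8)[of Bm] Bm by auto
    have "\<gamma> * S \<le> g * S" using S pos by (intro mult_right_mono) auto
    hence \<alpha>: "1 \<le> \<alpha>" "\<alpha> \<le> 2" "0 \<le> \<gamma> * S" unfolding \<alpha>_def using S pos by auto
    define b where "b r = level N (L * \<alpha>) r" for r
    have bpow: "L * \<alpha> * b r ^ N = r ^ (N - 1)" if "0 \<le> r" for r
      unfolding b_def level_def using that pos \<alpha> N by (simp add: real_root_pow_pos2)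
    have b0: "b r > 0" if "0 < r" for r
      unfolding b_def level_def using that pos \<alpha> N by simp
    have bmono: "b r < b s" if "0 \<le> r" "r < s" for r s
    proof -
      have "r ^ (N - 1) < s ^ (N - 1)" using that N by (intro power_strict_mono) auto
      moreover have "0 < L * \<alpha>" using pos \<alpha> by simp
      ultimately show ?thesis unfolding b_def level_def using N by (simp add: divide_strict_right_mono)
    qed
    have bBm: "b r < Bm" if "m (b r) > 0" for r using that Bm by (smt (verit))
    have small: "m (b r) \<le> m0" if r: "2 * W < r" "m (b r) > 0" for r
    proof (rule ccontr)
      assume "\<not> m (b r) \<le> m0"
      hence gt: "m0 < m (b r)" by simp
      have "r > 0" using r W by linarith
      note br = b0[OF this]
      have "m (b r) \<le> m 0" "m 0 \<le> V" using P(1)[of 0 "b r"] P(4)[of 0] br by auto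
      hence "ln (m (b r)) \<le> ln (m 0)" "ln (m 0) \<le> ln V" "ln m0 \<le> ln (m (b r))" using r m0 gt by auto
      hence X: "0 \<le> ln (m 0) - ln (m (b r))" "ln (m 0) - ln (m (b r)) \<le> W" unfolding W_def by linarith+
      have "L * b r ^ N \<le> (e (b r) - e 0) * (ln (m 0) - ln (m (b r))) ^ (N - 1)"
        using P(9)[of 0 "b r"] br r by simp
      also have "\<dots> \<le> 1 * W ^ (N - 1)"
        using X P(5)[of 0] P(6)[of "b r"] br P(2)[of 0 "b r"] by (intro mult_mono power_mono) auto
      finally have "\<alpha> * (L * b r ^ N) \<le> \<alpha> * W ^ (N - 1)" using \<alpha> by (intro mult_left_mono) auto
      hence "r ^ (N - 1) \<le> \<alpha> * W ^ (N - 1)" using bpow[of r] \<open>r > 0\<close> by (simp add: mult_ac)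
      also have "\<dots> \<le> 2 ^ (N - 1) * W ^ (N - 1)"
      proof (intro mult_right_mono)
        have "(2::real) ^ 1 \<le> 2 ^ (N - 1)" using N by (intro power_increasing) auto
        thus "\<alpha> \<le> 2 ^ (N - 1)" using \<alpha>(2) by (simp only: power_one_right) 
      qed (use W_def in auto)
      finally have "r ^ (N - 1) \<le> (2 * W) ^ (N - 1)" by (simp add: power_mult_distrib)
      hence "r \<le> 2 * W" by (rule power_mono_iff[THEN iffD1, rotated 3]) (use N \<open>r > 0\<close> W_def in auto)
      thus False using r by simp
    qed
    have stepA: "r \<le> C - ln (m (b r))" "(1 - e (b r)) * r \<le> 2 * (real N - 1) * (C - ln (m (b r)) - r)"
      if r: "2 * W < r" "m (b r) > 0" for r
    proof -
      have r0: "r > 0" using r W by linarith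
      note br = b0[OF r0]
      define T where "T = C - ln (m (b r))"
      define q where "q = 1 - e (b r)"
      have q: "q \<ge> 0" unfolding q_def using P(6)[of "b r"] br by simp
      have T: "1 \<le> T" "L * b r ^ N \<le> (e (b r) - g' * nm (b r) ^ N) * T ^ (N - 1)"
        using CK[OF prof br r(2)] unfolding T_def by auto
      define w where "w = wn (b r) Bm"
      have w: "0 \<le> w" "L * w ^ N \<le> (D * exp 1 / G) ^ N * q"
        unfolding w_def q_def using P(12)[of "b r" Bm] bBm[OF r(2)] br
          tail_norm_bound[OF prof N pos(1,4,5), of "b r" Bm G] small[OF r] r(2) G unfolding m0_def by auto
      have nb: "0 \<le> nm (b r)" using P(7)[of "b r"] br by simp
      have "S \<le> (nm (b r) + w) ^ N"
        unfolding S_def w_def using P(10)[of "b r" Bm] P(7)[of Bm] Bm br bBm[OF r(2)] by (intro power_mono) auto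
      also have "\<dots> \<le> nm (b r) ^ N / (1 - \<eta>) ^ (N - 1) + w ^ N / \<eta> ^ (N - 1)"
        by (rule power_add_split) (use nb w \<eta> N in auto)
      finally have "\<gamma> * S \<le> \<gamma> * (nm (b r) ^ N / (1 - \<eta>) ^ (N - 1) + w ^ N / \<eta> ^ (N - 1))"
        using pos by (intro mult_left_mono) auto
      also have "\<dots> = \<gamma> / (1 - \<eta>) ^ (N - 1) * nm (b r) ^ N + \<gamma> / \<eta> ^ (N - 1) * w ^ N" by (simp add: algebra_simps)
      also have "\<dots> \<le> g' * nm (b r) ^ N + q / 2"
      proof (rule add_mono)
        show "\<gamma> / (1 - \<eta>) ^ (N - 1) * nm (b r) ^ N \<le> g' * nm (b r) ^ N"
          using \<eta>' nb by (intro mult_right_mono) auto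
        define E where "E = (\<gamma> / \<eta> ^ (N - 1)) * (D * exp 1) ^ N"
        have E: "E \<ge> 0" "2 * E / L \<le> G" unfolding E_def G_def using pos \<eta> by auto
        have "\<gamma> / \<eta> ^ (N - 1) * (L * w ^ N) \<le> \<gamma> / \<eta> ^ (N - 1) * ((D * exp 1 / G) ^ N * q)"
          using w(2) pos \<eta> by (intro mult_left_mono) auto
        also have "\<dots> = E / G ^ N * q" unfolding E_def by (simp add: power_divide)
        also have "\<dots> \<le> L / 2 * q"
        proof (rule mult_right_mono[OF _ q])
          have "G \<le> G ^ N" using G N by (intro self_le_power) auto
          hence "2 * E / L \<le> G ^ N" using E by linarith
          thus "E / G ^ N \<le> L / 2" using pos G by (simp add: field_simps)
        qed
        finally have "L * (\<gamma> / \<eta> ^ (N - 1) * w ^ N) \<le> L * (q / 2)" by (simp add: mult.left_commute mult.commute)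
        thus "\<gamma> / \<eta> ^ (N - 1) * w ^ N \<le> q / 2" using pos by (simp only: mult_le_cancel_left_pos)
      qed
      finally have gS: "\<gamma> * S \<le> g' * nm (b r) ^ N + q / 2" .
      \<comment> \<open>The factor \<open>\<alpha>\<close> = 1 + \<gamma> S is compensated by the
        subtracted \<gamma> S, and half of the energy left is kept.\<close>
      have "\<alpha> * (e (b r) - g' * nm (b r) ^ N) \<le> \<alpha> * (1 - q / 2 - \<gamma> * S)"
      proof (rule mult_left_mono)
        show "e (b r) - g' * nm (b r) ^ N \<le> 1 - q / 2 - \<gamma> * S" using gS unfolding q_def by (simp add: field_simps)
      qed (use \<alpha> in simp)
      also have "\<dots> = 1 - q / 2 - (\<gamma> * S) * (\<gamma> * S) - (\<gamma> * S) * q / 2" unfolding \<alpha>_def by (simp add: algebra_simps)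
      also have "\<dots> \<le> 1 - q / 2"
      proof -
        have "0 \<le> (\<gamma> * S) * (\<gamma> * S)" "0 \<le> (\<gamma> * S) * q" using \<alpha>(3) q by (auto intro: mult_nonneg_nonneg)
        thus ?thesis by linarith
      qed
      finally have aq: "\<alpha> * (e (b r) - g' * nm (b r) ^ N) \<le> 1 - q / 2" .
      have "r ^ (N - 1) = \<alpha> * (L * b r ^ N)" using bpow[of r] r0 by (simp add: mult_ac)
      also have "\<dots> \<le> \<alpha> * ((e (b r) - g' * nm (b r) ^ N) * T ^ (N - 1))" using T \<alpha> by (intro mult_left_mono) auto
      also have "\<dots> \<le> (1 - q / 2) * T ^ (N - 1)"
        unfolding mult.assoc[symmetric] using aq T by (intro mult_right_mono) auto
      finally have rT: "r ^ (N - 1) \<le> (1 - q / 2) * T ^ (N - 1)" .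
      also have "\<dots> \<le> 1 * T ^ (N - 1)" using q T by (intro mult_right_mono) auto
      finally have "r ^ (N - 1) \<le> T ^ (N - 1)" by simp
      hence "r \<le> T" by (rule power_mono_iff[THEN iffD1, rotated 3]) (use N r0 T in auto)
      thus "r \<le> C - ln (m (b r))" unfolding T_def .
      \<comment> \<open>Bernoulli's inequality turns the factor \<open>1 - q / 2\<close> between the
        powers into a linear gap between \<open>r\<close> and \<open>T\<close>.\<close>
      have "1 + real (N - 1) * (r / T - 1) \<le> (1 + (r / T - 1)) ^ (N - 1)"
        by (rule Bernoulli_inequality) (use r0 T in auto)
      also have "\<dots> = r ^ (N - 1) / T ^ (N - 1)" by (simp add: power_divide)
      also have "\<dots> \<le> 1 - q / 2" using rT T by (simp add: divide_le_eq)
      finally have "q / 2 \<le> real (N - 1) * (1 - r / T)" by (simp add: algebra_simps)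
      hence "q * T \<le> 2 * real (N - 1) * (T - r)" using T by (simp add: field_simps)
      moreover have "q * r \<le> q * T" using q \<open>r \<le> T\<close> by (intro mult_left_mono)
      ultimately show "(1 - e (b r)) * r \<le> 2 * (real N - 1) * (C - ln (m (b r)) - r)"
        unfolding q_def T_def using N by (simp add: of_nat_diff)
    qed
    \<comment> \<open>Between the two levels the energy is at most of order \<tau>2 / k and the
      logarithm is at most \<Delta> + \<tau>2. By \<open>root_power_diff_ge\<close> the difference
      in height would be too large for this if \<Delta> were much larger than \<tau>2.\<close>
    have stepB: "l - k \<le> 2 * C6 * (\<tau> + C)"
      if k: "2 * W < k" "2 * C6 * (\<tau> + C) \<le> k" "m (b k) > 0" "- ln (m (b k)) - k \<le> \<tau>"
        and l: "k < l" "m (b l) > 0" "- ln (m (b l)) - l \<le> \<tau>" and \<tau>: "0 \<le> \<tau>" for k l \<tau>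
    proof -
      define \<tau>2 where "\<tau>2 = \<tau> + C"
      have \<tau>2: "\<tau>2 \<ge> 1" unfolding \<tau>2_def using \<tau> C by simp
      have k0: "k > 0" using k W by linarith
      define \<Delta> where "\<Delta> = l - k"
      have \<Delta>: "\<Delta> > 0" unfolding \<Delta>_def using l by simp
      define q where "q = 1 - e (b k)"
      have q0: "q \<ge> 0" unfolding q_def using P(6)[of "b k"] b0[OF k0] by simp
      have qk: "q * k \<le> 2 * (real N - 1) * \<tau>2"
      proof -
        have "q * k \<le> 2 * (real N - 1) * (C - ln (m (b k)) - k)" using stepA(2)[OF k(1,3)] unfolding q_def .
        also have "\<dots> \<le> 2 * (real N - 1) * \<tau>2"
          using k(4) N unfolding \<tau>2_def by (intro mult_left_mono) auto
        finally show ?thesis .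
      qed
      define X where "X = ln (m (b k)) - ln (m (b l))"
      have bk: "b k > 0" "b k < b l" using b0[OF k0] bmono[of k l] k0 l by auto
      have X: "0 \<le> X" "X \<le> \<Delta> + \<tau>2"
        unfolding X_def \<Delta>_def \<tau>2_def using stepA(1)[OF k(1,3)] l(3) P(1)[of "b k" "b l"] bk l(2) by auto
      have "L * (b l - b k) ^ N \<le> (e (b l) - e (b k)) * X ^ (N - 1)"
        unfolding X_def using P(9)[of "b k" "b l"] bk l(2) by simp
      also have "\<dots> \<le> q * (\<Delta> + \<tau>2) ^ (N - 1)"
        using X P(6)[of "b l"] P(2)[of "b k" "b l"] bk q0 unfolding q_def by (intro mult_mono power_mono) auto
      finally have "\<alpha> * (L * (b l - b k) ^ N) * k \<le> \<alpha> * (q * (\<Delta> + \<tau>2) ^ (N - 1)) * k"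
        using \<alpha> k0 by (intro mult_right_mono mult_left_mono) auto
      also have "\<dots> = \<alpha> * (q * k) * (\<Delta> + \<tau>2) ^ (N - 1)" by (simp add: mult_ac)
      also have "\<dots> \<le> 2 * (2 * (real N - 1) * \<tau>2) * (\<Delta> + \<tau>2) ^ (N - 1)"
      proof (rule mult_right_mono)
        show "\<alpha> * (q * k) \<le> 2 * (2 * (real N - 1) * \<tau>2)"
          by (rule mult_mono[OF \<alpha>(2) qk]) (use q0 k0 in auto)
      qed (use \<Delta> \<tau>2 in simp)
      finally have up: "\<alpha> * (L * (b l - b k) ^ N) * k \<le> 4 * (real N - 1) * \<tau>2 * (\<Delta> + \<tau>2) ^ (N - 1)" by (simp add: mult_ac)
      have "(\<Delta> / 2) ^ N \<le> l * (root N (l ^ (N - 1)) - root N (k ^ (N - 1))) ^ N"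
        unfolding \<Delta>_def by (rule root_power_diff_ge[OF N k0 l(1)])
      also have "root N (l ^ (N - 1)) - root N (k ^ (N - 1)) = root N (L * \<alpha>) * (b l - b k)"
      proof -
        have "root N (r ^ (N - 1)) = root N (L * \<alpha>) * b r" for r
          unfolding b_def level_def real_root_mult[symmetric] using pos \<alpha> by simp
        thus ?thesis by (simp add: right_diff_distrib)
      qed
      also have "(root N (L * \<alpha>) * (b l - b k)) ^ N = L * \<alpha> * (b l - b k) ^ N"
        using pos \<alpha> N by (simp add: power_mult_distrib real_root_pow_pos2)
      finally have "(\<Delta> / 2) ^ N * k \<le> l * (L * \<alpha> * (b l - b k) ^ N) * k" using k0 by (intro mult_right_mono) auto
      also have "\<dots> = l * (\<alpha> * (L * (b l - b k) ^ N) * k)" by (simp add: mult_ac)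
      also have "\<dots> \<le> l * (4 * (real N - 1) * \<tau>2 * (\<Delta> + \<tau>2) ^ (N - 1))" using up l k0 by (intro mult_left_mono) auto
      finally have main: "\<Delta> ^ N * k \<le> 2 ^ N * (l * (4 * (real N - 1) * \<tau>2 * (\<Delta> + \<tau>2) ^ (N - 1)))"
        by (simp add: power_divide field_simps)
      show ?thesis
      proof (cases "\<Delta> \<le> \<tau>2")
        case True
        also have "\<tau>2 \<le> 2 * C6 * \<tau>2" using C6 \<tau>2 by simp
        finally show ?thesis unfolding \<Delta>_def \<tau>2_def .
      next
        case False
        have "(\<Delta> + \<tau>2) ^ (N - 1) \<le> (2 * \<Delta>) ^ (N - 1)" using False \<Delta> \<tau>2 by (intro power_mono) auto
        hence "2 ^ N * (l * (4 * (real N - 1) * \<tau>2 * (\<Delta> + \<tau>2) ^ (N - 1))) \<le> 2 ^ N * (l * (4 * (real N - 1) * \<tau>2 * (2 * \<Delta>) ^ (N - 1)))"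
          using l k0 N \<tau>2 by (intro mult_left_mono) auto
        also have "\<dots> = \<Delta> ^ (N - 1) * (C6 * \<tau>2 * l)" unfolding C6_def by (simp add: power_mult_distrib mult_ac)
        finally have "\<Delta> ^ N * k \<le> \<Delta> ^ (N - 1) * (C6 * \<tau>2 * l)" using main by linarith
        moreover have "\<Delta> ^ N * k = \<Delta> ^ (N - 1) * (\<Delta> * k)" using N by (cases N) auto
        ultimately have "\<Delta> * k \<le> C6 * \<tau>2 * l" using \<Delta> by simp
        also have "\<dots> = C6 * \<tau>2 * k + C6 * \<tau>2 * \<Delta>" unfolding \<Delta>_def by (simp add: algebra_simps)
        \<comment> \<open>Since \<open>k\<close> is at least 2 * C6 * \<tau>2, the contribution of l
          - k to \<open>l\<close> is absorbed by half of the left side.\<close>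
        also have "C6 * \<tau>2 * \<Delta> \<le> k / 2 * \<Delta>" using k(2) \<Delta> unfolding \<tau>2_def by (intro mult_right_mono) auto
        finally have "\<Delta> * k \<le> (2 * C6 * \<tau>2) * k" by (simp add: algebra_simps)
        hence "\<Delta> \<le> 2 * C6 * \<tau>2" using k0 by (simp only: mult_le_cancel_right_pos)
        thus ?thesis unfolding \<Delta>_def \<tau>2_def .
      qed
    qed
    define K where "K = {k \<in> {1..n}. m (b (real k)) > 0}"
    define d where "d k = - ln (m (b (real k))) - real k + C7" for k
    have finK: "finite K" unfolding K_def by simp
    have d0: "0 \<le> d k" if "k \<in> K" for k
    proof (cases "2 * W < real k")
      case True
      moreover have "m (b (real k)) > 0" using that unfolding K_def by simp
      ultimately have "real k \<le> C - ln (m (b (real k)))" by (rule stepA(1))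
      thus ?thesis using W unfolding d_def C7_def by linarith
    next
      case False
      have "m (b (real k)) \<le> V" "m (b (real k)) > 0" using P(4)[of "b (real k)"] b0[of "real k"] that unfolding K_def by auto
      hence "ln (m (b (real k))) \<le> ln V" by simp
      thus ?thesis using False C unfolding d_def C7_def by linarith
    qed
    have cnt: "real (card {k\<in>K. d k \<le> real j}) \<le> A * real j + B" for j
    proof -
      define I where "I = {k\<in>K. d k \<le> real j}"
      define \<tau> where "\<tau> = real j"
      have I: "m (b (real k)) > 0" "- ln (m (b (real k))) - real k \<le> \<tau>" if "k \<in> I" for k
        using that C7 unfolding I_def K_def d_def \<tau>_def by auto
      define R where "R = 2 * W + 2 * C6 * (\<tau> + C)"
      have R0: "0 \<le> R" "0 \<le> \<tau> + C" unfolding R_def \<tau>_def W_def using C6 C by auto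
      define rr where "rr = nat \<lfloor>R\<rfloor>"
      define dd where "dd = nat \<lfloor>2 * C6 * (\<tau> + C)\<rfloor>"
      \<comment> \<open>All such levels lie in the initial stretch or in one window that starts at
        the first of them beyond it, because \<open>stepB\<close> bounds the distance of any later
        one from that first one.\<close>
      have "\<exists>x. I \<subseteq> {..rr} \<union> {x..x + dd}"
      proof (cases "\<exists>k\<in>I. R < real k")
        case True
        define x where "x = (LEAST k. k \<in> I \<and> R < real k)"
        have x: "x \<in> I" "R < real x" using LeastI_ex[of "\<lambda>k. k \<in> I \<and> R < real k"] True unfolding x_def by auto
        have "k \<in> {..rr} \<union> {x..x + dd}" if k: "k \<in> I" for k
        proof (cases "R < real k")
          case True
          have xk: "x \<le> k" unfolding x_def by (rule Least_le) (use k True in simp)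
          have "real k - real x \<le> 2 * C6 * (\<tau> + C)"
          proof (cases "x = k")
            case True
            thus ?thesis using R0 C6 by simp
          next
            case False
            hence "real x < real k" using xk by simp
            moreover have "0 \<le> W" unfolding W_def by simp
            moreover have "0 \<le> 2 * C6 * (\<tau> + C)" using R0 C6 by simp
            ultimately show ?thesis
              using stepB[of "real x" \<tau> "real k"] x I[OF x(1)] I[OF k] unfolding R_def \<tau>_def by auto
          qed
          hence "real (k - x) \<le> 2 * C6 * (\<tau> + C)" using xk by (simp add: of_nat_diff)
          hence "k - x \<le> dd" unfolding dd_def by (simp add: le_nat_floor)
          thus ?thesis using xk by auto
        next
          case False
          hence "k \<le> rr" unfolding rr_def by (simp add: le_nat_floor)
          thus ?thesis by simp
        qed
        thus ?thesis by blast
      next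
        case False
        hence "I \<subseteq> {..rr}" unfolding rr_def by (auto simp: le_nat_floor not_less)
        thus ?thesis by blast
      qed
      then obtain x where x: "I \<subseteq> {..rr} \<union> {x..x + dd}" by blast
      have "card I \<le> card ({..rr} \<union> {x..x + dd})" by (rule card_mono[OF _ x]) simp
      also have "\<dots> \<le> card {..rr} + card {x..x + dd}" by (rule card_Un_le)
      also have "\<dots> = rr + dd + 2" by simp
      finally have "real (card I) \<le> real rr + real dd + 2" by linarith
      moreover have "real rr \<le> R" unfolding rr_def using R0 by simp
      moreover have "real dd \<le> 2 * C6 * (\<tau> + C)" unfolding dd_def using R0 C6 by simp
      ultimately show ?thesis
        unfolding I_def[symmetric] A_def B_def R_def \<tau>_def by (simp add: algebra_simps)
    qed
    have "(\<Sum>k=1..n. (m (b (real k)) * exp (real k)) powr \<sigma>) = (\<Sum>k\<in>K. (m (b (real k)) * exp (real k)) powr \<sigma>)"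
    proof (rule sum.mono_neutral_right)
      show "\<forall>k\<in>{1..n} - K. (m (b (real k)) * exp (real k)) powr \<sigma> = 0"
      proof
        fix k assume "k \<in> {1..n} - K"
        hence "m (b (real k)) = 0" using P(3)[of "b (real k)"] b0[of "real k"] unfolding K_def by force
        thus "(m (b (real k)) * exp (real k)) powr \<sigma> = 0" by simp
      qed
    qed (auto simp: K_def)
    also have "\<dots> = (\<Sum>k\<in>K. exp (\<sigma> * C7) * exp (- (\<sigma> * d k)))"
    proof (rule sum.cong)
      fix k assume "k \<in> K"
      hence mk: "m (b (real k)) > 0" unfolding K_def by simp
      have "(m (b (real k)) * exp (real k)) powr \<sigma> = exp (\<sigma> * (ln (m (b (real k))) + real k))"
        using mk by (simp add: powr_def ln_mult)
      also have "\<dots> = exp (\<sigma> * C7) * exp (- (\<sigma> * d k))"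
        unfolding d_def exp_add[symmetric] by (simp add: algebra_simps)
      finally show "(m (b (real k)) * exp (real k)) powr \<sigma> = exp (\<sigma> * C7) * exp (- (\<sigma> * d k))" .
    qed simp
    also have "\<dots> = exp (\<sigma> * C7) * (\<Sum>k\<in>K. exp (- (\<sigma> * d k)))" by (simp add: sum_distrib_left)
    also have "\<dots> \<le> exp (\<sigma> * C7) * Q"
      using Q[OF finK, of d] d0 cnt by (intro mult_left_mono) auto
    finally show ?thesis unfolding b_def \<alpha>_def S_def .
  qed
  thus ?thesis by blast
qed

section \<open>Wulff shapes\<close>

locale anisotropic =
  fixes F :: "'a::euclidean_space \<Rightarrow> real"
  assumes aniso: "anisotropic_F F"
begin

section \<open>The norm and its dual norm\<close>

lemma F_nonneg: "0 \<le> F x" and F_convex: "convex_on UNIV F" and F_even: "F (- x) = F x"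
  and F_scale_pos: "0 < t \<Longrightarrow> F (t *\<^sub>R x) = t * F x" and F_pos: "x \<noteq> 0 \<Longrightarrow> 0 < F x"
  using aniso unfolding anisotropic_F_def by auto

lemma F_0 [simp]: "F 0 = 0"
  using F_scale_pos[of 2 0] by simp

lemma F_scale: "0 \<le> t \<Longrightarrow> F (t *\<^sub>R x) = t * F x"
  using F_scale_pos[of t x] by (cases "t = 0") auto

lemma F_triangle: "F (x + y) \<le> F x + F y"
proof -
  have "F ((1 - 1/2) *\<^sub>R (2 *\<^sub>R x) + (1/2) *\<^sub>R (2 *\<^sub>R y)) \<le> (1 - 1/2) * F (2 *\<^sub>R x) + 1/2 * F (2 *\<^sub>R y)"
    by (rule convex_onD[OF F_convex]) auto
  thus ?thesis by (simp add: F_scale)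
qed

lemma F_continuous: "continuous_on UNIV F"
  by (rule convex_on_continuous[OF open_UNIV F_convex])

lemma F_measurable [measurable]: "F \<in> borel_measurable borel"
  using F_continuous by (rule borel_measurable_continuous_onI)

lemma F_bounds: "\<exists>c>0. \<exists>C>0. \<forall>x. c * norm x \<le> F x \<and> F x \<le> C * norm x"
proof -
  have cs: "compact (sphere (0::'a) 1)" and ne: "sphere (0::'a) 1 \<noteq> {}" by auto
  have con: "continuous_on (sphere 0 1) F" using F_continuous continuous_on_subset by blast
  obtain x0 where x0: "x0 \<in> sphere 0 1" "\<And>y. y \<in> sphere 0 1 \<Longrightarrow> F x0 \<le> F y"
    using continuous_attains_inf[OF cs ne con] by blast
  obtain x1 where x1: "x1 \<in> sphere 0 1" "\<And>y. y \<in> sphere 0 1 \<Longrightarrow> F y \<le> F x1"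
    using continuous_attains_sup[OF cs ne con] by blast
  have pos: "F x0 > 0" "F x1 > 0" using x0(1) x1(1) by (auto intro!: F_pos)
  have "F x0 * norm x \<le> F x \<and> F x \<le> F x1 * norm x" for x
  proof (cases "x = 0")
    case False
    have "F x = F (norm x *\<^sub>R (x /\<^sub>R norm x))" using False by simp
    also have "\<dots> = norm x * F (x /\<^sub>R norm x)" by (rule F_scale) simp
    finally show ?thesis using x0(2)[of "x /\<^sub>R norm x"] x1(2)[of "x /\<^sub>R norm x"] False
      by (simp add: mult.commute)
  qed simp
  thus ?thesis using pos by blast
qed

lemma Fo_bdd: "bdd_above ((\<lambda>\<xi>. x \<bullet> \<xi>) ` {\<xi>. F \<xi> \<le> 1})"
proof -
  obtain c where c: "c > 0" "\<And>x. c * norm x \<le> F x" using F_bounds by blast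
  show ?thesis
  proof (rule bdd_aboveI2)
    fix \<xi> assume "\<xi> \<in> {\<xi>. F \<xi> \<le> 1}"
    hence "norm \<xi> \<le> 1 / c" using c(2)[of \<xi>] c(1) by (simp add: field_simps)
    have "x \<bullet> \<xi> \<le> norm x * norm \<xi>" by (rule norm_cauchy_schwarz)
    also have "\<dots> \<le> norm x * (1 / c)" using \<open>norm \<xi> \<le> 1 / c\<close> by (intro mult_left_mono) auto
    finally show "x \<bullet> \<xi> \<le> norm x * (1 / c)" .
  qed
qed

lemma Fo_upper: "F \<xi> \<le> 1 \<Longrightarrow> x \<bullet> \<xi> \<le> Fo F x"
  unfolding Fo_def by (rule cSUP_upper[OF _ Fo_bdd]) simp

lemma Fo_least: "(\<And>\<xi>. F \<xi> \<le> 1 \<Longrightarrow> x \<bullet> \<xi> \<le> M) \<Longrightarrow> Fo F x \<le> M"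
  unfolding Fo_def by (rule cSUP_least) (auto intro!: exI[of _ 0])

lemma Fo_nonneg: "0 \<le> Fo F x"
  using Fo_upper[of 0 x] by simp

lemma inner_le_Fo_F: "x \<bullet> \<xi> \<le> Fo F x * F \<xi>"
proof (cases "\<xi> = 0")
  case False
  hence p: "F \<xi> > 0" by (rule F_pos)
  have "x \<bullet> (\<xi> /\<^sub>R F \<xi>) \<le> Fo F x" by (rule Fo_upper) (use p in \<open>simp add: F_scale\<close>)
  thus ?thesis using p by (simp add: field_simps)
qed simp

lemma Fo_even: "Fo F (- x) = Fo F x"
proof -
  have "Fo F (- x) \<le> Fo F x" for x
    by (rule Fo_least) (use Fo_upper[of "- _" x] F_even in force)
  from this[of x] this[of "- x"] show ?thesis by simp
qed

lemma abs_inner_le: "\<bar>x \<bullet> \<xi>\<bar> \<le> Fo F x * F \<xi>"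
  using inner_le_Fo_F[of x \<xi>] inner_le_Fo_F[of "- x" \<xi>] by (simp add: Fo_even)

lemma Fo_triangle: "Fo F (x + y) \<le> Fo F x + Fo F y"
  by (rule Fo_least) (simp add: inner_add_left add_mono Fo_upper)

lemma Fo_scale: assumes "0 < t" shows "Fo F (t *\<^sub>R x) = t * Fo F x"
proof -
  have le: "Fo F (t *\<^sub>R x) \<le> t * Fo F x" if "0 < t" for t x
    by (rule Fo_least) (use that Fo_upper in simp)
  have "Fo F x = Fo F ((1 / t) *\<^sub>R (t *\<^sub>R x))" using assms by simp
  also have "\<dots> \<le> (1 / t) * Fo F (t *\<^sub>R x)" by (rule le) (use assms in simp)
  finally have "t * Fo F x \<le> Fo F (t *\<^sub>R x)" using assms by (simp add: field_simps)
  thus ?thesis using le[OF assms, of x] by simp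
qed

lemma Fo_bounds: "\<exists>c>0. \<exists>C>0. \<forall>x. c * norm x \<le> Fo F x \<and> Fo F x \<le> C * norm x"
proof -
  obtain c C where c: "c > 0" "C > 0" "\<And>x. c * norm x \<le> F x" "\<And>x. F x \<le> C * norm x" using F_bounds by blast
  have "1 / C * norm x \<le> Fo F x" for x
  proof (cases "x = 0")
    case False
    have "norm x * norm x = x \<bullet> x" by (simp add: power2_norm_eq_inner[symmetric] power2_eq_square)
    also have "\<dots> \<le> Fo F x * F x" by (rule inner_le_Fo_F)
    also have "\<dots> \<le> Fo F x * (C * norm x)" using c Fo_nonneg by (intro mult_left_mono) auto
    finally have "norm x * norm x \<le> (Fo F x * C) * norm x" by (simp add: mult_ac)
    hence "norm x \<le> Fo F x * C" using False by simp
    thus ?thesis using c by (simp add: field_simps)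
  qed (simp add: Fo_nonneg)
  moreover have "Fo F x \<le> 1 / c * norm x" for x
  proof (rule Fo_least)
    fix \<xi> assume "F \<xi> \<le> 1"
    hence "norm \<xi> \<le> 1 / c" using c(3)[of \<xi>] c(1) by (simp add: field_simps)
    hence "norm x * norm \<xi> \<le> norm x * (1 / c)" by (intro mult_left_mono) auto
    thus "x \<bullet> \<xi> \<le> 1 / c * norm x" using norm_cauchy_schwarz[of x \<xi>] by (simp add: mult.commute)
  qed
  ultimately show ?thesis using c by (meson zero_less_divide_1_iff)
qed

lemma Fo_0 [simp]: "Fo F 0 = 0"
  using Fo_bounds by (metis mult_zero_right norm_zero order_antisym)

lemma Fo_continuous: "continuous_on UNIV (Fo F)"
proof -
  have "convex_on UNIV (Fo F)"
  proof (rule convex_onI)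
    fix t x y assume t: "0 < t" "t < (1::real)"
    have "Fo F ((1 - t) *\<^sub>R x + t *\<^sub>R y) \<le> Fo F ((1 - t) *\<^sub>R x) + Fo F (t *\<^sub>R y)" by (rule Fo_triangle)
    thus "Fo F ((1 - t) *\<^sub>R x + t *\<^sub>R y) \<le> (1 - t) * Fo F x + t * Fo F y" using t by (simp add: Fo_scale)
  qed simp
  thus ?thesis by (rule convex_on_continuous[OF open_UNIV])
qed

lemma Fo_measurable [measurable]: "Fo F \<in> borel_measurable borel"
  using Fo_continuous by (rule borel_measurable_continuous_onI)

section \<open>Wulff balls and their volume\<close>

definition Wulff :: "real \<Rightarrow> 'a set" where
  "Wulff r = {x. Fo F x < r}"

lemma Wulff_open: "open (Wulff r)"
  unfolding Wulff_def using Fo_continuous by (intro open_Collect_less continuous_intros)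

lemma Wulff_bounded: "bounded (Wulff r)"
proof -
  obtain c where c: "c > 0" "\<And>x. c * norm x \<le> Fo F x" using Fo_bounds by blast
  have "norm x \<le> r / c" if "x \<in> Wulff r" for x
    using c(2)[of x] that c(1) unfolding Wulff_def by (simp add: field_simps)
  thus ?thesis by (auto simp: bounded_iff)
qed

lemma zero_in_Wulff: "0 < r \<Longrightarrow> 0 \<in> Wulff r"
  unfolding Wulff_def by simp

lemma measure_Wulff_scale:
  assumes "0 < r"
  shows "measure lborel (Wulff r) = r ^ DIM('a) * measure lborel (Wulff 1)"
proof -
  have "Wulff r = (\<lambda>x. r *\<^sub>R x + 0) ` Wulff 1"
  proof (rule set_eqI)
    fix x
    have "x \<in> Wulff r \<longleftrightarrow> (1 / r) *\<^sub>R x \<in> Wulff 1"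
      unfolding Wulff_def using assms by (simp add: Fo_scale field_simps)
    also have "\<dots> \<longleftrightarrow> x \<in> (\<lambda>x. r *\<^sub>R x + 0) ` Wulff 1"
      using assms by (auto simp: image_iff intro!: bexI[of _ "(1 / r) *\<^sub>R x"])
    finally show "x \<in> Wulff r \<longleftrightarrow> x \<in> (\<lambda>x. r *\<^sub>R x + 0) ` Wulff 1" .
  qed
  hence "measure lebesgue (Wulff r) = \<bar>r\<bar> ^ DIM('a) * measure lebesgue (Wulff 1)"
    using measure_lebesgue_affine[of r 0 "Wulff 1"] by (simp add: add.commute)
  moreover have "measure lebesgue (Wulff s) = measure lborel (Wulff s)" for s
    using Wulff_open[of s] by (intro measure_completion) simp
  ultimately show ?thesis using assms by simp
qed

lemma measure_Wulff_pos: "0 < r \<Longrightarrow> 0 < measure lborel (Wulff r)"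
  using Wulff_open Wulff_bounded zero_in_Wulff by (intro measure_lborel_open_pos) auto

text \<open>The closed unit ball of the definition and the open one have the same measure: the
  closed ball lies in every dilate of the open one by a factor r > 1, and r tends to 1.\<close>

lemma kappa_eq: "kappa F = measure lborel (Wulff 1)"
proof -
  let ?K = "{x::'a. Fo F x \<le> 1}"
  have K: "?K \<in> sets borel" by measurable
  have fm: "Wulff r \<in> fmeasurable lborel" for r
    using Wulff_open Wulff_bounded by (intro fmeasurableI emeasure_bounded_finite) auto
  have ub: "measure lborel ?K \<le> r ^ DIM('a) * measure lborel (Wulff 1)" if "1 < r" for r
  proof -
    have "measure lborel ?K \<le> measure lborel (Wulff r)"
      by (rule measure_mono_fmeasurable[OF _ _ fm]) (use K that in \<open>auto simp: Wulff_def\<close>)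
    thus ?thesis using measure_Wulff_scale[of r] that by simp
  qed
  have "measure lborel ?K \<le> 1 ^ DIM('a) * measure lborel (Wulff 1)"
  proof (rule tendsto_lowerbound)
    show "((\<lambda>r. r ^ DIM('a) * measure lborel (Wulff 1)) \<longlongrightarrow> 1 ^ DIM('a) * measure lborel (Wulff 1)) (at_right 1)"
      by (intro tendsto_intros)
    show "\<forall>\<^sub>F r in at_right 1. measure lborel ?K \<le> r ^ DIM('a) * measure lborel (Wulff 1)"
      using ub by (auto simp: eventually_at_right_field intro!: exI[of _ 2])
  qed simp
  moreover have "measure lborel (Wulff 1) \<le> measure lborel ?K"
  proof (rule measure_mono_fmeasurable)
    have "?K \<subseteq> Wulff 2" unfolding Wulff_def by auto
    thus "?K \<in> fmeasurable lborel" by (rule fmeasurableI2[OF fm]) (use K in simp)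
  qed (use Wulff_open in \<open>auto simp: Wulff_def\<close>)
  moreover have "measure lebesgue ?K = measure lborel ?K" using K by (intro measure_completion) simp
  ultimately show ?thesis unfolding kappa_def by simp
qed

lemma kappa_pos: "0 < kappa F"
  unfolding kappa_eq by (rule measure_Wulff_pos) simp

lemma emeasure_Wulff: "0 < r \<Longrightarrow> emeasure lborel (Wulff r) = ennreal (r ^ DIM('a) * kappa F)"
  unfolding kappa_eq using measure_Wulff_scale[of r] emeasure_bounded_finite[OF Wulff_bounded, of r]
  by (simp add: emeasure_eq_ennreal_measure top.not_eq_extremum)

text \<open>The number \<open>N ^ N * kappa F\<close> is at the same time the N-th power of the
  isoperimetric constant \<open>N * root N (kappa F)\<close>; this coincidence makes the capacity
  estimate produce exactly the constant of the exponent.\<close>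

lemma lambdaN_power:
  assumes "2 \<le> DIM('a)"
  shows "0 < lambdaN F" "lambdaN F ^ (DIM('a) - 1) = real DIM('a) ^ DIM('a) * kappa F"
proof -
  let ?N = "real DIM('a)"
  show pos: "0 < lambdaN F" unfolding lambdaN_def Let_def using kappa_pos by simp
  have N1: "?N - 1 > 0" using assms by simp
  have "lambdaN F ^ (DIM('a) - 1) = lambdaN F powr (?N - 1)"
    using pos assms by (subst powr_realpow[symmetric]) (auto simp: of_nat_diff)
  also have "\<dots> = (?N powr (?N / (?N - 1))) powr (?N - 1) * (kappa F powr (1 / (?N - 1))) powr (?N - 1)"
    unfolding lambdaN_def Let_def by (subst powr_mult) auto
  also have "\<dots> = ?N powr ?N * kappa F powr 1" using N1 by (simp add: powr_powr)
  also have "\<dots> = ?N ^ DIM('a) * kappa F" using kappa_pos by (simp add: powr_realpow)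
  finally show "lambdaN F ^ (DIM('a) - 1) = real DIM('a) ^ DIM('a) * kappa F" .
qed

text \<open>The Brunn-Minkowski inequality with a Wulff ball, linearised by the tangent of the N-th
  power. In the perimeter term the measure of \<open>A\<close> is replaced by a lower bound
  \<open>\<mu>\<close>, so that later one constant serves all levels of a strip.\<close>

lemma Wulff_isoperimetric:
  assumes "open A" "bounded A" "A \<noteq> {}" "0 < h" "0 \<le> \<mu>" "\<mu> \<le> measure lborel A"
  shows "measure lborel A + h * (DIM('a) * root DIM('a) (kappa F) * root DIM('a) \<mu> ^ (DIM('a) - 1))
    \<le> measure lborel (msum A (Wulff h))"
proof -
  let ?N = "DIM('a)" and ?m = "measure lborel A"
  have rW: "root ?N (measure lborel (Wulff h)) = h * root ?N (kappa F)"
    unfolding kappa_eq measure_Wulff_scale[OF assms(4)] using assms(4) by (simp add: real_root_mult real_root_power_cancel)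
  have rm: "0 \<le> root ?N ?m" "0 \<le> root ?N (kappa F)" using kappa_pos by auto
  have "root ?N ?m ^ ?N + real ?N * root ?N ?m ^ (?N - 1) * (h * root ?N (kappa F))
     \<le> (root ?N ?m + h * root ?N (kappa F)) ^ ?N"
    using power_tangent_le[of "root ?N ?m + h * root ?N (kappa F)" "root ?N ?m" ?N] rm assms(4) by simp
  also have "\<dots> \<le> measure lborel (msum A (Wulff h))"
    using Brunn_Minkowski_open[OF assms(1-3) Wulff_open Wulff_bounded, of h] zero_in_Wulff[OF assms(4)] rW by force
  finally have "?m + real ?N * root ?N ?m ^ (?N - 1) * (h * root ?N (kappa F)) \<le> measure lborel (msum A (Wulff h))"
    by (simp add: real_root_pow_pos2)
  moreover have "real ?N * root ?N \<mu> ^ (?N - 1) * (h * root ?N (kappa F)) \<le> real ?N * root ?N ?m ^ (?N - 1) * (h * root ?N (kappa F))"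
    using assms rm by (intro mult_right_mono mult_left_mono power_mono) auto
  ultimately show ?thesis by (simp add: mult_ac)
qed

end

section \<open>Capacity of level sets\<close>

lemma smooth_on_differentiable: "smooth_on S f \<Longrightarrow> x \<in> S \<Longrightarrow> f differentiable (at x)"
  by (erule smooth_on.cases) auto

lemma smooth_on_partial: "smooth_on S f \<Longrightarrow> i \<in> Basis \<Longrightarrow> smooth_on S (\<lambda>x. frechet_derivative f (at x) i)"
  by (erule smooth_on.cases) auto

lemma grad_has_derivative:
  assumes "f differentiable (at x)"
  shows "(f has_derivative (\<lambda>h. grad f x \<bullet> h)) (at x)"
proof -
  have d: "(f has_derivative frechet_derivative f (at x)) (at x)"
    using assms frechet_derivative_works by blast
  then interpret bounded_linear "frechet_derivative f (at x)" by (rule has_derivative_bounded_linear)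
  have "frechet_derivative f (at x) h = grad f x \<bullet> h" for h
  proof -
    have "frechet_derivative f (at x) h = frechet_derivative f (at x) (\<Sum>i\<in>Basis. (h \<bullet> i) *\<^sub>R i)"
      by (simp add: euclidean_representation)
    also have "\<dots> = (\<Sum>i\<in>Basis. (h \<bullet> i) * frechet_derivative f (at x) i)"
      unfolding sum by (intro sum.cong refl) (simp add: scaleR)
    also have "\<dots> = grad f x \<bullet> h"
      unfolding grad_def inner_sum_left inner_scaleR_left
      by (intro sum.cong refl) (simp add: inner_commute mult.commute)
    finally show ?thesis .
  qed
  hence "frechet_derivative f (at x) = (\<lambda>h. grad f x \<bullet> h)" by (rule ext)
  thus ?thesis using d by simp
qed

lemma grad_unique:
  assumes "(f has_derivative f') (at x)" "\<And>h. f' h = g \<bullet> h"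
  shows "grad f x = g"
proof -
  have "f' = frechet_derivative f (at x)" by (rule frechet_derivative_at[OF assms(1)])
  hence "grad f x = (\<Sum>i\<in>Basis. (g \<bullet> i) *\<^sub>R i)" unfolding grad_def using assms(2) by (metis (no_types, lifting) sum.cong)
  thus ?thesis by (simp add: euclidean_representation)
qed

lemma smooth_continuous: "smooth_on UNIV f \<Longrightarrow> continuous_on UNIV f"
  by (simp add: continuous_at_imp_continuous_on differentiable_imp_continuous_within smooth_on_differentiable)

lemma smooth_grad_continuous: "smooth_on UNIV f \<Longrightarrow> continuous_on UNIV (grad f)"
  unfolding grad_def[abs_def]
  by (intro continuous_intros smooth_continuous smooth_on_partial)

lemma test_fun_has_derivative: "test_fun \<Omega> \<phi> \<Longrightarrow> (\<phi> has_derivative (\<lambda>h. grad \<phi> x \<bullet> h)) (at x)"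
  unfolding test_fun_def using smooth_on_differentiable by (blast intro: grad_has_derivative)

lemma test_fun_continuous: "test_fun \<Omega> \<phi> \<Longrightarrow> continuous_on UNIV \<phi>"
  and test_fun_grad_continuous: "test_fun \<Omega> \<phi> \<Longrightarrow> continuous_on UNIV (grad \<phi>)"
  unfolding test_fun_def using smooth_continuous smooth_grad_continuous by auto

lemma test_fun_measurable:
  assumes "test_fun \<Omega> \<phi>"
  shows "\<phi> \<in> borel_measurable borel" "grad \<phi> \<in> borel_measurable borel"
  by (rule borel_measurable_continuous_onI[OF test_fun_continuous[OF assms]],
      rule borel_measurable_continuous_onI[OF test_fun_grad_continuous[OF assms]])

lemma test_fun_zero:
  assumes "test_fun \<Omega> \<phi>" "x \<notin> closure {x. \<phi> x \<noteq> 0}"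
  shows "\<phi> x = 0" "grad \<phi> x = 0"
proof -
  have cl: "y \<in> closure {x. \<phi> x \<noteq> 0}" if "\<phi> y \<noteq> 0" for y
    using that by (intro subsetD[OF closure_subset]) simp
  show "\<phi> x = 0" using assms(2) cl[of x] by blast
  have "((\<lambda>_. 0) has_derivative (\<lambda>h. 0)) (at x)" by (rule has_derivative_const)
  hence "(\<phi> has_derivative (\<lambda>h. 0)) (at x)"
  proof (rule has_derivative_transform_within_open)
    show "open (- closure {x. \<phi> x \<noteq> 0})" by auto
    show "0 = \<phi> y" if "y \<in> - closure {x. \<phi> x \<noteq> 0}" for y
    proof (rule ccontr)
      assume "0 \<noteq> \<phi> y"
      hence "y \<in> closure {x. \<phi> x \<noteq> 0}" by (intro cl) simp
      thus False using that by simp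
    qed
  qed (use assms(2) in auto)
  thus "grad \<phi> x = 0" by (rule grad_unique) simp
qed

lemma test_fun_zero_outside:
  assumes "test_fun \<Omega> \<phi>" "x \<notin> \<Omega>"
  shows "\<phi> x = 0" "grad \<phi> x = 0"
  using test_fun_zero[OF assms(1), of x] assms unfolding test_fun_def by auto

lemma test_fun_bounded_support:
  assumes "test_fun \<Omega> \<phi>"
  shows "\<exists>R>0. \<forall>x. R < norm x \<longrightarrow> \<phi> x = 0 \<and> grad \<phi> x = 0"
proof -
  have "bounded (closure {x. \<phi> x \<noteq> 0})" using assms compact_imp_bounded unfolding test_fun_def by blast
  then obtain R where R: "\<And>x. x \<in> closure {x. \<phi> x \<noteq> 0} \<Longrightarrow> norm x \<le> R" using bounded_iff by blast
  have out: "x \<notin> closure {x. \<phi> x \<noteq> 0}" if "max R 1 < norm x" for x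
  proof
    assume "x \<in> closure {x. \<phi> x \<noteq> 0}"
    thus False using R[of x] that by simp
  qed
  show ?thesis
    by (intro exI[of _ "max R 1"] conjI allI impI) (simp, (rule test_fun_zero[OF assms out], assumption)+)
qed

lemma test_fun_integrable:
  fixes g :: "'a::euclidean_space \<Rightarrow> real"
  assumes "test_fun \<Omega> \<phi>" "continuous_on UNIV g" "\<And>x. \<phi> x = 0 \<Longrightarrow> grad \<phi> x = 0 \<Longrightarrow> g x = 0"
  shows "integrable lborel g"
proof -
  obtain R where R: "0 < R" "\<And>x. R < norm x \<Longrightarrow> \<phi> x = 0" "\<And>x. R < norm x \<Longrightarrow> grad \<phi> x = 0"
    using test_fun_bounded_support[OF assms(1)] by metis
  have "integrable lborel (\<lambda>x. indicator (cball 0 R) x *\<^sub>R g x)"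
    by (rule borel_integrable_compact) (use assms(2) continuous_on_subset in auto)
  also have "(\<lambda>x. indicator (cball 0 R) x *\<^sub>R g x) = g"
    using R assms(3) by (auto simp: fun_eq_iff indicator_def)
  finally show ?thesis .
qed

text \<open>The gradient vanishes outside a ball of radius R. Uniform continuity on the ball of
  radius R + 1 covers all pairs at distance below 1 with one point in the smaller ball.\<close>

lemma test_fun_grad_uniform:
  fixes \<phi> :: "'a::euclidean_space \<Rightarrow> real"
  assumes "test_fun \<Omega> \<phi>" "0 < \<epsilon>"
  obtains \<delta> where "0 < \<delta>" "\<And>x y. norm (y - x) < \<delta> \<Longrightarrow> norm (grad \<phi> y - grad \<phi> x) \<le> \<epsilon>"
proof -
  obtain R where R: "0 < R" "\<And>x. R < norm x \<Longrightarrow> \<phi> x = 0" "\<And>x. R < norm x \<Longrightarrow> grad \<phi> x = 0"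
    using test_fun_bounded_support[OF assms(1)] by metis
  have "uniformly_continuous_on (cball 0 (R + 1)) (grad \<phi>)"
    by (rule compact_uniformly_continuous) (use test_fun_grad_continuous[OF assms(1)] continuous_on_subset in auto)
  then obtain d where d: "d > 0" "\<And>x y. x \<in> cball 0 (R + 1) \<Longrightarrow> y \<in> cball 0 (R + 1) \<Longrightarrow> dist y x < d \<Longrightarrow> dist (grad \<phi> y) (grad \<phi> x) < \<epsilon>"
    using assms(2) unfolding uniformly_continuous_on_def by metis
  show ?thesis
  proof (rule that[of "min d 1"])
    fix x y :: 'a assume xy: "norm (y - x) < min d 1"
    show "norm (grad \<phi> y - grad \<phi> x) \<le> \<epsilon>"
    proof (cases "norm x \<le> R \<or> norm y \<le> R")
      case True
      have "norm y \<le> norm x + norm (y - x)" "norm x \<le> norm y + norm (y - x)"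
        using norm_triangle_sub[of y x] norm_triangle_sub[of x y] by (auto simp: norm_minus_commute)
      hence "norm x \<le> R + 1" "norm y \<le> R + 1" using True xy by auto
      thus ?thesis using d(2)[of x y] xy by (auto simp: dist_norm intro: less_imp_le)
    next
      case False
      thus ?thesis using R(3)[of x] R(3)[of y] assms(2) by simp
    qed
  qed (use d in simp)
qed

text \<open>The mean value inequality for \<phi> minus its linear part at x. What matters is that
  \<delta> does not depend on x.\<close>

lemma test_fun_taylor:
  fixes \<phi> :: "'a::euclidean_space \<Rightarrow> real"
  assumes "test_fun \<Omega> \<phi>" "0 < \<epsilon>"
  obtains \<delta> where "0 < \<delta>" "\<And>x z. norm z < \<delta> \<Longrightarrow> \<bar>\<phi> (x + z) - \<phi> x - grad \<phi> x \<bullet> z\<bar> \<le> \<epsilon> * norm z"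
proof -
  obtain \<delta> where \<delta>: "0 < \<delta>" "\<And>x y. norm (y - x) < \<delta> \<Longrightarrow> norm (grad \<phi> y - grad \<phi> x) \<le> \<epsilon>"
    using test_fun_grad_uniform[OF assms] by blast
  show ?thesis
  proof (rule that[OF \<delta>(1)])
    fix x z :: 'a assume z: "norm z < \<delta>"
    define \<psi> where "\<psi> y = \<phi> y - grad \<phi> x \<bullet> y" for y
    have der: "(\<psi> has_derivative (\<lambda>h. (grad \<phi> y - grad \<phi> x) \<bullet> h)) (at y within ball x \<delta>)" for y
    proof -
      have "(\<phi> has_derivative (\<lambda>h. grad \<phi> y \<bullet> h)) (at y within ball x \<delta>)"
        using test_fun_has_derivative[OF assms(1)] has_derivative_at_withinI by blast
      thus ?thesis unfolding \<psi>_def[abs_def] inner_diff_left by (intro derivative_intros)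
    qed
    have "norm (\<psi> (x + z) - \<psi> x) \<le> \<epsilon> * norm ((x + z) - x)"
    proof (rule differentiable_bound[OF convex_ball der])
      fix y assume "y \<in> ball x \<delta>"
      hence "norm (grad \<phi> y - grad \<phi> x) \<le> \<epsilon>" using \<delta>(2)[of y x] by (simp add: dist_norm norm_minus_commute)
      thus "onorm (\<lambda>h. (grad \<phi> y - grad \<phi> x) \<bullet> h) \<le> \<epsilon>"
        by (intro onorm_le) (smt (verit) Cauchy_Schwarz_ineq2 mult_right_mono norm_ge_zero real_norm_def)
    qed (use z \<delta>(1) in \<open>auto simp: dist_norm\<close>)
    thus "\<bar>\<phi> (x + z) - \<phi> x - grad \<phi> x \<bullet> z\<bar> \<le> \<epsilon> * norm z" unfolding \<psi>_def by (simp add: inner_add_right)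
  qed
qed

text \<open>The tangent inequality at the mean value \<open>s\<close> of \<open>f\<close> is
  integrated over \<open>A\<close>; its linear part integrates to 0.\<close>

lemma Jensen_power_set_integral:
  fixes f :: "'a \<Rightarrow> real"
  assumes A: "A \<in> sets M" "emeasure M A < \<infinity>" and f: "\<And>x. 0 \<le> f x"
    and int: "integrable M (\<lambda>x. indicator A x * f x)" "integrable M (\<lambda>x. indicator A x * f x ^ n)" and n: "1 \<le> n"
  shows "(\<integral>x. indicator A x * f x \<partial>M) ^ n \<le> (\<integral>x. indicator A x * f x ^ n \<partial>M) * measure M A ^ (n - 1)"
proof -
  define I where "I = (\<integral>x. indicator A x * f x \<partial>M)"
  define J where "J = (\<integral>x. indicator A x * f x ^ n \<partial>M)"
  have I0: "0 \<le> I" and J0: "0 \<le> J" unfolding I_def J_def using f by (auto intro!: Bochner_Integration.integral_nonneg)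
  have intA: "integrable M (indicator A :: 'a \<Rightarrow> real)" using A by simp
  show ?thesis
  proof (cases "measure M A = 0")
    case True
    have "emeasure M A = 0" using True A by (metis emeasure_eq_ennreal_measure ennreal_0 infinity_ennreal_def less_irrefl)
    hence "A \<in> null_sets M" using A by auto
    hence "AE x in M. indicator A x * f x = 0" using AE_not_in[of A M] by (auto elim!: eventually_mono)
    hence "I = 0" unfolding I_def by (simp add: integral_eq_zero_AE)
    thus ?thesis using n J0 unfolding I_def[symmetric] J_def[symmetric] by (simp add: zero_power True)
  next
    case False
    define \<mu> where "\<mu> = measure M A"
    have \<mu>: "\<mu> > 0" unfolding \<mu>_def using False by (simp add: zero_less_measure_iff)
    define s where "s = I / \<mu>"
    have s: "s \<ge> 0" unfolding s_def using I0 \<mu> by simp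
    have "(\<integral>x. indicator A x * (s ^ n + n * s ^ (n - 1) * (f x - s)) \<partial>M) \<le> J"
      unfolding J_def
    proof (rule integral_mono)
      have "integrable M (\<lambda>x. (s ^ n - n * s ^ (n - 1) * s) * indicator A x + (n * s ^ (n - 1)) * (indicator A x * f x))"
        using intA int by (intro Bochner_Integration.integrable_add integrable_mult_right) auto
      thus "integrable M (\<lambda>x. indicator A x * (s ^ n + n * s ^ (n - 1) * (f x - s)))"
        by (simp add: algebra_simps)
      show "indicator A x * (s ^ n + real n * s ^ (n - 1) * (f x - s)) \<le> indicator A x * f x ^ n" for x
        using power_tangent_le[OF f s] by (intro mult_left_mono) auto
    qed (use int in simp)
    also have "(\<integral>x. indicator A x * (s ^ n + n * s ^ (n - 1) * (f x - s)) \<partial>M)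
       = (\<integral>x. (s ^ n - n * s ^ (n - 1) * s) * indicator A x + (n * s ^ (n - 1)) * (indicator A x * f x) \<partial>M)"
      by (intro Bochner_Integration.integral_cong refl) (simp add: algebra_simps)
    also have "\<dots> = (s ^ n - n * s ^ (n - 1) * s) * \<mu> + n * s ^ (n - 1) * I"
      using intA int A(1) unfolding I_def \<mu>_def by (subst Bochner_Integration.integral_add) auto
    also have "\<dots> = s ^ n * \<mu>" unfolding s_def using \<mu> by (simp add: algebra_simps)
    finally have "s ^ n * \<mu> * \<mu> ^ (n - 1) \<le> J * \<mu> ^ (n - 1)" using \<mu> by (intro mult_right_mono) auto
    moreover have "s ^ n * \<mu> * \<mu> ^ (n - 1) = I ^ n"
    proof -
      have "\<mu> * \<mu> ^ (n - 1) = \<mu> ^ n" using n by (cases n) auto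
      thus ?thesis unfolding s_def using \<mu> by (simp add: power_divide mult.assoc)
    qed
    ultimately show ?thesis unfolding I_def J_def \<mu>_def by simp
  qed
qed

section \<open>The isoperimetric inequality integrated over levels\<close>

context anisotropic begin

lemma F_grad_integrable:
  assumes "test_fun \<Omega> \<phi>" "1 \<le> n"
  shows "integrable lborel (\<lambda>x. F (grad \<phi> x) ^ n)"
proof (rule test_fun_integrable[OF assms(1)])
  show "continuous_on UNIV (\<lambda>x. F (grad \<phi> x) ^ n)"
    by (intro continuous_intros continuous_on_compose2[OF F_continuous test_fun_grad_continuous[OF assms(1)]]) auto
qed (use assms(2) in \<open>simp add: zero_power\<close>)

lemma superlevel_bounded:
  assumes "test_fun \<Omega> \<phi>" "0 \<le> t"
  shows "bounded {x. t < \<bar>\<phi> x\<bar>}"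
proof -
  obtain R where R: "0 < R" "\<And>x. R < norm x \<Longrightarrow> \<phi> x = 0" "\<And>x. R < norm x \<Longrightarrow> grad \<phi> x = 0"
    using test_fun_bounded_support[OF assms(1)] by metis
  hence "norm x \<le> R" if "t < \<bar>\<phi> x\<bar>" for x using that assms(2) by (metis abs_zero not_le)
  thus ?thesis unfolding bounded_iff by (intro exI[of _ R]) simp
qed

text \<open>Fubini's theorem in the place of the coarea formula. In the set \<open>Q\<close> of
  pairs (x, t), the section at a height t contains the shell that a Wulff ball of radius h adds to
  the superlevel set, so its measure is at least h \<Lambda>; the section at a point x lies in an
  interval of length h (F (grad \<phi> x) + \<epsilon>). Comparing the two, dividing by h, and
  letting first h and then \<epsilon> tend to 0 gives the claim.\<close>

lemma coarea_isoperimetric: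
  fixes \<phi> :: "'a \<Rightarrow> real"
  assumes \<phi>: "test_fun \<Omega> \<phi>" and ab: "0 \<le> a" "a < b"
    and \<mu>: "\<mu> = measure lborel {x. b \<le> \<bar>\<phi> x\<bar>}" "0 < \<mu>"
  shows "(b - a) * (DIM('a) * root DIM('a) (kappa F) * root DIM('a) \<mu> ^ (DIM('a) - 1))
    \<le> (\<integral>x. indicator {x. a < \<bar>\<phi> x\<bar> \<and> \<bar>\<phi> x\<bar> < b} x * F (grad \<phi> x) \<partial>lborel)"
proof -
  define \<Lambda> where "\<Lambda> = DIM('a) * root DIM('a) (kappa F) * root DIM('a) \<mu> ^ (DIM('a) - 1)"
  have \<Lambda>: "\<Lambda> > 0" unfolding \<Lambda>_def using kappa_pos \<mu> by simp
  define S where "S = {x. a < \<bar>\<phi> x\<bar> \<and> \<bar>\<phi> x\<bar> < b}"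
  define I where "I = (\<integral>x. indicator S x * F (grad \<phi> x) \<partial>lborel)"
  note [measurable] = test_fun_measurable[OF \<phi>]
  have S_meas [measurable]: "S \<in> sets borel" unfolding S_def by measurable
  have S_bd: "bounded S" by (rule bounded_subset[OF superlevel_bounded[OF \<phi> ab(1)]]) (auto simp: S_def)
  have S_fin: "emeasure lborel S < \<infinity>" by (rule emeasure_bounded_finite[OF S_bd])
  have FgI: "integrable lborel (\<lambda>x. F (grad \<phi> x))" using F_grad_integrable[OF \<phi>, of 1] by simp
  have intF: "integrable lborel (\<lambda>x. indicator S x * F (grad \<phi> x))"
    using integrable_mult_indicator[of S lborel "\<lambda>x. F (grad \<phi> x)"] FgI by simp
  have intS: "integrable lborel (indicator S :: 'a \<Rightarrow> real)" using S_fin by simp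
  obtain R where R: "0 < R" "\<And>x. R < norm x \<Longrightarrow> \<phi> x = 0" "\<And>x. R < norm x \<Longrightarrow> grad \<phi> x = 0"
    using test_fun_bounded_support[OF \<phi>] by metis
  obtain G where G: "G > 0" "\<And>x. F (grad \<phi> x) \<le> G"
  proof -
    have "compact ((\<lambda>x. F (grad \<phi> x)) ` cball 0 R)"
      by (intro compact_continuous_image continuous_on_compose2[OF F_continuous] continuous_on_subset[OF test_fun_grad_continuous[OF \<phi>]]) auto
    then obtain G where "\<And>x. x \<in> cball 0 R \<Longrightarrow> norm (F (grad \<phi> x)) \<le> G"
      using compact_imp_bounded bounded_iff by (metis (no_types, lifting) imageI)
    hence GR: "F (grad \<phi> x) \<le> G" if "norm x \<le> R" for x using that by force
    have "F (grad \<phi> x) \<le> max G 1" for x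
    proof (cases "norm x \<le> R")
      case True
      thus ?thesis using GR by (simp add: le_max_iff_disj)
    next
      case False
      thus ?thesis using R(3)[of x] by simp
    qed
    thus ?thesis using that[of "max G 1"] by simp
  qed
  obtain c where c: "c > 0" "\<And>x. c * norm x \<le> Fo F x" using Fo_bounds by blast
  have main: "(b - a) * \<Lambda> \<le> I + \<epsilon> * measure lborel S" if \<epsilon>: "0 < \<epsilon>" for \<epsilon>
  proof -
    \<comment> \<open>The tolerance is \<open>c * \<epsilon>\<close> because the Taylor remainder is
      measured by the Euclidean norm and the shift by \<open>Fo F\<close>, which is at least
      \<open>c\<close> times that norm.\<close>
    obtain \<delta> where \<delta>: "0 < \<delta>" "\<And>x z. norm z < \<delta> \<Longrightarrow> \<bar>\<phi> (x + z) - \<phi> x - grad \<phi> x \<bullet> z\<bar> \<le> (c * \<epsilon>) * norm z"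
      using test_fun_taylor[OF \<phi>, of "c * \<epsilon>"] c \<epsilon> by auto
    define L where "L = G + \<epsilon>"
    have L: "L > 0" unfolding L_def using G \<epsilon> by simp
    \<comment> \<open>A shift by less than \<open>h\<close> changes |\<phi>| by less than h * L, so
      for t above a + h * L the shell stays above the level \<open>a\<close>.\<close>
    have step: "(b - (a + h * L)) * \<Lambda> \<le> I + \<epsilon> * measure lborel S"
      if h: "0 < h" "h \<le> c * \<delta>" "a + h * L < b" for h
    proof -
      have spread: "\<bar>\<phi> (x + z)\<bar> < \<bar>\<phi> x\<bar> + h * (F (grad \<phi> x) + \<epsilon>)" if z: "Fo F z < h" for x z
      proof -
        have nz: "c * norm z < h" using c(2)[of z] z by simp
        hence "c * norm z < c * \<delta>" using h by simp
        hence "norm z < \<delta>" using c by simp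
        hence "\<bar>\<phi> (x + z) - \<phi> x - grad \<phi> x \<bullet> z\<bar> \<le> \<epsilon> * (c * norm z)" using \<delta>(2)[of z x] by (simp add: mult_ac)
        also have "\<dots> < \<epsilon> * h" using nz \<epsilon> by simp
        finally have "\<bar>\<phi> (x + z) - \<phi> x - grad \<phi> x \<bullet> z\<bar> < \<epsilon> * h" .
        moreover have "\<bar>grad \<phi> x \<bullet> z\<bar> \<le> h * F (grad \<phi> x)"
        proof -
          have "\<bar>z \<bullet> grad \<phi> x\<bar> \<le> Fo F z * F (grad \<phi> x)" by (rule abs_inner_le)
          also have "\<dots> \<le> h * F (grad \<phi> x)" using z F_nonneg by (intro mult_right_mono) auto
          finally show ?thesis by (simp add: inner_commute)
        qed
        ultimately show ?thesis by (simp add: algebra_simps)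
      qed
      define Q where "Q = {(x, t). a < \<bar>\<phi> x\<bar> \<and> \<bar>\<phi> x\<bar> < b \<and> \<bar>\<phi> x\<bar> \<le> t \<and> t < \<bar>\<phi> x\<bar> + h * (F (grad \<phi> x) + \<epsilon>)}"
      have Qm: "Q \<in> sets (lborel \<Otimes>\<^sub>M lborel)"
      proof -
        have "{p \<in> space (lborel \<Otimes>\<^sub>M lborel). a < \<bar>\<phi> (fst p)\<bar> \<and> \<bar>\<phi> (fst p)\<bar> < b \<and> \<bar>\<phi> (fst p)\<bar> \<le> snd p
          \<and> snd p < \<bar>\<phi> (fst p)\<bar> + h * (F (grad \<phi> (fst p)) + \<epsilon>)} \<in> sets (lborel \<Otimes>\<^sub>M (lborel :: real measure))" by measurable
        moreover have "{p \<in> space (lborel \<Otimes>\<^sub>M lborel). a < \<bar>\<phi> (fst p)\<bar> \<and> \<bar>\<phi> (fst p)\<bar> < b \<and> \<bar>\<phi> (fst p)\<bar> \<le> snd p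
          \<and> snd p < \<bar>\<phi> (fst p)\<bar> + h * (F (grad \<phi> (fst p)) + \<epsilon>)} = Q" unfolding Q_def by (auto simp: space_pair_measure)
        ultimately show ?thesis by simp
      qed
      have slice: "ennreal (h * \<Lambda>) \<le> emeasure lborel ((\<lambda>x. (x, t)) -` Q)" if t: "a + h * L < t" "t < b" for t
      proof -
        define V where "V = {x. t < \<bar>\<phi> x\<bar>}"
        have t0: "0 \<le> t" using t ab h L by (smt (verit) mult_pos_pos)
        have V: "open V" "bounded V"
          unfolding V_def using test_fun_continuous[OF \<phi>] superlevel_bounded[OF \<phi> t0]
          by (auto intro!: open_Collect_less continuous_intros)
        have Vf: "V \<in> fmeasurable lborel" using V by (intro fmeasurableI emeasure_bounded_finite) auto
        have sub: "{x. b \<le> \<bar>\<phi> x\<bar>} \<subseteq> V" unfolding V_def using t by auto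
        have \<mu>V: "\<mu> \<le> measure lborel V" unfolding \<mu>(1) by (rule measure_mono_fmeasurable[OF sub _ Vf]) measurable
        hence "V \<noteq> {}" using \<mu>(2) by auto
        let ?D = "msum V (Wulff h)"
        have D: "open ?D" "bounded ?D" by (rule open_msum[OF V(1)], rule bounded_msum[OF V(2) Wulff_bounded])
        have Df: "?D \<in> fmeasurable lborel" using D by (intro fmeasurableI emeasure_bounded_finite) auto
        have VD: "V \<subseteq> ?D" using zero_in_Wulff[OF h(1)] by force
        have "measure lborel V + h * \<Lambda> \<le> measure lborel ?D"
          unfolding \<Lambda>_def by (rule Wulff_isoperimetric) (use V \<open>V \<noteq> {}\<close> h \<mu> \<mu>V in auto)
        moreover have "measure lborel (?D - V) = measure lborel ?D - measure lborel V"
          by (rule measure_Diff) (use D V Df VD fmeasurableD2 in auto)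
        ultimately have "h * \<Lambda> \<le> measure lborel (?D - V)" by simp
        hence "ennreal (h * \<Lambda>) \<le> emeasure lborel (?D - V)"
          using fmeasurable.Diff[OF Df Vf] by (simp add: emeasure_eq_measure2 ennreal_leI)
        also have "\<dots> \<le> emeasure lborel ((\<lambda>x. (x, t)) -` Q)"
        proof (rule emeasure_mono)
          show "?D - V \<subseteq> (\<lambda>x. (x, t)) -` Q"
          proof
            fix x assume "x \<in> ?D - V"
            then obtain y w where yw: "x = y + w" "t < \<bar>\<phi> y\<bar>" "Fo F w < h" "\<bar>\<phi> x\<bar> \<le> t" unfolding V_def Wulff_def by auto
            have "\<bar>\<phi> (x + (- w))\<bar> < \<bar>\<phi> x\<bar> + h * (F (grad \<phi> x) + \<epsilon>)" by (rule spread) (simp add: Fo_even yw)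
            hence lt: "t < \<bar>\<phi> x\<bar> + h * (F (grad \<phi> x) + \<epsilon>)" using yw by simp
            also have "\<dots> \<le> \<bar>\<phi> x\<bar> + h * L" unfolding L_def using G(2) h by simp
            finally have "a < \<bar>\<phi> x\<bar>" using t by simp
            thus "x \<in> (\<lambda>x. (x, t)) -` Q" unfolding Q_def using lt yw t by auto
          qed
          show "(\<lambda>x. (x, t)) -` Q \<in> sets lborel" using sets_Pair2[OF Qm] by simp
        qed
        finally show ?thesis .
      qed
      have "ennreal ((b - (a + h * L)) * (h * \<Lambda>)) = (\<integral>\<^sup>+t. ennreal (h * \<Lambda>) * indicator {a + h * L<..<b} t \<partial>lborel)"
        using h \<Lambda> by (simp add: nn_integral_cmult_indicator ennreal_mult[symmetric] mult.commute)
      also have "\<dots> \<le> (\<integral>\<^sup>+t. emeasure lborel ((\<lambda>x. (x, t)) -` Q) \<partial>lborel)"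
        by (intro nn_integral_mono) (use slice in \<open>auto simp: indicator_def\<close>)
      also have "\<dots> = emeasure (lborel \<Otimes>\<^sub>M lborel) Q"
        by (rule lborel_pair.emeasure_pair_measure_alt2[OF Qm, symmetric])
      also have "\<dots> = (\<integral>\<^sup>+x. emeasure lborel (Pair x -` Q) \<partial>lborel)"
        by (rule lborel.emeasure_pair_measure_alt[OF Qm])
      also have "\<dots> \<le> (\<integral>\<^sup>+x. ennreal (indicator S x * (h * (F (grad \<phi> x) + \<epsilon>))) \<partial>lborel)"
      proof (rule nn_integral_mono)
        fix x
        show "emeasure lborel (Pair x -` Q) \<le> ennreal (indicator S x * (h * (F (grad \<phi> x) + \<epsilon>)))"
        proof (cases "x \<in> S")
          case True
          have "Pair x -` Q \<subseteq> {\<bar>\<phi> x\<bar>..<\<bar>\<phi> x\<bar> + h * (F (grad \<phi> x) + \<epsilon>)}" unfolding Q_def by auto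
          hence "emeasure lborel (Pair x -` Q) \<le> emeasure lborel {\<bar>\<phi> x\<bar>..<\<bar>\<phi> x\<bar> + h * (F (grad \<phi> x) + \<epsilon>)}"
            by (intro emeasure_mono) auto
          also have "\<dots> = ennreal (h * (F (grad \<phi> x) + \<epsilon>))" using h \<epsilon> F_nonneg by (simp add: add_nonneg_nonneg)
          finally show ?thesis using True by simp
        next
          case False
          hence "Pair x -` Q = {}" unfolding Q_def S_def by auto
          thus ?thesis by simp
        qed
      qed
      also have "\<dots> = ennreal (\<integral>x. indicator S x * (h * (F (grad \<phi> x) + \<epsilon>)) \<partial>lborel)"
      proof (rule nn_integral_eq_integral)
        have "integrable lborel (\<lambda>x. h * (indicator S x * F (grad \<phi> x)) + (h * \<epsilon>) * indicator S x)"
          using intF intS by (intro Bochner_Integration.integrable_add integrable_mult_right) auto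
        thus "integrable lborel (\<lambda>x. indicator S x * (h * (F (grad \<phi> x) + \<epsilon>)))" by (simp add: algebra_simps)
        show "AE x in lborel. 0 \<le> indicator S x * (h * (F (grad \<phi> x) + \<epsilon>))"
          using h \<epsilon> F_nonneg by (auto intro!: mult_nonneg_nonneg add_nonneg_nonneg)
      qed
      also have "(\<integral>x. indicator S x * (h * (F (grad \<phi> x) + \<epsilon>)) \<partial>lborel) = (\<integral>x. h * (indicator S x * F (grad \<phi> x)) + (h * \<epsilon>) * indicator S x \<partial>lborel)"
        by (intro Bochner_Integration.integral_cong refl) (simp add: algebra_simps)
      also have "\<dots> = h * I + h * \<epsilon> * measure lborel S"
        unfolding I_def using intF intS by (subst Bochner_Integration.integral_add) auto
      finally have "(b - (a + h * L)) * (h * \<Lambda>) \<le> h * I + h * \<epsilon> * measure lborel S"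
      proof (rule ennreal_le_iff[THEN iffD1, rotated])
        have "0 \<le> I" unfolding I_def using F_nonneg by (intro Bochner_Integration.integral_nonneg) auto
        thus "0 \<le> h * I + h * \<epsilon> * measure lborel S" using h \<epsilon> by simp
      qed
      hence "h * ((b - (a + h * L)) * \<Lambda>) \<le> h * (I + \<epsilon> * measure lborel S)" by (simp add: algebra_simps)
      thus ?thesis using h by simp
    qed
    have "(b - (a + 0 * L)) * \<Lambda> \<le> I + \<epsilon> * measure lborel S"
    proof (rule tendsto_upperbound)
      show "((\<lambda>h. (b - (a + h * L)) * \<Lambda>) \<longlongrightarrow> (b - (a + 0 * L)) * \<Lambda>) (at_right 0)"
        by (intro tendsto_intros)
      have "a + h * L < b" if "0 < h" "h < (b - a) / L" for h
        using that L by (simp add: field_simps)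
      hence "(b - (a + h * L)) * \<Lambda> \<le> I + \<epsilon> * measure lborel S" if "0 < h" "h < min (c * \<delta>) ((b - a) / L)" for h
        using step[of h] that by simp
      thus "\<forall>\<^sub>F h in at_right 0. (b - (a + h * L)) * \<Lambda> \<le> I + \<epsilon> * measure lborel S"
        using c \<delta> ab L by (auto simp: eventually_at_right_field intro!: exI[of _ "min (c * \<delta>) ((b - a) / L)"])
    qed simp
    thus ?thesis by simp
  qed
  have "(b - a) * \<Lambda> \<le> I + 0 * measure lborel S"
  proof (rule tendsto_lowerbound)
    show "((\<lambda>\<epsilon>. I + \<epsilon> * measure lborel S) \<longlongrightarrow> I + 0 * measure lborel S) (at_right 0)"
      by (intro tendsto_intros)
    show "\<forall>\<^sub>F \<epsilon> in at_right 0. (b - a) * \<Lambda> \<le> I + \<epsilon> * measure lborel S"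
      using main by (auto simp: eventually_at_right_field intro!: exI[of _ 1])
  qed simp
  thus ?thesis unfolding I_def S_def \<Lambda>_def by simp
qed

text \<open>The N-th power of the previous bound, combined with Jensen's inequality on the strip,
  whose measure is the difference on the right.\<close>

lemma capacity_step:
  fixes \<phi> :: "'a \<Rightarrow> real"
  assumes \<phi>: "test_fun \<Omega> \<phi>" and ab: "0 \<le> a" "a < b" and N: "2 \<le> DIM('a)"
    and \<mu>: "0 < measure lborel {x. b \<le> \<bar>\<phi> x\<bar>}"
  shows "lambdaN F ^ (DIM('a) - 1) * (b - a) ^ DIM('a) * measure lborel {x. b \<le> \<bar>\<phi> x\<bar>} ^ (DIM('a) - 1)
    \<le> (\<integral>x. indicator {x. a < \<bar>\<phi> x\<bar> \<and> \<bar>\<phi> x\<bar> < b} x * F (grad \<phi> x) ^ DIM('a) \<partial>lborel)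
      * (measure lborel {x. a < \<bar>\<phi> x\<bar>} - measure lborel {x. b \<le> \<bar>\<phi> x\<bar>}) ^ (DIM('a) - 1)"
proof -
  let ?N = "DIM('a)"
  define \<mu> where "\<mu> = measure lborel {x. b \<le> \<bar>\<phi> x\<bar>}"
  define S where "S = {x. a < \<bar>\<phi> x\<bar> \<and> \<bar>\<phi> x\<bar> < b}"
  note [measurable] = test_fun_measurable[OF \<phi>]
  have S_meas [measurable]: "S \<in> sets borel" unfolding S_def by measurable
  have S_bd: "bounded S" by (rule bounded_subset[OF superlevel_bounded[OF \<phi> ab(1)]]) (auto simp: S_def)
  have int: "integrable lborel (\<lambda>x. indicator S x * F (grad \<phi> x) ^ n)" if "1 \<le> n" for n
    using integrable_mult_indicator[of S lborel "\<lambda>x. F (grad \<phi> x) ^ n"] F_grad_integrable[OF \<phi> that] by simp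
  have "((b - a) * (?N * root ?N (kappa F) * root ?N \<mu> ^ (?N - 1))) ^ ?N
     \<le> (\<integral>x. indicator S x * F (grad \<phi> x) \<partial>lborel) ^ ?N"
  proof (rule power_mono)
    show "(b - a) * (?N * root ?N (kappa F) * root ?N \<mu> ^ (?N - 1)) \<le> (\<integral>x. indicator S x * F (grad \<phi> x) \<partial>lborel)"
      unfolding S_def by (rule coarea_isoperimetric[OF \<phi> ab]) (use \<mu> \<mu>_def in auto)
    show "0 \<le> (b - a) * (?N * root ?N (kappa F) * root ?N \<mu> ^ (?N - 1))"
      using ab kappa_pos by (simp add: \<mu>_def)
  qed
  also have "\<dots> \<le> (\<integral>x. indicator S x * F (grad \<phi> x) ^ ?N \<partial>lborel) * measure lborel S ^ (?N - 1)"
    by (rule Jensen_power_set_integral) (use int[of 1] int[of ?N] N F_nonneg emeasure_bounded_finite[OF S_bd] in auto)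
  finally have 1: "((b - a) * (?N * root ?N (kappa F) * root ?N \<mu> ^ (?N - 1))) ^ ?N \<le> \<dots>" .
  have rt: "(root ?N \<mu> ^ (?N - 1)) ^ ?N = (root ?N \<mu> ^ ?N) ^ (?N - 1)" by (simp add: power_mult[symmetric] mult.commute)
  hence "((b - a) * (?N * root ?N (kappa F) * root ?N \<mu> ^ (?N - 1))) ^ ?N = (b - a) ^ ?N * (?N ^ ?N * kappa F * \<mu> ^ (?N - 1))"
    unfolding power_mult_distrib rt using kappa_pos by (simp add: \<mu>_def real_root_pow_pos2)
  also have "\<dots> = lambdaN F ^ (?N - 1) * (b - a) ^ ?N * \<mu> ^ (?N - 1)" using lambdaN_power[OF N] by (simp add: mult_ac)
  finally have 2: "((b - a) * (?N * root ?N (kappa F) * root ?N \<mu> ^ (?N - 1))) ^ ?N = \<dots>" .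
  have "measure lborel S = measure lborel ({x. a < \<bar>\<phi> x\<bar>} - {x. b \<le> \<bar>\<phi> x\<bar>})"
    by (rule arg_cong[where f="measure lborel"]) (auto simp: S_def)
  also have "\<dots> = measure lborel {x. a < \<bar>\<phi> x\<bar>} - measure lborel {x. b \<le> \<bar>\<phi> x\<bar>}"
    by (rule measure_Diff) (use emeasure_bounded_finite[OF superlevel_bounded[OF \<phi> ab(1)]] ab in auto)
  finally show ?thesis using 1 2 unfolding S_def \<mu>_def by simp
qed

end

section \<open>From thin strips to the logarithm\<close>

lemma power_mean_sum:
  fixes d :: "nat \<Rightarrow> real"
  assumes d: "\<And>j. j < n \<Longrightarrow> 0 \<le> d j" and k: "1 \<le> k"
  shows "(\<Sum>j<n. d j) ^ k \<le> real n ^ (k - 1) * (\<Sum>j<n. d j ^ k)"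
proof (cases "n = 0")
  case True
  thus ?thesis using k by (simp add: zero_power)
next
  case False
  define s where "s = (\<Sum>j<n. d j) / n"
  have "0 \<le> (\<Sum>j<n. d j)" by (rule sum_nonneg) (use d in simp)
  hence s: "s \<ge> 0" unfolding s_def by simp
  have "(\<Sum>j<n. s ^ k + k * s ^ (k - 1) * (d j - s)) \<le> (\<Sum>j<n. d j ^ k)"
    by (intro sum_mono power_tangent_le) (use d s in auto)
  also have "(\<Sum>j<n. s ^ k + k * s ^ (k - 1) * (d j - s)) = n * s ^ k + k * s ^ (k - 1) * ((\<Sum>j<n. d j) - n * s)"
    by (simp add: sum.distrib sum_distrib_left[symmetric] sum_subtractf)
  also have "\<dots> = n * s ^ k" unfolding s_def using False by simp
  finally have "real n ^ (k - 1) * (n * s ^ k) \<le> real n ^ (k - 1) * (\<Sum>j<n. d j ^ k)" by (intro mult_left_mono) auto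
  moreover have "real n ^ (k - 1) * (n * s ^ k) = (n * s) ^ k"
    using k by (cases k) (auto simp: power_mult_distrib)
  moreover have "n * s = (\<Sum>j<n. d j)" unfolding s_def using False by simp
  ultimately show ?thesis by simp
qed

text \<open>The levels are chosen as quantiles along a geometric sequence of measures: jumps of the distribution
  function then do not spoil the logarithm.\<close>
lemma log_capacity_of_steps:
  fixes m \<mu> e :: "real \<Rightarrow> real"
  assumes N: "1 \<le> N" and ab: "a < b"
    and anti: "\<And>s t. a \<le> s \<Longrightarrow> s \<le> t \<Longrightarrow> t \<le> b \<Longrightarrow> m t \<le> m s" and mb: "0 < m b"
    and left: "\<And>t s. a < t \<Longrightarrow> t \<le> b \<Longrightarrow> (\<And>r. a \<le> r \<Longrightarrow> r < t \<Longrightarrow> s \<le> m r) \<Longrightarrow> s \<le> m t"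
    and right: "\<And>t s. a \<le> t \<Longrightarrow> t < b \<Longrightarrow> (\<And>r. t < r \<Longrightarrow> r \<le> b \<Longrightarrow> m r \<le> s) \<Longrightarrow> \<mu> t \<le> s"
    and \<mu>m: "\<And>t. a \<le> t \<Longrightarrow> t \<le> b \<Longrightarrow> \<mu> t \<le> m t"
    and step: "\<And>t r. a \<le> t \<Longrightarrow> t < r \<Longrightarrow> r \<le> b \<Longrightarrow> m r \<le> \<mu> t"
      "\<And>t r. a \<le> t \<Longrightarrow> t < r \<Longrightarrow> r \<le> b \<Longrightarrow> L * (r - t) ^ N * m r ^ (N - 1) \<le> (e r - e t) * (\<mu> t - m r) ^ (N - 1)"
    and emono: "\<And>s t. a \<le> s \<Longrightarrow> s \<le> t \<Longrightarrow> t \<le> b \<Longrightarrow> e s \<le> e t" and L: "0 \<le> L"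
  shows "L * (b - a) ^ N \<le> (e b - e a) * (ln (m a) - ln (m b)) ^ (N - 1)"
proof -
  define q where "q = ln (m a) - ln (m b)"
  have ma: "0 < m a" using anti[of a b] ab mb by simp
  have q: "0 \<le> q" unfolding q_def using anti[of a b] ab mb ma by simp
  \<comment> \<open>A chain of n quantile levels yields the claim with \<open>q\<close> replaced by
    \<open>n * (exp (q / n) - 1)\<close>, which tends to \<open>q\<close>.\<close>
  have key: "L * (b - a) ^ N \<le> (e b - e a) * (real n * (exp (q / n) - 1)) ^ (N - 1)" if n: "0 < n" for n :: nat
  proof -
    define s where "s j = m a * exp (- (real j * (q / n)))" for j :: nat
    have s0: "s 0 = m a" unfolding s_def by simp
    have sn: "s n = m b" unfolding s_def q_def using n ma mb by (simp add: exp_diff)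
    have spos: "s j > 0" for j unfolding s_def using ma by simp
    have santi: "s k \<le> s j" if "j \<le> k" for j k unfolding s_def using ma that q n
      by (intro mult_left_mono) (auto intro!: divide_right_mono mult_right_mono)
    have sratio: "s j = s (Suc j) * exp (q / n)" for j
    proof -
      have "- (real j * (q / n)) = - (real (Suc j) * (q / n)) + q / n" by (simp add: algebra_simps add_divide_distrib)
      thus ?thesis unfolding s_def by (simp only: exp_add mult.assoc)
    qed
    define T where "T j = {t. a \<le> t \<and> t \<le> b \<and> s j \<le> m t}" for j
    \<comment> \<open>The value for j = 0 is set to \<open>a\<close>, where the chain has to start:
      if \<open>m\<close> is constant to the right of \<open>a\<close>, the supremum of
      \<open>T 0\<close> lies above \<open>a\<close>.\<close>
    define t where "t j = (if j = 0 then a else Sup (T j))" for j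
    have aT: "a \<in> T j" for j unfolding T_def using ab santi[of 0 j] s0 by simp
    have bdd: "bdd_above (T j)" for j unfolding T_def by (intro bdd_aboveI[of _ b]) auto
    have t0: "t 0 = a" unfolding t_def by simp
    have tn: "t n = b"
    proof -
      have "b \<in> T n" unfolding T_def using sn ab by simp
      hence "Sup (T n) = b" by (intro cSup_eq_maximum) (auto simp: T_def)
      thus ?thesis unfolding t_def using n by simp
    qed
    have tab: "a \<le> t j" "t j \<le> b" for j
    proof -
      show "a \<le> t j" unfolding t_def using cSup_upper[OF aT bdd] by auto
      show "t j \<le> b" unfolding t_def using ab aT by (auto intro!: cSup_least simp: T_def)
    qed
    have tmono: "t j \<le> t (Suc j)" for j
    proof (cases "j = 0")
      case True
      thus ?thesis using tab t0 by simp
    next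
      case False
      have "T j \<subseteq> T (Suc j)" unfolding T_def using santi[of j "Suc j"] by auto
      moreover have "T j \<noteq> {}" using aT by blast
      ultimately have "Sup (T j) \<le> Sup (T (Suc j))" by (intro cSup_subset_mono bdd)
      thus ?thesis unfolding t_def using False by simp
    qed
    \<comment> \<open>\<open>m\<close> is left continuous, so its lower bound passes to the
      supremum.\<close>
    have mt: "s j \<le> m (t j)" for j
    proof (cases "t j = a")
      case True
      thus ?thesis using santi[of 0 j] s0 by simp
    next
      case False
      hence lt: "a < t j" using tab[of j] by simp
      hence tj: "t j = Sup (T j)" unfolding t_def by (auto split: if_splits)
      show ?thesis
      proof (rule left[OF lt tab(2)])
        fix r assume r: "a \<le> r" "r < t j"
        then obtain r' where r': "r' \<in> T j" "r < r'" using less_cSupD[of "T j" r] aT tj by auto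
        hence "m r' \<le> m r" using r unfolding T_def by (intro anti) auto
        thus "s j \<le> m r" using r' unfolding T_def by simp
      qed
    qed
    \<comment> \<open>\<open>\<mu>\<close> is bounded by the values of \<open>m\<close> just above
      the supremum, which are below the quantile; a jump of \<open>m\<close> at \<open>t j\<close>
      therefore does not enter the next strip.\<close>
    have \<mu>t: "\<mu> (t j) \<le> s j" if j: "j < n" for j
    proof (cases "j = 0")
      case True
      thus ?thesis using \<mu>m[of a] ab s0 t0 by simp
    next
      case j0: False
      show ?thesis
      proof (cases "t j < b")
        case True
        show ?thesis
        proof (rule right[OF tab(1) True])
          fix r assume r: "t j < r" "r \<le> b"
          hence "r \<notin> T j" using cSup_upper[OF _ bdd, of r j] j0 unfolding t_def by auto
          thus "m r \<le> s j" using r tab(1)[of j] unfolding T_def by auto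
        qed
      next
        case False
        hence "t j = b" using tab(2)[of j] by simp
        hence "\<mu> (t j) \<le> m b" using \<mu>m[of b] ab by simp
        also have "\<dots> \<le> s j" using santi[of j n] j sn by simp
        finally show ?thesis .
      qed
    qed
    have each: "L * (t (Suc j) - t j) ^ N \<le> (e (t (Suc j)) - e (t j)) * (exp (q / n) - 1) ^ (N - 1)" if j: "j < n" for j
    proof (cases "t j < t (Suc j)")
      case True
      define m' where "m' = m (t (Suc j))"
      have m': "s (Suc j) \<le> m'" "0 < m'" unfolding m'_def using mt[of "Suc j"] spos[of "Suc j"] by auto
      have ee: "0 \<le> e (t (Suc j)) - e (t j)" using emono[OF tab(1) tmono tab(2)] by simp
      have "\<mu> (t j) - m' \<le> m' * (exp (q / n) - 1)"
      proof -
        have "\<mu> (t j) \<le> s (Suc j) * exp (q / n)" using \<mu>t[OF j] unfolding sratio[of j] .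
        also have "\<dots> \<le> m' * exp (q / n)" using m' by (intro mult_right_mono) auto
        finally show ?thesis by (simp add: algebra_simps)
      qed
      moreover have "0 \<le> \<mu> (t j) - m'" unfolding m'_def using step(1)[OF tab(1) True tab(2)] by simp
      ultimately have "(\<mu> (t j) - m') ^ (N - 1) \<le> (m' * (exp (q / n) - 1)) ^ (N - 1)" by (rule power_mono)
      hence "L * (t (Suc j) - t j) ^ N * m' ^ (N - 1) \<le> (e (t (Suc j)) - e (t j)) * (m' * (exp (q / n) - 1)) ^ (N - 1)"
        using step(2)[OF tab(1) True tab(2)] ee unfolding m'_def by (meson mult_left_mono order_trans)
      also have "\<dots> = ((e (t (Suc j)) - e (t j)) * (exp (q / n) - 1) ^ (N - 1)) * m' ^ (N - 1)"
        by (simp add: power_mult_distrib)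
      finally show ?thesis using m'(2) by (simp add: mult_le_cancel_right)
    next
      \<comment> \<open>One jump of \<open>m\<close> may pass several quantiles at once; the levels
        then coincide and both sides vanish.\<close>
      case False
      hence "t (Suc j) = t j" using tmono[of j] by simp
      thus ?thesis using N by (simp add: zero_power)
    qed
    have "L * (b - a) ^ N = L * (\<Sum>j<n. t (Suc j) - t j) ^ N"
      by (simp only: sum_lessThan_telescope t0 tn)
    also have "\<dots> \<le> L * (real n ^ (N - 1) * (\<Sum>j<n. (t (Suc j) - t j) ^ N))"
      using tmono L N by (intro mult_left_mono power_mean_sum) auto
    also have "\<dots> = real n ^ (N - 1) * (\<Sum>j<n. L * (t (Suc j) - t j) ^ N)"
      by (simp add: sum_distrib_left mult_ac)
    also have "\<dots> \<le> real n ^ (N - 1) * (\<Sum>j<n. (e (t (Suc j)) - e (t j)) * (exp (q / n) - 1) ^ (N - 1))"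
      by (intro mult_left_mono sum_mono each) auto
    also have "\<dots> = real n ^ (N - 1) * ((e (t n) - e (t 0)) * (exp (q / n) - 1) ^ (N - 1))"
      unfolding sum_distrib_right[symmetric] by (simp only: sum_lessThan_telescope[of "\<lambda>j. e (t j)"])
    also have "\<dots> = (e b - e a) * (real n * (exp (q / n) - 1)) ^ (N - 1)"
      unfolding t0 tn by (simp add: power_mult_distrib)
    finally show ?thesis .
  qed
  have lim: "(\<lambda>n. real n * (exp (q / n) - 1)) \<longlonglongrightarrow> q"
    by real_asymp
  have "(\<lambda>n. (e b - e a) * (real n * (exp (q / n) - 1)) ^ (N - 1)) \<longlonglongrightarrow> (e b - e a) * q ^ (N - 1)"
    by (intro tendsto_intros lim)
  moreover have "\<forall>\<^sub>F n in sequentially. L * (b - a) ^ N \<le> (e b - e a) * (real n * (exp (q / n) - 1)) ^ (N - 1)"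
    using eventually_gt_at_top[of 0] by eventually_elim (rule key)
  ultimately show ?thesis unfolding q_def by (rule tendsto_lowerbound) simp
qed

section \<open>Distribution function and truncated energy of a test function\<close>

context anisotropic begin

text \<open>The restriction to \<Omega> matters for t \<le> 0 only, where the set would otherwise be
  the whole space; it makes the value at 0 the measure of \<Omega>.\<close>

definition mass :: "'a set \<Rightarrow> ('a \<Rightarrow> real) \<Rightarrow> real \<Rightarrow> real" where
  "mass \<Omega> \<phi> t = measure lborel {x\<in>\<Omega>. t \<le> \<bar>\<phi> x\<bar>}"

definition energy :: "('a \<Rightarrow> real) \<Rightarrow> real \<Rightarrow> real" where
  "energy \<phi> t = (\<integral>x. indicator {x. \<bar>\<phi> x\<bar> < t} x * F (grad \<phi> x) ^ DIM('a) \<partial>lborel)"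

context
  fixes \<Omega> :: "'a set" and \<phi> :: "'a \<Rightarrow> real"
  assumes \<phi>: "test_fun \<Omega> \<phi>" and \<Omega>: "open \<Omega>" "bounded \<Omega>"
begin

lemma phi_measurable [measurable]: "\<phi> \<in> borel_measurable borel" "grad \<phi> \<in> borel_measurable borel"
  using test_fun_measurable[OF \<phi>] by auto

lemma Omega_measurable [measurable]: "\<Omega> \<in> sets borel"
  using \<Omega> by simp

lemma Omega_fmeasurable: "\<Omega> \<in> fmeasurable lborel"
  using \<Omega> by (intro fmeasurableI emeasure_bounded_finite) auto

lemma mass_set_fmeasurable: "{x\<in>\<Omega>. t \<le> \<bar>\<phi> x\<bar>} \<in> fmeasurable lborel"
  by (rule fmeasurableI2[OF Omega_fmeasurable]) auto

lemma mass_pos_level: "0 < t \<Longrightarrow> mass \<Omega> \<phi> t = measure lborel {x. t \<le> \<bar>\<phi> x\<bar>}"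
proof -
  assume "0 < t"
  hence "x \<in> \<Omega>" if "t \<le> \<bar>\<phi> x\<bar>" for x using that test_fun_zero_outside(1)[OF \<phi>, of x] by fastforce
  hence "{x\<in>\<Omega>. t \<le> \<bar>\<phi> x\<bar>} = {x. t \<le> \<bar>\<phi> x\<bar>}" by blast
  thus ?thesis unfolding mass_def by simp
qed

lemma mass_antimono: "s \<le> t \<Longrightarrow> mass \<Omega> \<phi> t \<le> mass \<Omega> \<phi> s"
  unfolding mass_def by (rule measure_mono_fmeasurable[OF _ _ mass_set_fmeasurable]) auto

lemma mass_le: "mass \<Omega> \<phi> t \<le> measure lborel \<Omega>"
  unfolding mass_def by (rule measure_mono_fmeasurable[OF _ _ Omega_fmeasurable]) auto

lemma energy_integrable: "integrable lborel (\<lambda>x. indicator {x. P \<bar>\<phi> x\<bar>} x * F (grad \<phi> x) ^ DIM('a))"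
  if [measurable]: "Measurable.pred borel P"
  using integrable_mult_indicator[of "{x. P \<bar>\<phi> x\<bar>}" lborel "\<lambda>x. F (grad \<phi> x) ^ DIM('a)"]
    F_grad_integrable[OF \<phi>, of "DIM('a)"] by simp

lemma energy_mono: "s \<le> t \<Longrightarrow> energy \<phi> s \<le> energy \<phi> t"
  unfolding energy_def
  by (intro integral_mono energy_integrable) (auto simp: indicator_def F_nonneg)

lemma energy_nonneg: "0 \<le> energy \<phi> t"
  unfolding energy_def by (intro Bochner_Integration.integral_nonneg) (simp add: F_nonneg)

lemma energy_le: "energy \<phi> t \<le> (\<integral>x. F (grad \<phi> x) ^ DIM('a) \<partial>lborel)"
  unfolding energy_def
  by (intro integral_mono energy_integrable F_grad_integrable[OF \<phi>]) (auto simp: indicator_def F_nonneg)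

text \<open>The right side also counts the energy on the set where |\<phi>| = s, which the open
  strip of \<open>capacity_step\<close> omits.\<close>

lemma energy_diff:
  assumes "s \<le> t"
  shows "(\<integral>x. indicator {x. s < \<bar>\<phi> x\<bar> \<and> \<bar>\<phi> x\<bar> < t} x * F (grad \<phi> x) ^ DIM('a) \<partial>lborel) \<le> energy \<phi> t - energy \<phi> s"
proof -
  have "energy \<phi> t - energy \<phi> s = (\<integral>x. indicator {x. \<bar>\<phi> x\<bar> < t} x * F (grad \<phi> x) ^ DIM('a)
     - indicator {x. \<bar>\<phi> x\<bar> < s} x * F (grad \<phi> x) ^ DIM('a) \<partial>lborel)"
    unfolding energy_def by (rule Bochner_Integration.integral_diff[symmetric]) (intro energy_integrable, measurable)+
  moreover have "(\<integral>x. indicator {x. s < \<bar>\<phi> x\<bar> \<and> \<bar>\<phi> x\<bar> < t} x * F (grad \<phi> x) ^ DIM('a) \<partial>lborel) \<le> \<dots>"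
    by (intro integral_mono Bochner_Integration.integrable_diff energy_integrable energy_integrable[where P="\<lambda>u. s < u \<and> u < t"])
      (use assms in \<open>auto simp: indicator_def F_nonneg\<close>)
  ultimately show ?thesis by simp
qed

lemma log_capacity:
  assumes N: "2 \<le> DIM('a)" and ab: "0 \<le> a" "a < b" "0 < mass \<Omega> \<phi> b"
  shows "lambdaN F ^ (DIM('a) - 1) * (b - a) ^ DIM('a)
    \<le> (energy \<phi> b - energy \<phi> a) * (ln (mass \<Omega> \<phi> a) - ln (mass \<Omega> \<phi> b)) ^ (DIM('a) - 1)"
proof (rule log_capacity_of_steps[where \<mu>="\<lambda>t. measure lborel {x. t < \<bar>\<phi> x\<bar>}"])
  let ?mu = "measure (lborel :: 'a measure)"
  have gt_fm: "{x. t < \<bar>\<phi> x\<bar>} \<in> fmeasurable lborel" if "0 \<le> t" for t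
    using superlevel_bounded[OF \<phi> that] by (intro fmeasurableI emeasure_bounded_finite) auto
  fix t s r :: real
  {
    assume t: "a < t" "t \<le> b" and s: "\<And>r. a \<le> r \<Longrightarrow> r < t \<Longrightarrow> s \<le> mass \<Omega> \<phi> r"
    \<comment> \<open>Left continuity: the levels increase from \<open>a\<close> to
      \<open>t\<close>, and the closed superlevel sets decrease to that of \<open>t\<close>.\<close>
    define A where "A k = {x\<in>\<Omega>. t - (t - a) / real (Suc k) \<le> \<bar>\<phi> x\<bar>}" for k
    have "(\<lambda>k. ?mu (A k)) \<longlonglongrightarrow> ?mu (\<Inter>k. A k)"
    proof (rule Lim_measure_decseq)
      show "range A \<subseteq> sets lborel" unfolding A_def by auto
      show "decseq A"
      proof (rule decseq_SucI, rule subsetI)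
        fix k x assume "x \<in> A (Suc k)"
        moreover have "(t - a) / real (Suc (Suc k)) \<le> (t - a) / real (Suc k)" using t by (intro divide_left_mono) auto
        ultimately show "x \<in> A k" unfolding A_def by auto
      qed
      show "emeasure lborel (A k) \<noteq> \<infinity>" for k
        unfolding A_def using fmeasurableD2[OF mass_set_fmeasurable, of "t - (t - a) / real (Suc k)"] by simp
    qed
    moreover have "(\<Inter>k. A k) = {x\<in>\<Omega>. t \<le> \<bar>\<phi> x\<bar>}"
    proof -
      have "t \<le> v \<longleftrightarrow> (\<forall>k. t - (t - a) / real (Suc k) \<le> v)" for v
      proof
        assume "t \<le> v"
        thus "\<forall>k. t - (t - a) / real (Suc k) \<le> v" using t by (smt (verit) divide_nonneg_nonneg of_nat_0_le_iff)
      next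
        assume h: "\<forall>k. t - (t - a) / real (Suc k) \<le> v"
        have "(\<lambda>k. t - (t - a) / real (Suc k)) \<longlonglongrightarrow> t" by real_asymp
        thus "t \<le> v" by (rule LIMSEQ_le_const2) (use h in auto)
      qed
      thus ?thesis unfolding A_def by auto
    qed
    moreover have "s \<le> ?mu (A k)" for k
      unfolding A_def mass_def[symmetric]
    proof (rule s)
      have "(t - a) / real (Suc k) \<le> (t - a) / 1" using t by (intro divide_left_mono) auto
      thus "a \<le> t - (t - a) / real (Suc k)" by simp
    qed (use t in simp)
    ultimately show "s \<le> mass \<Omega> \<phi> t" unfolding mass_def by (intro LIMSEQ_le_const) auto
  }
  {
    assume t: "a \<le> t" "t < b" and s: "\<And>r. t < r \<Longrightarrow> r \<le> b \<Longrightarrow> mass \<Omega> \<phi> r \<le> s"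
    \<comment> \<open>Right limit: the levels decrease from \<open>b\<close> to \<open>t\<close>,
      and their superlevel sets exhaust the strict superlevel set of \<open>t\<close>.\<close>
    define A where "A k = {x. t + (b - t) / real (Suc k) \<le> \<bar>\<phi> x\<bar>}" for k
    have U: "(\<Union>k. A k) = {x. t < \<bar>\<phi> x\<bar>}"
    proof -
      have "t < v \<longleftrightarrow> (\<exists>k. t + (b - t) / real (Suc k) \<le> v)" for v
      proof
        assume v: "t < v"
        have "(\<lambda>k. t + (b - t) / real (Suc k)) \<longlonglongrightarrow> t" by real_asymp
        hence "\<forall>\<^sub>F k in sequentially. t + (b - t) / real (Suc k) < v" using v by (rule order_tendstoD)
        thus "\<exists>k. t + (b - t) / real (Suc k) \<le> v" by (auto simp: eventually_sequentially intro: less_imp_le)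
      next
        assume "\<exists>k. t + (b - t) / real (Suc k) \<le> v"
        then obtain k where "t + (b - t) / real (Suc k) \<le> v" by blast
        moreover have "0 < (b - t) / real (Suc k)" using t by simp
        ultimately show "t < v" by linarith
      qed
      thus ?thesis unfolding A_def by auto
    qed
    have "(\<lambda>k. ?mu (A k)) \<longlonglongrightarrow> ?mu (\<Union>k. A k)"
    proof (rule Lim_measure_incseq)
      show "range A \<subseteq> sets lborel" unfolding A_def by auto
      show "incseq A"
      proof (rule incseq_SucI, rule subsetI)
        fix k x assume "x \<in> A k"
        moreover have "(b - t) / real (Suc (Suc k)) \<le> (b - t) / real (Suc k)" using t by (intro divide_left_mono) auto
        ultimately show "x \<in> A (Suc k)" unfolding A_def by auto
      qed
      show "emeasure lborel (\<Union>k. A k) \<noteq> \<infinity>" unfolding U using fmeasurableD2[OF gt_fm[of t]] t ab by simp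
    qed
    moreover have "?mu (A k) \<le> s" for k
    proof -
      have "(b - t) / real (Suc k) \<le> (b - t) / 1" using t by (intro divide_left_mono) auto
      hence p: "0 < (b - t) / real (Suc k)" "(b - t) / real (Suc k) \<le> b - t" using t by auto
      hence "0 < t + (b - t) / real (Suc k)" using t ab by linarith
      hence "?mu (A k) = mass \<Omega> \<phi> (t + (b - t) / real (Suc k))"
        unfolding A_def by (rule mass_pos_level[symmetric])
      also have "\<dots> \<le> s" by (rule s) (use p t in auto)
      finally show ?thesis .
    qed
    ultimately show "?mu {x. t < \<bar>\<phi> x\<bar>} \<le> s" unfolding U by (intro LIMSEQ_le_const2) auto
  }
  {
    assume t: "a \<le> t" "t \<le> b"
    show "?mu {x. t < \<bar>\<phi> x\<bar>} \<le> mass \<Omega> \<phi> t"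
      unfolding mass_def
    proof (rule measure_mono_fmeasurable[OF _ _ mass_set_fmeasurable])
      have "x \<in> \<Omega>" if "t < \<bar>\<phi> x\<bar>" for x using that t ab test_fun_zero_outside(1)[OF \<phi>, of x] by fastforce
      thus "{x. t < \<bar>\<phi> x\<bar>} \<subseteq> {x\<in>\<Omega>. t \<le> \<bar>\<phi> x\<bar>}" by auto
    qed measurable
  }
  {
    assume t: "a \<le> t" "t < r" "r \<le> b"
    have r: "mass \<Omega> \<phi> r = ?mu {x. r \<le> \<bar>\<phi> x\<bar>}" using t ab by (intro mass_pos_level) simp
    show "mass \<Omega> \<phi> r \<le> ?mu {x. t < \<bar>\<phi> x\<bar>}"
      unfolding r by (rule measure_mono_fmeasurable[OF _ _ gt_fm]) (use t ab in auto)
    have mr: "0 < ?mu {x. r \<le> \<bar>\<phi> x\<bar>}" using mass_antimono[OF t(3)] ab r by simp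
    have "lambdaN F ^ (DIM('a) - 1) * (r - t) ^ DIM('a) * mass \<Omega> \<phi> r ^ (DIM('a) - 1)
      \<le> (\<integral>x. indicator {x. t < \<bar>\<phi> x\<bar> \<and> \<bar>\<phi> x\<bar> < r} x * F (grad \<phi> x) ^ DIM('a) \<partial>lborel)
      * (?mu {x. t < \<bar>\<phi> x\<bar>} - mass \<Omega> \<phi> r) ^ (DIM('a) - 1)"
      unfolding r by (rule capacity_step[OF \<phi>]) (use t ab N mr in auto)
    also have "\<dots> \<le> (energy \<phi> r - energy \<phi> t) * (?mu {x. t < \<bar>\<phi> x\<bar>} - mass \<Omega> \<phi> r) ^ (DIM('a) - 1)"
      using energy_diff[of t r] t \<open>mass \<Omega> \<phi> r \<le> ?mu {x. t < \<bar>\<phi> x\<bar>}\<close> by (intro mult_right_mono) auto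
    finally show "lambdaN F ^ (DIM('a) - 1) * (r - t) ^ DIM('a) * mass \<Omega> \<phi> r ^ (DIM('a) - 1)
      \<le> (energy \<phi> r - energy \<phi> t) * (?mu {x. t < \<bar>\<phi> x\<bar>} - mass \<Omega> \<phi> r) ^ (DIM('a) - 1)" .
  }
qed (use N ab mass_antimono energy_mono lambdaN_power(1)[OF N] in auto)

end

end

section \<open>Truncation of test functions\<close>

text \<open>\<open>smooth_on\<close> is coinductive, and the derivative of a product or a power is a
  sum of products rather than one product or power. The coinduction therefore runs over a class
  closed under these operations and under partial derivatives.\<close>

inductive smooth_alg :: "('a::euclidean_space \<Rightarrow> real) \<Rightarrow> bool" where
  base: "smooth_on UNIV f \<Longrightarrow> smooth_alg f"
| const: "smooth_alg (\<lambda>_. c)"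
| add: "smooth_alg f \<Longrightarrow> smooth_alg g \<Longrightarrow> smooth_alg (\<lambda>x. f x + g x)"
| mult: "smooth_alg f \<Longrightarrow> smooth_alg g \<Longrightarrow> smooth_alg (\<lambda>x. f x * g x)"
| powr: "smooth_alg f \<Longrightarrow> (\<And>x. 0 < f x) \<Longrightarrow> smooth_alg (\<lambda>x. f x powr r)"

lemma frechet_derivative_at_eq: "(f has_derivative f') (at x) \<Longrightarrow> frechet_derivative f (at x) = f'"
  by (rule frechet_derivative_at[symmetric])

lemma smooth_alg_step:
  fixes f :: "'a::euclidean_space \<Rightarrow> real"
  assumes "smooth_alg f"
  shows "(\<forall>x. f differentiable (at x)) \<and> (\<forall>i\<in>Basis. smooth_alg (\<lambda>x. frechet_derivative f (at x) i))"
  using assms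
proof induction
  case (base f)
  thus ?case using smooth_on_differentiable smooth_on_partial smooth_alg.base by blast
next
  case (const c)
  have "frechet_derivative (\<lambda>_::'a. c) (at x) i = 0" for x i
    by (subst frechet_derivative_at_eq[OF has_derivative_const]) simp
  moreover have "smooth_alg (\<lambda>_::'a. 0)" by (rule smooth_alg.const)
  ultimately show ?case by simp
next
  case (add f g)
  have d: "(f has_derivative frechet_derivative f (at x)) (at x)" "(g has_derivative frechet_derivative g (at x)) (at x)" for x
    using add frechet_derivative_works by blast+
  have "frechet_derivative (\<lambda>x. f x + g x) (at x) i = frechet_derivative f (at x) i + frechet_derivative g (at x) i" for x i
    by (subst frechet_derivative_at_eq[OF has_derivative_add[OF d]]) simp
  thus ?case using add by (auto intro: smooth_alg.add differentiable_add)
next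
  case (mult f g)
  have d: "(f has_derivative frechet_derivative f (at x)) (at x)" "(g has_derivative frechet_derivative g (at x)) (at x)" for x
    using mult frechet_derivative_works by blast+
  have "frechet_derivative (\<lambda>x. f x * g x) (at x) i = f x * frechet_derivative g (at x) i + frechet_derivative f (at x) i * g x" for x i
    by (subst frechet_derivative_at_eq[OF has_derivative_mult[OF d]]) simp
  thus ?case using mult by (auto intro!: smooth_alg.add smooth_alg.mult intro: differentiable_mult)
next
  case (powr f r)
  have d: "(f has_derivative frechet_derivative f (at x)) (at x)" for x
    using powr frechet_derivative_works by blast
  have D: "((\<lambda>x. f x powr r) has_derivative (\<lambda>h. (r * f x powr (r - 1)) * frechet_derivative f (at x) h)) (at x)" for x
  proof -
    have "((\<lambda>t. t powr r) has_real_derivative (r * f x powr (r - 1))) (at (f x))"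
      by (rule has_real_derivative_powr) (use powr in simp)
    from has_derivative_compose[OF d[of x] this[unfolded has_field_derivative_def]]
    show ?thesis by simp
  qed
  have "frechet_derivative (\<lambda>x. f x powr r) (at x) i = r * f x powr (r - 1) * frechet_derivative f (at x) i" for x i
    by (subst frechet_derivative_at_eq[OF D]) simp
  moreover have "(\<lambda>x. f x powr r) differentiable at x" for x using D differentiableI by blast
  ultimately show ?case using powr by (auto intro!: smooth_alg.mult smooth_alg.powr smooth_alg.const)
qed

lemma smooth_alg_smooth: "smooth_alg f \<Longrightarrow> smooth_on UNIV f"
proof (coinduction arbitrary: f rule: smooth_on.coinduct)
  case smooth_on
  thus ?case using smooth_alg_step by blast
qed

lemma smooth_alg_power: "smooth_alg f \<Longrightarrow> smooth_alg (\<lambda>x. f x ^ n)"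
  by (induction n) (auto intro: smooth_alg.const smooth_alg.mult)

text \<open>A smooth approximation of the truncation of \<open>t\<close> to \<open>[-b, b]\<close>; the factor \<open>k\<close> makes the
  derivative tend to \<open>0\<close> also at \<open>t = b\<close>.\<close>
definition soft :: "nat \<Rightarrow> real \<Rightarrow> real \<Rightarrow> real" where
  "soft k b t = t * (1 + real k * (t / b) ^ (2 * k)) powr (- 1 / (2 * real k))"

definition soft' :: "nat \<Rightarrow> real \<Rightarrow> real \<Rightarrow> real" where
  "soft' k b t = (1 + real k * (t / b) ^ (2 * k)) powr (- 1 / (2 * real k) - 1)"

lemma soft_arg_ge: "1 \<le> 1 + real k * (t / b) ^ (2 * k)"
  by (simp add: power_mult)

lemma soft_arg_pos: "0 < 1 + real k * (t / b) ^ (2 * k)"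
  using soft_arg_ge[of k t b] by linarith

lemma soft_exponent_le: "- 1 / (2 * real k) \<le> 0"
  by (rule divide_nonpos_nonneg) auto

text \<open>With w = 1 + k (t/b)^(2k), the product rule leaves the factor w - k (t/b)^(2k), which is
  1. The derivative is thus a single negative power of w, whence its bounds 0 and 1.\<close>

lemma soft_derivative:
  assumes "0 < k" "0 < b"
  shows "(soft k b has_real_derivative soft' k b t) (at t)"
proof -
  define w where "w t = 1 + real k * (t / b) ^ (2 * k)" for t
  have w: "0 < w t" for t unfolding w_def using soft_arg_ge[of k t b] by linarith
  have dw: "(w has_real_derivative real k * (real (2 * k) * (t / b) ^ (2 * k - 1) * (1 / b))) (at t)"
  proof -
    have "((\<lambda>t. t / b) has_real_derivative 1 / b) (at t)" by (rule DERIV_cdivide[OF DERIV_ident])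
    from DERIV_power[OF this, of "2 * k"] have "((\<lambda>t. (t / b) ^ (2 * k)) has_real_derivative real (2 * k) * (t / b) ^ (2 * k - 1) * (1 / b)) (at t)"
      by (simp add: mult_ac)
    from DERIV_add[OF DERIV_const DERIV_cmult[OF this, of "real k"], of 1] show ?thesis
      unfolding w_def[abs_def] by simp
  qed
  have "((\<lambda>t. t * w t powr (- 1 / (2 * real k))) has_real_derivative
     1 * w t powr (- 1 / (2 * real k)) + ((- 1 / (2 * real k)) * w t powr (- 1 / (2 * real k) - 1) * (real k * (real (2 * k) * (t / b) ^ (2 * k - 1) * (1 / b)))) * t) (at t)"
    by (intro DERIV_mult DERIV_ident DERIV_chain2[OF has_real_derivative_powr dw] w)
  moreover have "1 * w t powr (- 1 / (2 * real k)) + ((- 1 / (2 * real k)) * w t powr (- 1 / (2 * real k) - 1) * (real k * (real (2 * k) * (t / b) ^ (2 * k - 1) * (1 / b)))) * t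
     = soft' k b t"
  proof -
    have "w t powr (- 1 / (2 * real k)) = w t * w t powr (- 1 / (2 * real k) - 1)"
      using w[of t] by (simp add: powr_mult_base)
    note wt = this
    have "(t / b) ^ (2 * k - 1) * (1 / b) * t = (t / b) ^ (2 * k)"
    proof -
      obtain j where "2 * k = Suc j" using assms by (cases "2 * k") auto
      thus ?thesis by simp
    qed
    moreover have "((- 1 / (2 * real k)) * P * (real k * (real (2 * k) * q * (1 / b)))) * t = - (real k * (q * (1 / b) * t)) * P" for P q
      using assms by (simp add: field_simps)
    ultimately have "((- 1 / (2 * real k)) * w t powr (- 1 / (2 * real k) - 1) * (real k * (real (2 * k) * (t / b) ^ (2 * k - 1) * (1 / b)))) * t
       = - (real k * (t / b) ^ (2 * k)) * w t powr (- 1 / (2 * real k) - 1)" by metis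
    note B = this
    have C: "real k * (t / b) ^ (2 * k) = w t - 1" unfolding w_def by simp
    show ?thesis unfolding B C wt soft'_def w_def[symmetric] by (simp add: algebra_simps)
  qed
  ultimately show ?thesis unfolding soft_def[abs_def] w_def by simp
qed

lemma soft'_bounds: "0 \<le> soft' k b t" "soft' k b t \<le> 1"
proof -
  show "0 \<le> soft' k b t" unfolding soft'_def by simp
  have "(1 + real k * (t / b) ^ (2 * k)) powr (- 1 / (2 * real k) - 1) \<le> (1 + real k * (t / b) ^ (2 * k)) powr 0"
    using soft_arg_ge[of k t b] soft_exponent_le[of k] by (intro powr_mono) linarith+
  thus "soft' k b t \<le> 1" unfolding soft'_def using soft_arg_ge[of k t b] by simp
qed

text \<open>The constant on the left tends to 1 as k grows, so in the limit the norms of the smooth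
  truncations are not below that of the true one.\<close>

lemma soft_ge:
  assumes "0 < k" "0 < b"
  shows "(1 + real k) powr (- 1 / (2 * real k)) * min \<bar>t\<bar> b \<le> \<bar>soft k b t\<bar>"
proof -
  define c where "c = \<bar>t\<bar> / b"
  have c: "c \<ge> 0" unfolding c_def using assms by simp
  have tc: "(t / b) ^ (2 * k) = c ^ (2 * k)" unfolding c_def by (simp add: power_mult power_divide)
  define M where "M = max 1 c"
  have M: "M \<ge> 1" "c \<le> M" unfolding M_def by auto
  have "1 + real k * (t / b) ^ (2 * k) \<le> (1 + real k) * M ^ (2 * k)"
  proof -
    have "1 \<le> M ^ (2 * k)" using M by simp
    moreover have "real k * c ^ (2 * k) \<le> real k * M ^ (2 * k)" using M c by (intro mult_left_mono power_mono) auto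
    ultimately show ?thesis unfolding tc by (simp add: algebra_simps)
  qed
  hence "((1 + real k) * M ^ (2 * k)) powr (- 1 / (2 * real k)) \<le> (1 + real k * (t / b) ^ (2 * k)) powr (- 1 / (2 * real k))"
    using soft_arg_pos[of k t b] soft_exponent_le[of k] by (intro powr_mono2') auto
  moreover have "((1 + real k) * M ^ (2 * k)) powr (- 1 / (2 * real k)) = (1 + real k) powr (- 1 / (2 * real k)) * (1 / M)"
  proof -
    have "(M ^ (2 * k)) powr (- 1 / (2 * real k)) = M powr (real (2 * k) * (- 1 / (2 * real k)))"
      using M by (subst powr_realpow[symmetric]) (auto simp: powr_powr)
    also have "real (2 * k) * (- 1 / (2 * real k)) = - 1" using assms by simp
    finally have "(M ^ (2 * k)) powr (- 1 / (2 * real k)) = 1 / M" using M by (simp add: powr_minus_divide)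
    moreover have "((1 + real k) * M ^ (2 * k)) powr (- 1 / (2 * real k)) = (1 + real k) powr (- 1 / (2 * real k)) * (M ^ (2 * k)) powr (- 1 / (2 * real k))"
      by (rule powr_mult)
    ultimately show ?thesis by simp
  qed
  ultimately have "(1 + real k) powr (- 1 / (2 * real k)) * (1 / M) \<le> (1 + real k * (t / b) ^ (2 * k)) powr (- 1 / (2 * real k))" by simp
  hence "\<bar>t\<bar> * ((1 + real k) powr (- 1 / (2 * real k)) * (1 / M)) \<le> \<bar>t\<bar> * (1 + real k * (t / b) ^ (2 * k)) powr (- 1 / (2 * real k))"
    by (intro mult_left_mono) auto
  moreover have "\<bar>t\<bar> * (1 / M) = min \<bar>t\<bar> b"
    unfolding M_def c_def using assms by (auto simp: min_def max_def field_simps)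
  hence "(1 + real k) powr (- 1 / (2 * real k)) * min \<bar>t\<bar> b = \<bar>t\<bar> * ((1 + real k) powr (- 1 / (2 * real k)) * (1 / M))"
    by (metis mult.left_commute)
  ultimately show ?thesis unfolding soft_def abs_mult by simp
qed

lemma soft'_tendsto:
  assumes "0 < b"
  shows "(\<lambda>k. soft' k b t) \<longlonglongrightarrow> (if \<bar>t\<bar> < b then 1 else 0)"
proof -
  define c where "c = \<bar>t\<bar> / b"
  have c: "c \<ge> 0" unfolding c_def using assms by simp
  have tc: "(t / b) ^ (2 * k) = c ^ (2 * k)" for k unfolding c_def by (simp add: power_mult power_divide)
  show ?thesis
  proof (cases "\<bar>t\<bar> < b")
    case True
    hence c1: "c < 1" unfolding c_def using assms by simp
    have "(\<lambda>k. real k * (c ^ 2) ^ k) \<longlonglongrightarrow> 0"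
      by (rule powser_times_n_limit_0) (use c c1 in \<open>simp add: power_less_one_iff abs_square_less_1\<close>)
    hence "(\<lambda>k. real k * c ^ (2 * k)) \<longlonglongrightarrow> 0" by (simp only: power_mult)
    hence "(\<lambda>k. 1 + real k * (t / b) ^ (2 * k)) \<longlonglongrightarrow> 1 + 0"
      unfolding tc by (intro tendsto_intros)
    \<comment> \<open>For k > 0 the varying exponent of \<open>soft'\<close> lies between - 2 and -
      1, so fixed powers serve as bounds.\<close>
    hence "(\<lambda>k. (1 + real k * (t / b) ^ (2 * k)) powr (- 2)) \<longlonglongrightarrow> (1 + 0) powr (- 2)"
      by (rule tendsto_powr[OF _ tendsto_const]) simp
    hence lim: "(\<lambda>k. (1 + real k * (t / b) ^ (2 * k)) powr (- 2)) \<longlonglongrightarrow> 1" by simp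
    have "\<forall>\<^sub>F k in sequentially. (1 + real k * (t / b) ^ (2 * k)) powr (- 2) \<le> soft' k b t"
      using eventually_gt_at_top[of 0]
    proof eventually_elim
      case (elim k)
      hence "- 2 \<le> - 1 / (2 * real k) - 1" by simp
      thus ?case unfolding soft'_def by (rule powr_mono[OF _ soft_arg_ge])
    qed
    moreover have "\<forall>\<^sub>F k in sequentially. soft' k b t \<le> 1" using soft'_bounds by simp
    ultimately have "(\<lambda>k. soft' k b t) \<longlonglongrightarrow> 1"
      by (rule tendsto_sandwich[OF _ _ lim tendsto_const])
    thus ?thesis using True by simp
  next
    case False
    hence c1: "1 \<le> c" unfolding c_def using assms by simp
    have "soft' k b t \<le> (1 + real k) powr (- 1)" for k
    proof -
      have "1 + real k \<le> 1 + real k * (t / b) ^ (2 * k)"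
        unfolding tc using c1 mult_left_mono[of 1 "c ^ (2 * k)" "real k"] by simp
      hence "(1 + real k * (t / b) ^ (2 * k)) powr (- 1) \<le> (1 + real k) powr (- 1)"
        by (intro powr_mono2') auto
      moreover have "soft' k b t \<le> (1 + real k * (t / b) ^ (2 * k)) powr (- 1)"
        unfolding soft'_def by (rule powr_mono[OF _ soft_arg_ge]) (use soft_exponent_le[of k] in linarith)
      ultimately show ?thesis by linarith
    qed
    hence up: "\<forall>\<^sub>F k in sequentially. soft' k b t \<le> (1 + real k) powr (- 1)" by simp
    have lim: "(\<lambda>k. (1 + real k) powr (- 1)) \<longlonglongrightarrow> 0" by real_asymp
    have "\<forall>\<^sub>F k in sequentially. 0 \<le> soft' k b t" using soft'_bounds by simp
    hence "(\<lambda>k. soft' k b t) \<longlonglongrightarrow> 0" by (rule tendsto_sandwich[OF _ up tendsto_const lim])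
    thus ?thesis using False by simp
  qed
qed

lemma test_fun_support_subset:
  assumes "test_fun \<Omega> \<phi>" "smooth_on UNIV g" and sub: "{x. g x \<noteq> 0} \<subseteq> {x. \<phi> x \<noteq> 0}"
  shows "test_fun \<Omega> g"
proof -
  have cl: "closure {x. g x \<noteq> 0} \<subseteq> closure {x. \<phi> x \<noteq> 0}" by (rule closure_mono[OF sub])
  hence "compact (closure {x. g x \<noteq> 0})"
    using assms(1) unfolding test_fun_def by (meson closed_closure compact_closure bounded_subset compact_imp_bounded closure_subset)
  thus ?thesis using assms(1,2) cl unfolding test_fun_def by blast
qed

lemma soft_test_fun:
  assumes \<phi>: "test_fun \<Omega> \<phi>" and k: "0 < k" "0 < b"
  shows "test_fun \<Omega> (\<lambda>x. soft k b (\<phi> x))" "grad (\<lambda>x. soft k b (\<phi> x)) x = soft' k b (\<phi> x) *\<^sub>R grad \<phi> x"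
proof -
  have sm: "smooth_on UNIV \<phi>" using \<phi> unfolding test_fun_def by blast
  have "smooth_alg (\<lambda>x. \<phi> x * (1 + real k * (\<phi> x * (1 / b)) ^ (2 * k)) powr (- 1 / (2 * real k)))"
  proof (intro smooth_alg.intros(4,5) smooth_alg.base[OF sm])
    show "smooth_alg (\<lambda>x. 1 + real k * (\<phi> x * (1 / b)) ^ (2 * k))"
      by (intro smooth_alg.add smooth_alg.mult smooth_alg.const smooth_alg_power smooth_alg.base[OF sm])
    show "0 < 1 + real k * (\<phi> x * (1 / b)) ^ (2 * k)" for x
      using soft_arg_pos[of k "\<phi> x" b] by simp
  qed
  hence "smooth_on UNIV (\<lambda>x. soft k b (\<phi> x))" unfolding soft_def using smooth_alg_smooth by simp
  thus "test_fun \<Omega> (\<lambda>x. soft k b (\<phi> x))"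
    by (rule test_fun_support_subset[OF \<phi>]) (auto simp: soft_def)
  have "((\<lambda>x. soft k b (\<phi> x)) has_derivative (\<lambda>h. soft' k b (\<phi> x) * (grad \<phi> x \<bullet> h))) (at x)"
    using has_derivative_compose[OF test_fun_has_derivative[OF \<phi>] soft_derivative[OF k, unfolded has_field_derivative_def]] .
  thus "grad (\<lambda>x. soft k b (\<phi> x)) x = soft' k b (\<phi> x) *\<^sub>R grad \<phi> x"
    by (rule grad_unique) simp
qed

section \<open>Profiles of test functions\<close>

lemma Lp_norm_lborel: "Lp_norm p \<Omega> u = enn2real (\<integral>\<^sup>+x\<in>\<Omega>. ennreal (\<bar>u x\<bar> powr p) \<partial>lborel) powr (1 / p)"
  unfolding Lp_norm_def nn_integral_completion ..

lemma Lp_norm_nonneg: "0 \<le> Lp_norm p \<Omega> u"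
  unfolding Lp_norm_def by simp

text \<open>\<open>Lp_norm\<close> sends an infinite integral to 0 through \<open>enn2real\<close>;
  the finiteness hypothesis, here and in several lemmas below, excludes this value.\<close>

lemma nn_integral_eq_Lp_norm:
  assumes "0 < p" "(\<integral>\<^sup>+x\<in>\<Omega>. ennreal (\<bar>u x\<bar> powr p) \<partial>lborel) < \<infinity>"
  shows "(\<integral>\<^sup>+x\<in>\<Omega>. ennreal (\<bar>u x\<bar> powr p) \<partial>lborel) = ennreal (Lp_norm p \<Omega> u powr p)"
  unfolding Lp_norm_lborel using assms by (simp add: powr_powr)

lemma Lp_norm_le:
  assumes "0 < p" "0 \<le> M" "(\<integral>\<^sup>+x\<in>\<Omega>. ennreal (\<bar>u x\<bar> powr p) \<partial>lborel) \<le> ennreal (M powr p)"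
  shows "Lp_norm p \<Omega> u \<le> M"
proof -
  have "enn2real (\<integral>\<^sup>+x\<in>\<Omega>. ennreal (\<bar>u x\<bar> powr p) \<partial>lborel) \<le> M powr p"
    using assms(3) by (intro enn2real_leI) auto
  hence "Lp_norm p \<Omega> u \<le> (M powr p) powr (1 / p)"
    unfolding Lp_norm_lborel using assms by (intro powr_mono2) auto
  thus ?thesis using assms by (simp add: powr_powr)
qed

lemma Lp_norm_mono:
  assumes "0 < p" "\<And>x. x \<in> \<Omega> \<Longrightarrow> \<bar>u x\<bar> \<le> \<bar>v x\<bar>" "(\<integral>\<^sup>+x\<in>\<Omega>. ennreal (\<bar>v x\<bar> powr p) \<partial>lborel) < \<infinity>"
  shows "Lp_norm p \<Omega> u \<le> Lp_norm p \<Omega> v"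
proof (rule Lp_norm_le[OF assms(1) Lp_norm_nonneg])
  have "(\<integral>\<^sup>+x\<in>\<Omega>. ennreal (\<bar>u x\<bar> powr p) \<partial>lborel) \<le> (\<integral>\<^sup>+x\<in>\<Omega>. ennreal (\<bar>v x\<bar> powr p) \<partial>lborel)"
    by (intro nn_integral_mono) (use assms in \<open>auto simp: indicator_def intro!: powr_mono2\<close>)
  thus "(\<integral>\<^sup>+x\<in>\<Omega>. ennreal (\<bar>u x\<bar> powr p) \<partial>lborel) \<le> ennreal (Lp_norm p \<Omega> v powr p)"
    using nn_integral_eq_Lp_norm[OF assms(1,3)] by simp
qed

lemma Lp_norm_scale:
  assumes "0 < p" "0 \<le> c" and [measurable]: "u \<in> borel_measurable lborel" "\<Omega> \<in> sets lborel"
  shows "Lp_norm p \<Omega> (\<lambda>x. c * u x) = c * Lp_norm p \<Omega> u"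
proof -
  have "(\<integral>\<^sup>+x\<in>\<Omega>. ennreal (\<bar>c * u x\<bar> powr p) \<partial>lborel) = (\<integral>\<^sup>+x\<in>\<Omega>. ennreal (c powr p) * ennreal (\<bar>u x\<bar> powr p) \<partial>lborel)"
    using assms(1,2) by (simp add: abs_mult powr_mult ennreal_mult)
  hence "Lp_norm p \<Omega> (\<lambda>x. c * u x) = enn2real (\<integral>\<^sup>+x. ennreal (c powr p) * (ennreal (\<bar>u x\<bar> powr p) * indicator \<Omega> x) \<partial>lborel) powr (1 / p)"
    unfolding Lp_norm_lborel by (simp add: mult.assoc)
  also have "(\<integral>\<^sup>+x. ennreal (c powr p) * (ennreal (\<bar>u x\<bar> powr p) * indicator \<Omega> x) \<partial>lborel)
      = ennreal (c powr p) * (\<integral>\<^sup>+x\<in>\<Omega>. ennreal (\<bar>u x\<bar> powr p) \<partial>lborel)"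
    by (rule nn_integral_cmult) measurable
  also have "enn2real \<dots> powr (1 / p) = c * Lp_norm p \<Omega> u"
    unfolding Lp_norm_lborel using assms(1,2) by (simp add: enn2real_mult powr_mult powr_powr)
  finally show ?thesis .
qed

lemma nn_integral_bounded_finite:
  fixes u :: "'a::euclidean_space \<Rightarrow> real"
  assumes "0 < p" "emeasure lborel \<Omega> < \<infinity>" "\<Omega> \<in> sets lborel" "\<And>x. x \<in> \<Omega> \<Longrightarrow> \<bar>u x\<bar> \<le> M"
  shows "(\<integral>\<^sup>+x\<in>\<Omega>. ennreal (\<bar>u x\<bar> powr p) \<partial>lborel) < \<infinity>"
proof -
  have "(\<integral>\<^sup>+x\<in>\<Omega>. ennreal (\<bar>u x\<bar> powr p) \<partial>lborel) \<le> (\<integral>\<^sup>+x. ennreal (\<bar>M\<bar> powr p) * indicator \<Omega> x \<partial>lborel)"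
    by (intro nn_integral_mono) (use assms in \<open>fastforce simp: indicator_def intro!: powr_mono2 ennreal_leI\<close>)
  also have "\<dots> = ennreal (\<bar>M\<bar> powr p) * emeasure lborel \<Omega>" using assms by (simp add: nn_integral_cmult_indicator)
  also have "\<dots> < \<infinity>" using assms by (simp add: ennreal_mult_less_top)
  finally show ?thesis .
qed

text \<open>Minkowski's inequality from the convexity bound \<open>powr_add_split\<close>, with the
  share of the second norm as the weight \<theta>. The summand \<epsilon>/2 keeps both norms
  positive.\<close>

lemma Lp_norm_triangle:
  fixes u v w :: "'a::euclidean_space \<Rightarrow> real"
  assumes p: "1 \<le> p" and meas: "u \<in> borel_measurable lborel" "v \<in> borel_measurable lborel" "\<Omega> \<in> sets lborel"
    and le: "\<And>x. x \<in> \<Omega> \<Longrightarrow> \<bar>w x\<bar> \<le> \<bar>u x\<bar> + \<bar>v x\<bar>"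
    and fin: "(\<integral>\<^sup>+x\<in>\<Omega>. ennreal (\<bar>u x\<bar> powr p) \<partial>lborel) < \<infinity>" "(\<integral>\<^sup>+x\<in>\<Omega>. ennreal (\<bar>v x\<bar> powr p) \<partial>lborel) < \<infinity>"
  shows "Lp_norm p \<Omega> w \<le> Lp_norm p \<Omega> u + Lp_norm p \<Omega> v"
proof (rule field_le_epsilon)
  fix \<epsilon> :: real assume \<epsilon>: "0 < \<epsilon>"
  have p0: "0 < p" using p by simp
  define a where "a = Lp_norm p \<Omega> u + \<epsilon> / 2"
  define b where "b = Lp_norm p \<Omega> v + \<epsilon> / 2"
  have ab: "0 < a" "0 < b" unfolding a_def b_def using Lp_norm_nonneg[of p \<Omega> u] Lp_norm_nonneg[of p \<Omega> v] \<epsilon> by linarith+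
  define \<theta> where "\<theta> = b / (a + b)"
  have \<theta>: "0 < \<theta>" "\<theta> < 1" "1 - \<theta> = a / (a + b)" unfolding \<theta>_def using ab by (auto simp: field_simps)
  note [measurable] = meas
  have "(\<integral>\<^sup>+x\<in>\<Omega>. ennreal (\<bar>w x\<bar> powr p) \<partial>lborel)
     \<le> (\<integral>\<^sup>+x. ennreal (1 / (1 - \<theta>) powr (p - 1)) * (ennreal (\<bar>u x\<bar> powr p) * indicator \<Omega> x)
        + ennreal (1 / \<theta> powr (p - 1)) * (ennreal (\<bar>v x\<bar> powr p) * indicator \<Omega> x) \<partial>lborel)"
  proof (rule nn_integral_mono)
    fix x
    show "ennreal (\<bar>w x\<bar> powr p) * indicator \<Omega> x \<le> ennreal (1 / (1 - \<theta>) powr (p - 1)) * (ennreal (\<bar>u x\<bar> powr p) * indicator \<Omega> x)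
        + ennreal (1 / \<theta> powr (p - 1)) * (ennreal (\<bar>v x\<bar> powr p) * indicator \<Omega> x)"
    proof (cases "x \<in> \<Omega>")
      case True
      have "\<bar>w x\<bar> powr p \<le> (\<bar>u x\<bar> + \<bar>v x\<bar>) powr p" using le[OF True] p by (intro powr_mono2) auto
      also have "\<dots> \<le> \<bar>u x\<bar> powr p / (1 - \<theta>) powr (p - 1) + \<bar>v x\<bar> powr p / \<theta> powr (p - 1)"
        by (rule powr_add_split) (use \<theta> p in auto)
      finally have "ennreal (\<bar>w x\<bar> powr p) \<le> ennreal (1 / (1 - \<theta>) powr (p - 1) * \<bar>u x\<bar> powr p + 1 / \<theta> powr (p - 1) * \<bar>v x\<bar> powr p)"
        by (intro ennreal_leI) simp
      also have "\<dots> = ennreal (1 / (1 - \<theta>) powr (p - 1)) * ennreal (\<bar>u x\<bar> powr p) + ennreal (1 / \<theta> powr (p - 1)) * ennreal (\<bar>v x\<bar> powr p)"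
        by (simp add: ennreal_mult[symmetric] ennreal_plus[symmetric] del: ennreal_plus)
      finally show ?thesis using True by simp
    qed simp
  qed
  also have "\<dots> = ennreal (1 / (1 - \<theta>) powr (p - 1)) * ennreal (Lp_norm p \<Omega> u powr p) + ennreal (1 / \<theta> powr (p - 1)) * ennreal (Lp_norm p \<Omega> v powr p)"
    unfolding nn_integral_eq_Lp_norm[OF p0 fin(1), symmetric] nn_integral_eq_Lp_norm[OF p0 fin(2), symmetric]
    by (subst nn_integral_add) (auto simp: nn_integral_cmult)
  also have "\<dots> = ennreal (1 / (1 - \<theta>) powr (p - 1) * Lp_norm p \<Omega> u powr p + 1 / \<theta> powr (p - 1) * Lp_norm p \<Omega> v powr p)"
    by (simp add: ennreal_mult[symmetric] ennreal_plus[symmetric] del: ennreal_plus)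
  also have "\<dots> \<le> ennreal ((a + b) powr p)"
  proof (rule ennreal_leI)
    have "1 / (1 - \<theta>) powr (p - 1) * Lp_norm p \<Omega> u powr p + 1 / \<theta> powr (p - 1) * Lp_norm p \<Omega> v powr p
       \<le> 1 / (1 - \<theta>) powr (p - 1) * a powr p + 1 / \<theta> powr (p - 1) * b powr p"
      unfolding a_def b_def using \<epsilon> p Lp_norm_nonneg by (intro add_mono mult_left_mono powr_mono2) auto
    also have "\<dots> = (a + b) powr p"
    proof -
      have "z powr p = z powr (p - 1) * z" if "0 < z" for z using that by (simp add: powr_diff)
      moreover have "1 / (c / (a + b)) powr (p - 1) * (c powr (p - 1) * c) = (a + b) powr (p - 1) * c" if "0 < c" for c
        using that ab by (simp add: powr_divide)
      ultimately show ?thesis using ab unfolding \<theta>(3) unfolding \<theta>_def by (simp add: distrib_left[symmetric])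
    qed
    finally show "1 / (1 - \<theta>) powr (p - 1) * Lp_norm p \<Omega> u powr p + 1 / \<theta> powr (p - 1) * Lp_norm p \<Omega> v powr p \<le> (a + b) powr p" .
  qed
  finally have "Lp_norm p \<Omega> w \<le> a + b" by (rule Lp_norm_le[OF p0, rotated]) (use ab in simp)
  thus "Lp_norm p \<Omega> w \<le> Lp_norm p \<Omega> u + Lp_norm p \<Omega> v + \<epsilon>" unfolding a_def b_def by simp
qed

lemma ennreal_term_le_suminf: "f k \<le> (\<Sum>k. f k :: ennreal)"
  using sum_le_suminf[OF summableI, of "{k}" f] by simp

text \<open>The exponential uses only half of z, so that it remains summable against a measure that
  decays like exp (- z).\<close>

lemma powr_le_exp:
  fixes z p :: real
  assumes "0 \<le> z" "0 < p"
  shows "z powr p \<le> (2 * p) powr p * exp (z / 2)"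
proof -
  have "z / (2 * p) \<le> exp (z / (2 * p))" using exp_ge_add_one_self[of "z / (2 * p)"] by linarith
  hence "z \<le> 2 * p * exp (z / (2 * p))" using assms by (simp add: field_simps)
  hence "z powr p \<le> (2 * p * exp (z / (2 * p))) powr p" using assms by (intro powr_mono2) auto
  also have "\<dots> = (2 * p) powr p * exp (z / (2 * p)) powr p" using assms by (simp add: powr_mult)
  also have "exp (z / (2 * p)) powr p = exp (z / 2)" using assms by (simp add: powr_def)
  finally show ?thesis .
qed

text \<open>The p-th root of the constant of \<open>powr_le_exp\<close> times the sum of exp ((k +
  1) / 2) exp (- k) over all k, which estimates the integral layer by layer.\<close>

definition tail_const :: "real \<Rightarrow> real" where
  "tail_const p = ((2 * p) powr p * (exp (1 / 2) / (1 - exp (- 1 / 2)))) powr (1 / p)"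

lemma tail_const_nonneg: "0 \<le> tail_const p"
  unfolding tail_const_def by simp

text \<open>The values of \<open>w\<close> are sliced into layers of height \<open>H\<close>, and
  each layer is measured by the tail bound at its lower end. The condition \<open>0 < w x\<close>
  matters at z = 0 only: it keeps the zero set of \<open>w\<close> from counting against
  \<open>A\<close>.\<close>

lemma Lp_norm_exponential_tail:
  fixes w :: "'a::euclidean_space \<Rightarrow> real"
  assumes p: "0 < p" and [measurable]: "w \<in> borel_measurable borel" "\<Omega> \<in> sets borel" and w0: "\<And>x. 0 \<le> w x"
    and AH: "0 < A" "0 < H"
    and tail: "\<And>z. 0 \<le> z \<Longrightarrow> emeasure lborel {x\<in>\<Omega>. 0 < w x \<and> z \<le> w x} \<le> ennreal (A * exp (- (z / H)))"
  shows "Lp_norm p \<Omega> w \<le> tail_const p * A powr (1 / p) * H"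
proof (rule Lp_norm_le[OF p])
  define C where "C = (2 * p) powr p"
  have C: "0 < C" unfolding C_def using p by simp
  define S where "S k = {x\<in>\<Omega>. 0 < w x \<and> real k * H \<le> w x}" for k :: nat
  have S [measurable]: "S k \<in> sets borel" for k unfolding S_def by measurable
  have pt: "ennreal (\<bar>w x\<bar> powr p) * indicator \<Omega> x \<le> (\<Sum>k. ennreal (H powr p * C * exp ((real k + 1) / 2)) * indicator (S k) x)" for x
  proof (cases "x \<in> \<Omega> \<and> 0 < w x")
    case True
    define k where "k = nat \<lfloor>w x / H\<rfloor>"
    have k: "real k \<le> w x / H" "w x / H \<le> real k + 1" unfolding k_def using True AH by (auto simp: le_floor_iff)
    have xS: "x \<in> S k" unfolding S_def using True k AH by (simp add: field_simps)
    have "w x powr p = H powr p * (w x / H) powr p" using True AH by (simp add: powr_divide)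
    also have "\<dots> \<le> H powr p * (C * exp (w x / H / 2))"
      unfolding C_def using True AH p by (intro mult_left_mono powr_le_exp) auto
    also have "\<dots> \<le> H powr p * (C * exp ((real k + 1) / 2))"
      using k C by (intro mult_left_mono) auto
    finally have "ennreal (\<bar>w x\<bar> powr p) * indicator \<Omega> x \<le> ennreal (H powr p * C * exp ((real k + 1) / 2)) * indicator (S k) x"
      using True xS by (simp add: ennreal_leI mult.assoc)
    also have "\<dots> \<le> (\<Sum>k. ennreal (H powr p * C * exp ((real k + 1) / 2)) * indicator (S k) x)"
      by (rule ennreal_term_le_suminf)
    finally show ?thesis .
  next
    case False
    hence zero: "ennreal (\<bar>w x\<bar> powr p) * indicator \<Omega> x = 0" using w0[of x] by (auto simp: indicator_def)
    show ?thesis unfolding zero by simp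
  qed
  have "(\<integral>\<^sup>+x\<in>\<Omega>. ennreal (\<bar>w x\<bar> powr p) \<partial>lborel) \<le> (\<integral>\<^sup>+x. (\<Sum>k. ennreal (H powr p * C * exp ((real k + 1) / 2)) * indicator (S k) x) \<partial>lborel)"
    by (rule nn_integral_mono) (rule pt)
  also have "\<dots> = (\<Sum>k. ennreal (H powr p * C * exp ((real k + 1) / 2)) * emeasure lborel (S k))"
    by (subst nn_integral_suminf) (auto simp: nn_integral_cmult_indicator)
  also have "\<dots> \<le> (\<Sum>k. ennreal (H powr p * C * A * exp (1 / 2) * exp (- 1 / 2) ^ k))"
  proof (rule suminf_le)
    fix k
    have "ennreal (H powr p * C * exp ((real k + 1) / 2)) * emeasure lborel (S k)
      \<le> ennreal (H powr p * C * exp ((real k + 1) / 2)) * ennreal (A * exp (- (real k * H / H)))"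
      unfolding S_def using AH by (intro mult_left_mono tail) auto
    also have "\<dots> = ennreal ((H powr p * C * exp ((real k + 1) / 2)) * (A * exp (- (real k * H / H))))"
      using C AH by (intro ennreal_mult[symmetric]) auto
    also have "(H powr p * C * exp ((real k + 1) / 2)) * (A * exp (- (real k * H / H))) = H powr p * C * A * (exp ((real k + 1) / 2) * exp (- real k))"
      using AH by simp
    also have "exp ((real k + 1) / 2) * exp (- real k) = exp (1 / 2) * exp (- 1 / 2) ^ k"
      unfolding exp_add[symmetric] exp_of_nat_mult[symmetric] by (simp add: field_simps)
    finally show "ennreal (H powr p * C * exp ((real k + 1) / 2)) * emeasure lborel (S k) \<le> ennreal (H powr p * C * A * exp (1 / 2) * exp (- 1 / 2) ^ k)"
      by (simp add: mult.assoc)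
  qed auto
  also have "\<dots> = ennreal (H powr p * C * A * exp (1 / 2) * (1 / (1 - exp (- 1 / 2))))"
  proof -
    have "(\<lambda>k. H powr p * C * A * exp (1 / 2) * exp (- 1 / 2) ^ k) sums (H powr p * C * A * exp (1 / 2) * (1 / (1 - exp (- 1 / 2))))"
      by (intro sums_mult geometric_sums) simp
    thus ?thesis using C AH by (intro suminf_ennreal_eq) auto
  qed
  also have "H powr p * C * A * exp (1 / 2) * (1 / (1 - exp (- 1 / 2))) = (tail_const p * A powr (1 / p) * H) powr p"
    unfolding tail_const_def C_def using p AH by (simp add: powr_mult powr_powr)
  finally show "(\<integral>\<^sup>+x\<in>\<Omega>. ennreal (\<bar>w x\<bar> powr p) \<partial>lborel) \<le> ennreal ((tail_const p * A powr (1 / p) * H) powr p)" .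
qed (use AH tail_const_nonneg in auto)

lemma test_fun_bounded:
  assumes \<phi>: "test_fun \<Omega> \<phi>"
  shows "\<exists>M>0. \<forall>x. \<bar>\<phi> x\<bar> < M"
proof -
  have "compact (closure {x. \<phi> x \<noteq> 0})" using \<phi> unfolding test_fun_def by blast
  moreover have "continuous_on (closure {x. \<phi> x \<noteq> 0}) \<phi>"
    by (rule continuous_on_subset[OF test_fun_continuous[OF \<phi>] subset_UNIV])
  ultimately have "bounded (\<phi> ` closure {x. \<phi> x \<noteq> 0})"
    using compact_continuous_image compact_imp_bounded by metis
  then obtain M where M: "\<forall>y \<in> \<phi> ` closure {x. \<phi> x \<noteq> 0}. norm y \<le> M"
    unfolding bounded_iff ..
  have "\<bar>\<phi> x\<bar> < \<bar>M\<bar> + 1" for x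
  proof (cases "x \<in> closure {x. \<phi> x \<noteq> 0}")
    case True
    hence "\<phi> x \<in> \<phi> ` closure {x. \<phi> x \<noteq> 0}" by (rule imageI)
    hence "norm (\<phi> x) \<le> M" by (rule M[rule_format])
    thus ?thesis by simp
  next
    case False
    have "\<phi> x = 0" by (rule test_fun_zero(1)[OF \<phi> False])
    thus ?thesis by simp
  qed
  thus ?thesis by (intro exI[of _ "\<bar>M\<bar> + 1"]) auto
qed

lemma W0_test_fun:
  assumes "test_fun \<Omega> \<psi>" "0 < q"
  shows "W0 q \<Omega> \<psi> (grad \<psi>)"
  unfolding W0_def using assms
  by (auto intro!: exI[of _ "\<lambda>_. \<psi>"] measurable_completion test_fun_measurable[OF assms(1)])

section \<open>Truncations and the variational constant\<close>

context anisotropic begin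

lemma gamma1_le:
  fixes \<psi> :: "'a \<Rightarrow> real"
  assumes \<psi>: "test_fun \<Omega> \<psi>" and \<Omega>: "open \<Omega>" "bounded \<Omega>" and p: "0 < p"
  shows "gamma1 F \<Omega> p * Lp_norm p \<Omega> \<psi> ^ DIM('a) \<le> (\<integral>x. F (grad \<psi> x) ^ DIM('a) \<partial>lborel)"
proof -
  let ?S = "{(\<integral>x\<in>\<Omega>. F (Du x) ^ DIM('a) \<partial>lebesgue) / Lp_norm p \<Omega> u ^ DIM('a) | u Du.
       W0 (real DIM('a)) \<Omega> u Du \<and> \<not> (AE x in lebesgue. x \<in> \<Omega> \<longrightarrow> u x = 0)}"
  let ?E = "\<integral>x. F (grad \<psi> x) ^ DIM('a) \<partial>lborel"
  have [measurable]: "\<psi> \<in> borel_measurable borel" "grad \<psi> \<in> borel_measurable borel" "\<Omega> \<in> sets borel"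
    using test_fun_measurable[OF \<psi>] \<Omega> by auto
  have E0: "0 \<le> ?E" by (intro Bochner_Integration.integral_nonneg) (simp add: F_nonneg)
  have E: "(\<integral>x\<in>\<Omega>. F (grad \<psi> x) ^ DIM('a) \<partial>lebesgue) = ?E"
  proof -
    have "(\<integral>x\<in>\<Omega>. F (grad \<psi> x) ^ DIM('a) \<partial>lebesgue) = (\<integral>x. F (grad \<psi> x) ^ DIM('a) \<partial>lebesgue)"
      unfolding set_lebesgue_integral_def
      by (intro Bochner_Integration.integral_cong refl) (use test_fun_zero_outside(2)[OF \<psi>] in \<open>auto simp: indicator_def\<close>)
    also have "\<dots> = ?E" by (rule integral_completion) measurable
    finally show ?thesis .
  qed
  have lower: "0 \<le> z" if "z \<in> ?S" for z
    using that by (auto simp: set_lebesgue_integral_def F_nonneg Lp_norm_nonneg intro!: divide_nonneg_nonneg Bochner_Integration.integral_nonneg)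
  show ?thesis
  proof (cases "AE x in lebesgue. x \<in> \<Omega> \<longrightarrow> \<psi> x = 0")
    case True
    hence "AE x in lebesgue. ennreal (\<bar>\<psi> x\<bar> powr p) * indicator \<Omega> x = 0"
      by eventually_elim (auto simp: indicator_def)
    from nn_integral_cong_AE[OF this] have "(\<integral>\<^sup>+x\<in>\<Omega>. ennreal (\<bar>\<psi> x\<bar> powr p) \<partial>lebesgue) = 0" by simp
    hence "Lp_norm p \<Omega> \<psi> = 0" unfolding Lp_norm_def by simp
    thus ?thesis using E0 by (simp add: zero_power)
  next
    case False
    have "W0 (real DIM('a)) \<Omega> \<psi> (grad \<psi>)" by (rule W0_test_fun[OF \<psi>]) simp
    hence "(\<integral>x\<in>\<Omega>. F (grad \<psi> x) ^ DIM('a) \<partial>lebesgue) / Lp_norm p \<Omega> \<psi> ^ DIM('a) \<in> ?S"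
      using False by (intro CollectI exI[of _ \<psi>] exI[of _ "grad \<psi>"]) simp
    hence "?E / Lp_norm p \<Omega> \<psi> ^ DIM('a) \<in> ?S" unfolding E .
    hence "gamma1 F \<Omega> p \<le> ?E / Lp_norm p \<Omega> \<psi> ^ DIM('a)"
      unfolding gamma1_def by (intro cInf_lower bdd_belowI[of _ 0] lower)
    thus ?thesis using E0 Lp_norm_nonneg[of p \<Omega> \<psi>] by (cases "Lp_norm p \<Omega> \<psi> = 0") (auto simp: field_simps zero_power)
  qed
qed

context
  fixes \<Omega> :: "'a set" and \<phi> :: "'a \<Rightarrow> real" and p :: real
  assumes \<phi>: "test_fun \<Omega> \<phi>" and \<Omega>: "open \<Omega>" "bounded \<Omega>" and p: "1 < p"
begin

lemmas phi_meas [measurable] = phi_measurable[OF \<phi> \<Omega>]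
lemmas Omega_meas [measurable] = Omega_measurable[OF \<phi> \<Omega>]

lemma emeasure_Omega: "emeasure lborel \<Omega> < \<infinity>"
  using \<Omega> by (intro emeasure_bounded_finite)

lemma emeasure_mass: "emeasure lborel {x\<in>\<Omega>. t \<le> \<bar>\<phi> x\<bar>} = ennreal (mass \<Omega> \<phi> t)"
  unfolding mass_def using mass_set_fmeasurable[OF \<phi> \<Omega>] by (rule emeasure_eq_measure2[rotated]) 

text \<open>The infimum speaks about test functions here, and a truncation is not smooth. The smooth
  truncations \<open>soft k b (\<phi> x)\<close> are test functions; their energies converge to that
  of the truncation by dominated convergence, and their norms are bounded below by
  \<open>soft_ge\<close>.\<close>

lemma truncation_norm_le_energy:
  assumes b: "0 \<le> b" and g: "0 \<le> gamma1 F \<Omega> p"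
  shows "gamma1 F \<Omega> p * Lp_norm p \<Omega> (\<lambda>x. min \<bar>\<phi> x\<bar> b) ^ DIM('a) \<le> energy \<phi> b"
proof (cases "b = 0")
  case True
  have "min \<bar>\<phi> x\<bar> b = 0" for x using True by simp
  hence "Lp_norm p \<Omega> (\<lambda>x. min \<bar>\<phi> x\<bar> b) = 0" unfolding Lp_norm_def using p by simp
  thus ?thesis using energy_nonneg[OF \<phi> \<Omega>, of b] by (simp add: zero_power)
next
  case False
  hence b: "0 < b" using b by simp
  let ?N = "DIM('a)"
  let ?v = "\<lambda>x. min \<bar>\<phi> x\<bar> b"
  define c where "c k = (1 + real k) powr (- 1 / (2 * real k))" for k :: nat
  have c0: "0 \<le> c k" for k unfolding c_def by simp
  obtain M where M: "\<And>x. \<bar>\<phi> x\<bar> \<le> M" using test_fun_bounded[OF \<phi>] less_imp_le by metis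
  have key: "gamma1 F \<Omega> p * (c k * Lp_norm p \<Omega> ?v) ^ ?N \<le> (\<integral>x. soft' k b (\<phi> x) ^ ?N * F (grad \<phi> x) ^ ?N \<partial>lborel)" if k: "0 < k" for k
  proof -
    note st = soft_test_fun[OF \<phi> k b]
    have [measurable]: "soft k b \<in> borel_measurable borel" unfolding soft_def[abs_def] by measurable
    have "c k * Lp_norm p \<Omega> ?v = Lp_norm p \<Omega> (\<lambda>x. c k * ?v x)"
      by (rule Lp_norm_scale[symmetric]) (use p c0 in auto)
    also have "\<dots> \<le> Lp_norm p \<Omega> (\<lambda>x. soft k b (\<phi> x))"
    proof (rule Lp_norm_mono)
      show "\<bar>c k * ?v x\<bar> \<le> \<bar>soft k b (\<phi> x)\<bar>" for x using soft_ge[OF k b, of "\<phi> x"] c0[of k] b unfolding c_def by (simp add: abs_mult)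
      have "\<bar>soft k b t\<bar> \<le> \<bar>t\<bar>" for t
      proof -
        have "(1 + real k * (t / b) ^ (2 * k)) powr (- 1 / (2 * real k)) \<le> (1 + real k * (t / b) ^ (2 * k)) powr 0"
          using soft_exponent_le by (rule powr_mono[OF _ soft_arg_ge])
        also have "\<dots> = 1" using soft_arg_pos[of k t b] by simp
        finally show ?thesis unfolding soft_def by (simp add: abs_mult mult_left_le)
      qed
      hence "\<bar>soft k b (\<phi> x)\<bar> \<le> M" for x using M order_trans by blast
      thus "(\<integral>\<^sup>+x\<in>\<Omega>. ennreal (\<bar>soft k b (\<phi> x)\<bar> powr p) \<partial>lborel) < \<infinity>"
        by (intro nn_integral_bounded_finite emeasure_Omega) (use p in auto)
    qed (use p in simp)
    finally have "(c k * Lp_norm p \<Omega> ?v) ^ ?N \<le> Lp_norm p \<Omega> (\<lambda>x. soft k b (\<phi> x)) ^ ?N"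
      using mult_nonneg_nonneg[OF c0[of k] Lp_norm_nonneg[of p \<Omega> ?v]] by (intro power_mono)
    hence "gamma1 F \<Omega> p * (c k * Lp_norm p \<Omega> ?v) ^ ?N \<le> gamma1 F \<Omega> p * Lp_norm p \<Omega> (\<lambda>x. soft k b (\<phi> x)) ^ ?N"
      using g by (intro mult_left_mono)
    also have "\<dots> \<le> (\<integral>x. F (grad (\<lambda>x. soft k b (\<phi> x)) x) ^ ?N \<partial>lborel)"
      by (rule gamma1_le[OF st(1) \<Omega>]) (use p in simp)
    also have "\<dots> = (\<integral>x. soft' k b (\<phi> x) ^ ?N * F (grad \<phi> x) ^ ?N \<partial>lborel)"
      unfolding st(2) by (simp add: F_scale soft'_bounds power_mult_distrib)
    finally show ?thesis .
  qed
  have "(\<lambda>k. \<integral>x. soft' k b (\<phi> x) ^ ?N * F (grad \<phi> x) ^ ?N \<partial>lborel) \<longlonglongrightarrow> energy \<phi> b"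
    unfolding energy_def
  proof (rule integral_dominated_convergence[where w="\<lambda>x. F (grad \<phi> x) ^ ?N"])
    have [measurable]: "soft' k b \<in> borel_measurable borel" for k unfolding soft'_def[abs_def] by measurable
    show "(\<lambda>x. soft' k b (\<phi> x) ^ ?N * F (grad \<phi> x) ^ ?N) \<in> borel_measurable lborel" for k by measurable
    show "integrable lborel (\<lambda>x. F (grad \<phi> x) ^ ?N)" by (rule F_grad_integrable[OF \<phi>]) simp
    have "(\<lambda>k. soft' k b (\<phi> x) ^ ?N * F (grad \<phi> x) ^ ?N) \<longlonglongrightarrow> (if \<bar>\<phi> x\<bar> < b then 1 else 0) ^ ?N * F (grad \<phi> x) ^ ?N" for x
      by (intro tendsto_intros soft'_tendsto b)
    moreover have "(if \<bar>\<phi> x\<bar> < b then 1 else 0) ^ ?N = (indicator {x. \<bar>\<phi> x\<bar> < b} x :: real)" for x by (simp add: zero_power)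
    ultimately show "AE x in lborel. (\<lambda>k. soft' k b (\<phi> x) ^ ?N * F (grad \<phi> x) ^ ?N) \<longlonglongrightarrow> indicator {x. \<bar>\<phi> x\<bar> < b} x * F (grad \<phi> x) ^ ?N"
      by simp
    have "soft' k b (\<phi> x) ^ ?N * F (grad \<phi> x) ^ ?N \<le> 1 * F (grad \<phi> x) ^ ?N" for k x
      using soft'_bounds F_nonneg by (intro mult_right_mono power_le_one) auto
    thus "AE x in lborel. norm (soft' k b (\<phi> x) ^ ?N * F (grad \<phi> x) ^ ?N) \<le> F (grad \<phi> x) ^ ?N" for k
      using soft'_bounds F_nonneg by (simp add: abs_mult)
  qed measurable
  moreover have "(\<lambda>k. gamma1 F \<Omega> p * (c k * Lp_norm p \<Omega> ?v) ^ ?N) \<longlonglongrightarrow> gamma1 F \<Omega> p * (1 * Lp_norm p \<Omega> ?v) ^ ?N"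
  proof -
    have "c \<longlonglongrightarrow> 1" unfolding c_def by real_asymp
    thus ?thesis by (intro tendsto_intros)
  qed
  moreover have "\<forall>\<^sub>F k in sequentially. gamma1 F \<Omega> p * (c k * Lp_norm p \<Omega> ?v) ^ ?N \<le> (\<integral>x. soft' k b (\<phi> x) ^ ?N * F (grad \<phi> x) ^ ?N \<partial>lborel)"
    using eventually_gt_at_top[of 0] by eventually_elim (rule key)
  ultimately show ?thesis using tendsto_le[of sequentially] by fastforce
qed

lemma truncation_finite: "0 \<le> b \<Longrightarrow> (\<integral>\<^sup>+x\<in>\<Omega>. ennreal (\<bar>min \<bar>\<phi> x\<bar> b\<bar> powr p) \<partial>lborel) < \<infinity>"
  using p \<Omega> by (intro nn_integral_bounded_finite[where M=b] emeasure_Omega) auto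

lemma profile_test_fun:
  assumes N: "2 \<le> DIM('a)" and g: "0 \<le> gamma1 F \<Omega> p" and E: "(\<integral>x. F (grad \<phi> x) ^ DIM('a) \<partial>lborel) \<le> 1"
  shows "profile DIM('a) (lambdaN F ^ (DIM('a) - 1)) (gamma1 F \<Omega> p) p (tail_const p) (measure lborel \<Omega>)
    (mass \<Omega> \<phi>) (energy \<phi>) (\<lambda>b. Lp_norm p \<Omega> (\<lambda>x. min \<bar>\<phi> x\<bar> b)) (\<lambda>s b. Lp_norm p \<Omega> (\<lambda>x. max 0 (min \<bar>\<phi> x\<bar> b - s)))"
  unfolding profile_def
proof (intro conjI allI impI)
  fix s t :: real assume "0 \<le> s" "s \<le> t"
  show "mass \<Omega> \<phi> t \<le> mass \<Omega> \<phi> s" "energy \<phi> s \<le> energy \<phi> t"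
    using mass_antimono[OF \<phi> \<Omega> \<open>s \<le> t\<close>] energy_mono[OF \<phi> \<Omega> \<open>s \<le> t\<close>] by auto
next
  fix t :: real assume t: "0 \<le> t"
  show "0 \<le> mass \<Omega> \<phi> t" unfolding mass_def by simp
  show "mass \<Omega> \<phi> t \<le> measure lborel \<Omega>" by (rule mass_le[OF \<phi> \<Omega>])
  show "0 \<le> energy \<phi> t" by (rule energy_nonneg[OF \<phi> \<Omega>])
  show "energy \<phi> t \<le> 1" using energy_le[OF \<phi> \<Omega>, of t] E by simp
  show "0 \<le> Lp_norm p \<Omega> (\<lambda>x. min \<bar>\<phi> x\<bar> t)" by (rule Lp_norm_nonneg)
  show "gamma1 F \<Omega> p * Lp_norm p \<Omega> (\<lambda>x. min \<bar>\<phi> x\<bar> t) ^ DIM('a) \<le> energy \<phi> t"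
    by (rule truncation_norm_le_energy[OF t g])
next
  fix a b :: real assume "0 \<le> a" "a < b" "0 < mass \<Omega> \<phi> b"
  thus "lambdaN F ^ (DIM('a) - 1) * (b - a) ^ DIM('a)
    \<le> (energy \<phi> b - energy \<phi> a) * (ln (mass \<Omega> \<phi> a) - ln (mass \<Omega> \<phi> b)) ^ (DIM('a) - 1)"
    by (rule log_capacity[OF \<phi> \<Omega> N])
next
  fix s b :: real assume s: "0 \<le> s" "s \<le> b"
  show "Lp_norm p \<Omega> (\<lambda>x. min \<bar>\<phi> x\<bar> b) \<le> Lp_norm p \<Omega> (\<lambda>x. min \<bar>\<phi> x\<bar> s) + Lp_norm p \<Omega> (\<lambda>x. max 0 (min \<bar>\<phi> x\<bar> b - s))"
  proof (rule Lp_norm_triangle)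
    show "(\<integral>\<^sup>+x\<in>\<Omega>. ennreal (\<bar>min \<bar>\<phi> x\<bar> s\<bar> powr p) \<partial>lborel) < \<infinity>" by (rule truncation_finite[OF s(1)])
    show "(\<integral>\<^sup>+x\<in>\<Omega>. ennreal (\<bar>max 0 (min \<bar>\<phi> x\<bar> b - s)\<bar> powr p) \<partial>lborel) < \<infinity>"
      using p s by (intro nn_integral_bounded_finite[where M=b] emeasure_Omega) auto
  qed (use p s in auto)
  show "mass \<Omega> \<phi> s * s powr p \<le> Lp_norm p \<Omega> (\<lambda>x. min \<bar>\<phi> x\<bar> b) powr p"
  proof -
    \<comment> \<open>Chebyshev's inequality: on this set the truncation at \<open>b\<close> is
      still at least \<open>s\<close>, because s \<le> b.\<close>
    have "ennreal (s powr p) * emeasure lborel {x\<in>\<Omega>. s \<le> \<bar>\<phi> x\<bar>} = (\<integral>\<^sup>+x. ennreal (s powr p) * indicator {x\<in>\<Omega>. s \<le> \<bar>\<phi> x\<bar>} x \<partial>lborel)"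
      by (rule nn_integral_cmult_indicator[symmetric]) measurable
    also have "\<dots> \<le> (\<integral>\<^sup>+x\<in>\<Omega>. ennreal (\<bar>min \<bar>\<phi> x\<bar> b\<bar> powr p) \<partial>lborel)"
      using s p by (intro nn_integral_mono) (auto simp: indicator_def intro!: ennreal_leI powr_mono2)
    also have "\<dots> = ennreal (Lp_norm p \<Omega> (\<lambda>x. min \<bar>\<phi> x\<bar> b) powr p)"
      by (rule nn_integral_eq_Lp_norm[OF _ truncation_finite]) (use p s in auto)
    finally have "ennreal (s powr p * mass \<Omega> \<phi> s) \<le> ennreal (Lp_norm p \<Omega> (\<lambda>x. min \<bar>\<phi> x\<bar> b) powr p)"
      unfolding emeasure_mass by (simp add: ennreal_mult mass_def)
    thus ?thesis by (simp add: mult.commute)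
  qed
  show "0 \<le> Lp_norm p \<Omega> (\<lambda>x. max 0 (min \<bar>\<phi> x\<bar> b - s))" by (rule Lp_norm_nonneg)
next
  fix s b A H :: real
  assume s: "0 \<le> s" "s < b" and AH: "0 < A" "0 < H" and decay: "\<forall>c. s \<le> c \<longrightarrow> c \<le> b \<longrightarrow> mass \<Omega> \<phi> c \<le> A * exp (- ((c - s) / H))"
  show "Lp_norm p \<Omega> (\<lambda>x. max 0 (min \<bar>\<phi> x\<bar> b - s)) \<le> tail_const p * A powr (1 / p) * H"
  proof (rule Lp_norm_exponential_tail)
    fix z :: real assume z: "0 \<le> z"
    show "emeasure lborel {x \<in> \<Omega>. 0 < max 0 (min \<bar>\<phi> x\<bar> b - s) \<and> z \<le> max 0 (min \<bar>\<phi> x\<bar> b - s)} \<le> ennreal (A * exp (- (z / H)))"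
    proof (cases "s + z \<le> b")
      case True
      have "emeasure lborel {x \<in> \<Omega>. 0 < max 0 (min \<bar>\<phi> x\<bar> b - s) \<and> z \<le> max 0 (min \<bar>\<phi> x\<bar> b - s)} \<le> emeasure lborel {x\<in>\<Omega>. s + z \<le> \<bar>\<phi> x\<bar>}"
        by (intro emeasure_mono) (auto simp: max_def min_def split: if_splits)
      also have "\<dots> \<le> ennreal (A * exp (- (z / H)))"
        unfolding emeasure_mass using decay[rule_format, of "s + z"] z True by (intro ennreal_leI) simp
      finally show ?thesis .
    next
      case False
      hence empty: "{x \<in> \<Omega>. 0 < max 0 (min \<bar>\<phi> x\<bar> b - s) \<and> z \<le> max 0 (min \<bar>\<phi> x\<bar> b - s)} = {}"
        by (auto simp: max_def min_def split: if_splits)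
      show ?thesis unfolding empty by simp
    qed
  qed (use p AH in auto)
qed

end

end

section \<open>The singular Trudinger--Moser inequality\<close>

context anisotropic begin

text \<open>Comparison with the Wulff ball of radius R, where R^N is the measure of
  \<open>D\<close>. Outside it the weight is at most R^(-\<beta>); inside it dyadic shells give a
  geometric series, with ratio below 1 because \<beta> < N. Both parts are of order R^(N-\<beta>),
  and this is where the power 1 - \<beta>/N of the measure comes from, matching the same factor in
  the exponent.\<close>

lemma singular_weight_bound:
  fixes \<beta> :: real
  assumes \<beta>: "0 \<le> \<beta>" "\<beta> < DIM('a)"
  shows "\<exists>C\<ge>0. \<forall>D. D \<in> sets borel \<longrightarrow> emeasure lborel D < \<infinity> \<longrightarrow>
    (\<integral>\<^sup>+x\<in>D. ennreal (1 / Fo F x powr \<beta>) \<partial>lborel) \<le> ennreal (C * measure lborel D powr (1 - \<beta> / DIM('a)))"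
proof -
  let ?N = "DIM('a)"
  define q where "q = (1 / 2) powr (real ?N - \<beta>)"
  have q: "0 < q" "q < 1"
    unfolding q_def using \<beta> powr_less_mono2[of "real ?N - \<beta>" "1 / 2" 1] by auto
  define C where "C = kappa F * 2 powr \<beta> / (1 - q) + 1"
  have C: "0 \<le> C" unfolding C_def using kappa_pos q by simp
  have "(\<integral>\<^sup>+x\<in>D. ennreal (1 / Fo F x powr \<beta>) \<partial>lborel) \<le> ennreal (C * measure lborel D powr (1 - \<beta> / ?N))"
    if D [measurable]: "D \<in> sets borel" and fin: "emeasure lborel D < \<infinity>" for D
  proof (cases "measure lborel D = 0")
    case True
    hence "emeasure lborel D = 0" using fin by (simp add: emeasure_eq_ennreal_measure top.not_eq_extremum)
    hence "D \<in> null_sets lborel" by (intro null_setsI) auto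
    hence "AE x in lborel. x \<notin> D" by (rule AE_not_in)
    hence "AE x in lborel. ennreal (1 / Fo F x powr \<beta>) * indicator D x = 0" by eventually_elim simp
    from nn_integral_cong_AE[OF this] show ?thesis by simp
  next
    case False
    define \<mu> where "\<mu> = measure lborel D"
    have \<mu>: "0 < \<mu>" unfolding \<mu>_def using False by (simp add: zero_less_measure_iff)
    define R where "R = \<mu> powr (1 / ?N)"
    have R: "0 < R" unfolding R_def using \<mu> by simp
    define r where "r k = R * (1 / 2) ^ k" for k :: nat
    have r: "0 < r k" for k unfolding r_def using R by simp
    define c where "c k = 1 / r (Suc k) powr \<beta>" for k
    have W [measurable]: "Wulff s \<in> sets borel" for s using Wulff_open by simp
    have pt: "ennreal (1 / Fo F x powr \<beta>) * indicator D x \<le> (\<Sum>k. ennreal (c k) * indicator (Wulff (r k)) x) + ennreal (1 / R powr \<beta>) * indicator D x" for x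
    proof (cases "x \<in> D \<and> 0 < Fo F x")
      case True
      hence Fp: "0 < Fo F x" by simp
      show ?thesis
      proof (cases "Fo F x < R")
        case lt: True
        have "0 < Fo F x / R" using True R by simp
        then obtain j where "(1 / 2) ^ j < Fo F x / R" using real_arch_pow_inv[of "Fo F x / R" "1 / 2"] by auto
        hence "r j \<le> Fo F x" unfolding r_def using R by (simp add: field_simps)
        hence ex: "\<exists>j. r j \<le> Fo F x" by blast
        define j0 where "j0 = (LEAST j. r j \<le> Fo F x)"
        have j0: "r j0 \<le> Fo F x" unfolding j0_def by (rule LeastI_ex[OF ex])
        have "j0 \<noteq> 0" using j0 lt unfolding r_def by (cases j0) auto
        then obtain k where k: "j0 = Suc k" by (cases j0) auto
        have "\<not> r k \<le> Fo F x" using not_less_Least[of k "\<lambda>j. r j \<le> Fo F x"] unfolding j0_def[symmetric] k by simp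
        hence xW: "x \<in> Wulff (r k)" unfolding Wulff_def by simp
        have "r (Suc k) powr \<beta> \<le> Fo F x powr \<beta>" using j0 r[of "Suc k"] \<beta> unfolding k by (intro powr_mono2) auto
        hence "1 / Fo F x powr \<beta> \<le> c k" unfolding c_def using r[of "Suc k"] Fp by (intro divide_left_mono mult_pos_pos) auto
        hence "ennreal (1 / Fo F x powr \<beta>) * indicator D x \<le> ennreal (c k) * indicator (Wulff (r k)) x"
          using True xW by (simp add: ennreal_leI)
        also have "\<dots> \<le> (\<Sum>k. ennreal (c k) * indicator (Wulff (r k)) x)"
          by (rule ennreal_term_le_suminf)
        finally show ?thesis by (rule order_trans) simp
      next
        case False
        have "R powr \<beta> \<le> Fo F x powr \<beta>" using False R \<beta> by (intro powr_mono2) auto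
        hence "1 / Fo F x powr \<beta> \<le> 1 / R powr \<beta>" using R Fp by (intro divide_left_mono mult_pos_pos) auto
        hence "ennreal (1 / Fo F x powr \<beta>) * indicator D x \<le> ennreal (1 / R powr \<beta>) * indicator D x"
          by (intro mult_right_mono ennreal_leI) auto
        thus ?thesis by (rule order_trans) simp
      qed
    next
      case False
      \<comment> \<open>Either x is outside \<open>D\<close> or \<open>Fo F x\<close> = 0; in the
        latter case 0 powr \<beta> = 0 and division by 0 makes the weight 0.\<close>
      hence zero: "ennreal (1 / Fo F x powr \<beta>) * indicator D x = 0" using Fo_nonneg[of x] by (auto simp: indicator_def)
      show ?thesis unfolding zero by simp
    qed
    have "(\<integral>\<^sup>+x\<in>D. ennreal (1 / Fo F x powr \<beta>) \<partial>lborel)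
       \<le> (\<integral>\<^sup>+x. (\<Sum>k. ennreal (c k) * indicator (Wulff (r k)) x) + ennreal (1 / R powr \<beta>) * indicator D x \<partial>lborel)"
      by (rule nn_integral_mono) (rule pt)
    also have "\<dots> = (\<Sum>k. ennreal (c k) * emeasure lborel (Wulff (r k))) + ennreal (1 / R powr \<beta>) * emeasure lborel D"
      by (subst nn_integral_add, measurable, subst nn_integral_suminf, measurable) (simp add: nn_integral_cmult_indicator)
    also have "(\<Sum>k. ennreal (c k) * emeasure lborel (Wulff (r k))) = (\<Sum>k. ennreal (kappa F * 2 powr \<beta> * R powr (real ?N - \<beta>) * q ^ k))"
    proof (rule suminf_cong)
      fix k
      have eq: "c k * (r k ^ ?N * kappa F) = kappa F * 2 powr \<beta> * R powr (real ?N - \<beta>) * q ^ k"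
      proof -
        have 1: "r (Suc k) = r k / 2" unfolding r_def by simp
        have "c k = 2 powr \<beta> * r k powr (- \<beta>)" unfolding c_def 1 using r[of k] by (simp add: powr_divide powr_minus field_simps)
        hence "c k * (r k ^ ?N * kappa F) = kappa F * 2 powr \<beta> * (r k powr (- \<beta>) * r k powr real ?N)"
          using r[of k] by (simp add: powr_realpow)
        also have "r k powr (- \<beta>) * r k powr real ?N = r k powr (real ?N - \<beta>)" by (simp add: powr_add[symmetric])
        also have "\<dots> = R powr (real ?N - \<beta>) * ((1 / 2) ^ k) powr (real ?N - \<beta>)" unfolding r_def by (rule powr_mult)
        also have "((1 / 2) ^ k) powr (real ?N - \<beta>) = q ^ k"
          unfolding q_def by (subst (1 2) powr_realpow[symmetric]) (auto simp: powr_powr mult.commute)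
        finally show ?thesis by simp
      qed
      have "0 \<le> c k" unfolding c_def by simp
      thus "ennreal (c k) * emeasure lborel (Wulff (r k)) = ennreal (kappa F * 2 powr \<beta> * R powr (real ?N - \<beta>) * q ^ k)"
        unfolding emeasure_Wulff[OF r[of k]] eq[symmetric] using r[of k] kappa_pos by (intro ennreal_mult[symmetric]) auto
    qed
    also have "\<dots> = ennreal (kappa F * 2 powr \<beta> * R powr (real ?N - \<beta>) * (1 / (1 - q)))"
    proof -
      have "(\<lambda>k. kappa F * 2 powr \<beta> * R powr (real ?N - \<beta>) * q ^ k) sums (kappa F * 2 powr \<beta> * R powr (real ?N - \<beta>) * (1 / (1 - q)))"
        by (intro sums_mult geometric_sums) (use q in simp)
      thus ?thesis using q kappa_pos by (intro suminf_ennreal_eq) auto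
    qed
    also have "ennreal (1 / R powr \<beta>) * emeasure lborel D = ennreal (1 / R powr \<beta> * \<mu>)"
    proof -
      have "emeasure lborel D = ennreal \<mu>" unfolding \<mu>_def using fin by (simp add: emeasure_eq_ennreal_measure top.not_eq_extremum)
      thus ?thesis using \<mu> by (simp add: ennreal_mult[symmetric])
    qed
    also have "1 / R powr \<beta> * \<mu> = R powr (real ?N - \<beta>)"
    proof -
      have "\<mu> = R powr real ?N" unfolding R_def using \<mu> by (simp add: powr_powr)
      thus ?thesis using R by (simp add: powr_diff)
    qed
    also have "ennreal (kappa F * 2 powr \<beta> * R powr (real ?N - \<beta>) * (1 / (1 - q))) + ennreal (R powr (real ?N - \<beta>)) = ennreal (C * R powr (real ?N - \<beta>))"
      unfolding C_def using q kappa_pos by (subst ennreal_plus[symmetric]) (auto simp: algebra_simps)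
    also have "R powr (real ?N - \<beta>) = \<mu> powr (1 - \<beta> / ?N)" unfolding R_def by (simp add: powr_powr diff_divide_distrib)
    finally show ?thesis unfolding \<mu>_def .
  qed
  thus ?thesis using C by blast
qed

text \<open>The norm enters as a number \<open>S\<close>: in the passage to the limit it is replaced
  by a limit of norms, which may differ from the norm of the limit.\<close>

definition TM_integrand :: "real \<Rightarrow> real \<Rightarrow> real \<Rightarrow> real \<Rightarrow> 'a \<Rightarrow> real" where
  "TM_integrand \<gamma> \<beta> S t x = exp (lambdaN F * (1 - \<beta> / real DIM('a)) * \<bar>t\<bar> powr (real DIM('a) / (real DIM('a) - 1))
      * (1 + \<gamma> * S ^ DIM('a)) powr (1 / (real DIM('a) - 1))) / Fo F x powr \<beta>"

text \<open>Where the exponent without its factor \<sigma> lies between k and k + 1, |\<phi>| is at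
  least the level \<open>a k\<close>, and \<open>singular_weight_bound\<close> turns the weight into
  the power \<sigma> of the mass. The sum over k is the one of
  \<open>profile_exp_sum_bounded\<close>, taken with a height \<open>M\<close> that |\<phi>| does
  not reach, so that the truncated norm is the full one.\<close>

lemma TM_test_fun_bound:
  assumes N: "2 \<le> DIM('a)" and \<Omega>: "open \<Omega>" "bounded \<Omega>" "\<Omega> \<noteq> {}"
    and \<gamma>: "0 \<le> \<gamma>" "\<gamma> < gamma1 F \<Omega> p" and \<beta>: "0 \<le> \<beta>" "\<beta> < real DIM('a)" and p: "1 < p"
  shows "\<exists>Q. \<forall>\<phi>. test_fun \<Omega> \<phi> \<longrightarrow> (\<integral>x. F (grad \<phi> x) ^ DIM('a) \<partial>lborel) \<le> 1 \<longrightarrow>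
    (\<integral>\<^sup>+x\<in>\<Omega>. ennreal (TM_integrand \<gamma> \<beta> (Lp_norm p \<Omega> \<phi>) (\<phi> x) x) \<partial>lborel) \<le> ennreal Q"
proof -
  let ?N = "DIM('a)"
  define L where "L = lambdaN F ^ (?N - 1)"
  define \<sigma> where "\<sigma> = 1 - \<beta> / real ?N"
  define V where "V = measure lborel \<Omega>"
  have lam: "0 < lambdaN F" by (rule lambdaN_power(1)[OF N])
  have L: "0 < L" unfolding L_def using lam by simp
  have \<sigma>: "0 < \<sigma>" unfolding \<sigma>_def using \<beta> by simp
  have V: "0 < V" unfolding V_def using \<Omega> by (intro measure_lborel_open_pos)
  obtain C where C: "0 \<le> C" and weight: "\<And>D. D \<in> sets borel \<Longrightarrow> emeasure lborel D < \<infinity> \<Longrightarrow>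
    (\<integral>\<^sup>+x\<in>D. ennreal (1 / Fo F x powr \<beta>) \<partial>lborel) \<le> ennreal (C * measure lborel D powr \<sigma>)"
    using singular_weight_bound[OF \<beta>] unfolding \<sigma>_def by blast
  obtain Q where Q: "\<forall>m e nm wn Bm n. profile ?N L (gamma1 F \<Omega> p) p (tail_const p) V m e nm wn \<longrightarrow> 0 < Bm \<longrightarrow> (\<forall>t\<ge>Bm. m t = 0) \<longrightarrow>
    (\<Sum>k=1..n. (m (level ?N (L * (1 + \<gamma> * nm Bm ^ ?N)) (real k)) * exp (real k)) powr \<sigma>) \<le> Q"
    using profile_exp_sum_bounded[OF N L \<gamma> p tail_const_nonneg V \<sigma>] ..
  have "(\<integral>\<^sup>+x\<in>\<Omega>. ennreal (TM_integrand \<gamma> \<beta> (Lp_norm p \<Omega> \<phi>) (\<phi> x) x) \<partial>lborel) \<le> ennreal (exp \<sigma> * C * (V powr \<sigma> + Q))"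
    if \<phi>: "test_fun \<Omega> \<phi>" and E: "(\<integral>x. F (grad \<phi> x) ^ ?N \<partial>lborel) \<le> 1" for \<phi>
  proof -
    note [measurable] = phi_measurable[OF \<phi> \<Omega>(1,2)] Omega_measurable[OF \<phi> \<Omega>(1,2)]
    obtain M where M: "0 < M" "\<And>x. \<bar>\<phi> x\<bar> < M" using test_fun_bounded[OF \<phi>] by blast
    define S where "S = Lp_norm p \<Omega> \<phi>"
    define \<Lambda> where "\<Lambda> = L * (1 + \<gamma> * S ^ ?N)"
    have S0: "0 \<le> \<gamma> * S ^ ?N" unfolding S_def by (intro mult_nonneg_nonneg zero_le_power Lp_norm_nonneg \<gamma>(1))
    have \<Lambda>: "0 < \<Lambda>" unfolding \<Lambda>_def using L S0 by (intro mult_pos_pos) auto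
    have prof: "profile ?N L (gamma1 F \<Omega> p) p (tail_const p) V
      (mass \<Omega> \<phi>) (energy \<phi>) (\<lambda>b. Lp_norm p \<Omega> (\<lambda>x. min \<bar>\<phi> x\<bar> b)) (\<lambda>s b. Lp_norm p \<Omega> (\<lambda>x. max 0 (min \<bar>\<phi> x\<bar> b - s)))"
      unfolding L_def V_def by (rule profile_test_fun[OF \<phi> \<Omega>(1,2) p N _ E]) (use \<gamma> in simp)
    have m0: "\<forall>t\<ge>M. mass \<Omega> \<phi> t = 0"
    proof (intro allI impI)
      fix t assume "M \<le> t"
      hence empty: "{x\<in>\<Omega>. t \<le> \<bar>\<phi> x\<bar>} = {}" using M(2) by (auto simp: not_le intro: less_le_trans)
      show "mass \<Omega> \<phi> t = 0" unfolding mass_def empty by simp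
    qed
    have nm: "Lp_norm p \<Omega> (\<lambda>x. min \<bar>\<phi> x\<bar> M) = S"
    proof -
      have "min \<bar>\<phi> x\<bar> M = \<bar>\<phi> x\<bar>" for x using M(2)[of x] by simp
      thus ?thesis unfolding S_def Lp_norm_def by simp
    qed
    define a where "a k = level ?N \<Lambda> (real k)" for k
    have sumQ: "(\<Sum>k=1..n. (mass \<Omega> \<phi> (a k) * exp (real k)) powr \<sigma>) \<le> Q" for n
      using Q[rule_format, OF prof M(1) m0[rule_format], of n] unfolding nm \<Lambda>_def[symmetric] a_def by blast
    define rr where "rr t = lambdaN F * \<bar>t\<bar> powr (real ?N / (real ?N - 1)) * (1 + \<gamma> * S ^ ?N) powr (1 / (real ?N - 1))" for t
    have rr0: "0 \<le> rr t" for t unfolding rr_def using lam by simp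
    \<comment> \<open>The power N - 1 clears both fractional exponents and links the exponent of the
      integrand with \<open>level\<close>.\<close>
    have rr_pow: "rr t ^ (?N - 1) = \<Lambda> * \<bar>t\<bar> ^ ?N" for t
    proof -
      have e: "real (?N - 1) = real ?N - 1" using N by (simp add: of_nat_diff)
      have pw: "(y powr z) ^ (?N - 1) = y powr (z * (real ?N - 1))" if "0 \<le> y" for y z :: real
      proof (cases "y = 0")
        case True
        thus ?thesis using N by (simp add: zero_power)
      next
        case False
        hence "0 < y powr z" using that by simp
        hence "(y powr z) ^ (?N - 1) = (y powr z) powr real (?N - 1)" by (rule powr_realpow[symmetric])
        thus ?thesis unfolding e by (simp add: powr_powr)
      qed
      have nz: "real ?N - 1 \<noteq> 0" using N by simp
      have "(\<bar>t\<bar> powr (real ?N / (real ?N - 1))) ^ (?N - 1) = \<bar>t\<bar> powr real ?N"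
        by (subst pw) (use nz in auto)
      also have "\<dots> = \<bar>t\<bar> ^ ?N" using powr_realpow'[of "\<bar>t\<bar>" ?N] by simp
      finally have p1: "(\<bar>t\<bar> powr (real ?N / (real ?N - 1))) ^ (?N - 1) = \<bar>t\<bar> ^ ?N" .
      have "((1 + \<gamma> * S ^ ?N) powr (1 / (real ?N - 1))) ^ (?N - 1) = (1 + \<gamma> * S ^ ?N) powr 1"
        by (subst pw) (use nz S0 in auto)
      also have "\<dots> = 1 + \<gamma> * S ^ ?N" using S0 by simp
      finally have p2: "((1 + \<gamma> * S ^ ?N) powr (1 / (real ?N - 1))) ^ (?N - 1) = 1 + \<gamma> * S ^ ?N" .
      show ?thesis unfolding rr_def power_mult_distrib \<Lambda>_def L_def p1 p2 by simp
    qed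
    have lev: "a k \<le> \<bar>t\<bar>" if "real k \<le> rr t" for k t
    proof -
      have "real k ^ (?N - 1) \<le> \<Lambda> * \<bar>t\<bar> ^ ?N" unfolding rr_pow[symmetric] using that by (intro power_mono) auto
      hence "real k ^ (?N - 1) / \<Lambda> \<le> \<bar>t\<bar> ^ ?N" using \<Lambda> by (simp add: field_simps)
      hence "a k \<le> root ?N (\<bar>t\<bar> ^ ?N)" unfolding a_def level_def by simp
      thus ?thesis by (simp add: real_root_power_cancel)
    qed
    define A where "A k = {x\<in>\<Omega>. a k \<le> \<bar>\<phi> x\<bar>}" for k
    have A [measurable]: "A k \<in> sets borel" for k unfolding A_def by measurable
    have TM: "TM_integrand \<gamma> \<beta> S t x = exp (\<sigma> * rr t) * (1 / Fo F x powr \<beta>)" for t x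
      unfolding TM_integrand_def rr_def \<sigma>_def by (simp add: mult_ac)
    have pt: "ennreal (TM_integrand \<gamma> \<beta> S (\<phi> x) x) * indicator \<Omega> x \<le> (\<Sum>k. ennreal (exp (\<sigma> * (real k + 1))) * (ennreal (1 / Fo F x powr \<beta>) * indicator (A k) x))" for x
    proof (cases "x \<in> \<Omega>")
      case True
      define k where "k = nat \<lfloor>rr (\<phi> x)\<rfloor>"
      have k: "real k \<le> rr (\<phi> x)" "rr (\<phi> x) \<le> real k + 1" unfolding k_def using rr0[of "\<phi> x"] by (auto simp: le_floor_iff)
      have xA: "x \<in> A k" unfolding A_def using True lev[OF k(1)] by simp
      have "exp (\<sigma> * rr (\<phi> x)) \<le> exp (\<sigma> * (real k + 1))" using k \<sigma> by simp
      hence "exp (\<sigma> * rr (\<phi> x)) * (1 / Fo F x powr \<beta>) \<le> exp (\<sigma> * (real k + 1)) * (1 / Fo F x powr \<beta>)" by (intro mult_right_mono) auto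
      hence "ennreal (TM_integrand \<gamma> \<beta> S (\<phi> x) x) * indicator \<Omega> x \<le> ennreal (exp (\<sigma> * (real k + 1)) * (1 / Fo F x powr \<beta>))"
        unfolding TM using True by (simp add: ennreal_leI)
      also have "\<dots> = ennreal (exp (\<sigma> * (real k + 1))) * (ennreal (1 / Fo F x powr \<beta>) * indicator (A k) x)"
        using xA by (simp add: ennreal_mult[symmetric])
      also have "\<dots> \<le> (\<Sum>k. ennreal (exp (\<sigma> * (real k + 1))) * (ennreal (1 / Fo F x powr \<beta>) * indicator (A k) x))"
          by (rule ennreal_term_le_suminf)
      finally show ?thesis .
    qed simp
    have "(\<integral>\<^sup>+x\<in>\<Omega>. ennreal (TM_integrand \<gamma> \<beta> S (\<phi> x) x) \<partial>lborel)
       \<le> (\<integral>\<^sup>+x. (\<Sum>k. ennreal (exp (\<sigma> * (real k + 1))) * (ennreal (1 / Fo F x powr \<beta>) * indicator (A k) x)) \<partial>lborel)"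
      by (rule nn_integral_mono) (rule pt)
    also have "\<dots> = (\<Sum>k. ennreal (exp (\<sigma> * (real k + 1))) * (\<integral>\<^sup>+x\<in>A k. ennreal (1 / Fo F x powr \<beta>) \<partial>lborel))"
      by (subst nn_integral_suminf, measurable) (subst nn_integral_cmult, measurable)
    also have "\<dots> \<le> (\<Sum>k. ennreal (exp (\<sigma> * (real k + 1)) * (C * mass \<Omega> \<phi> (a k) powr \<sigma>)))"
    proof (intro suminf_le summableI)
      fix k
      have "emeasure lborel (A k) < \<infinity>" unfolding A_def using mass_set_fmeasurable[OF \<phi> \<Omega>(1,2)] by (auto simp: fmeasurable_def)
      hence "(\<integral>\<^sup>+x\<in>A k. ennreal (1 / Fo F x powr \<beta>) \<partial>lborel) \<le> ennreal (C * mass \<Omega> \<phi> (a k) powr \<sigma>)"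
        using weight[OF A] unfolding mass_def A_def by simp
      hence "ennreal (exp (\<sigma> * (real k + 1))) * (\<integral>\<^sup>+x\<in>A k. ennreal (1 / Fo F x powr \<beta>) \<partial>lborel) \<le> ennreal (exp (\<sigma> * (real k + 1))) * ennreal (C * mass \<Omega> \<phi> (a k) powr \<sigma>)"
        by (intro mult_left_mono) auto
      thus "ennreal (exp (\<sigma> * (real k + 1))) * (\<integral>\<^sup>+x\<in>A k. ennreal (1 / Fo F x powr \<beta>) \<partial>lborel) \<le> ennreal (exp (\<sigma> * (real k + 1)) * (C * mass \<Omega> \<phi> (a k) powr \<sigma>))"
        using C by (simp add: ennreal_mult)
    qed
    also have "\<dots> \<le> ennreal (exp \<sigma> * C * (V powr \<sigma> + Q))"
    proof (rule suminf_le_const[OF summableI])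
      fix n
      define f where "f k = (mass \<Omega> \<phi> (a k) * exp (real k)) powr \<sigma>" for k
      have feq: "exp (\<sigma> * (real k + 1)) * (C * mass \<Omega> \<phi> (a k) powr \<sigma>) = exp \<sigma> * C * f k" for k
      proof -
        have "f k = mass \<Omega> \<phi> (a k) powr \<sigma> * exp (real k) powr \<sigma>" unfolding f_def by (rule powr_mult)
        also have "exp (real k) powr \<sigma> = exp (\<sigma> * real k)" by (simp add: powr_def)
        finally show ?thesis by (simp add: distrib_left exp_add)
      qed
      have f0: "0 \<le> f k" for k unfolding f_def by simp
      \<comment> \<open>The profile bound starts at k = 1; for the first layer the measure of
        \<Omega> is enough.\<close>
      have "f 0 \<le> V powr \<sigma>"
        unfolding f_def V_def using \<sigma> mass_le[OF \<phi> \<Omega>(1,2), of "a 0"] by (simp add: powr_mono2 mass_def)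
      have "(\<Sum>k<n. f k) \<le> (\<Sum>k\<le>n. f k)" by (rule sum_mono2) (use f0 in auto)
      also have "\<dots> = f 0 + (\<Sum>k=1..n. f k)" by (simp add: sum.atMost_shift sum.atLeast1_atMost_eq[symmetric] atMost_atLeast0 sum.atLeast_Suc_atMost)
      also have "\<dots> \<le> V powr \<sigma> + Q" using \<open>f 0 \<le> V powr \<sigma>\<close> sumQ[of n] unfolding f_def by (rule add_mono)
      finally have "exp \<sigma> * C * (\<Sum>k<n. f k) \<le> exp \<sigma> * C * (V powr \<sigma> + Q)" using C by (intro mult_left_mono) auto
      moreover have "(\<Sum>k<n. ennreal (exp (\<sigma> * (real k + 1)) * (C * mass \<Omega> \<phi> (a k) powr \<sigma>))) = ennreal (exp \<sigma> * C * (\<Sum>k<n. f k))"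
        unfolding feq using C f0 by (subst sum_ennreal) (auto simp: sum_distrib_left)
      ultimately show "(\<Sum>k<n. ennreal (exp (\<sigma> * (real k + 1)) * (C * mass \<Omega> \<phi> (a k) powr \<sigma>))) \<le> ennreal (exp \<sigma> * C * (V powr \<sigma> + Q))"
        by (simp add: ennreal_leI)
    qed
    finally show ?thesis unfolding S_def .
  qed
  thus ?thesis by blast
qed

end

section \<open>From test functions to Sobolev functions\<close>

lemma AE_subseq_of_Lq_tendsto:
  fixes f :: "nat \<Rightarrow> 'a::euclidean_space \<Rightarrow> real"
  assumes q: "0 < q" and meas: "\<And>k. f k \<in> borel_measurable lebesgue" "u \<in> borel_measurable lebesgue" "\<Omega> \<in> sets lebesgue"
    and lim: "(\<lambda>k. \<integral>\<^sup>+x\<in>\<Omega>. ennreal (\<bar>f k x - u x\<bar> powr q) \<partial>lebesgue) \<longlonglongrightarrow> 0"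
  shows "\<exists>r::nat\<Rightarrow>nat. strict_mono r \<and> (AE x in lebesgue. x \<in> \<Omega> \<longrightarrow> (\<lambda>k. f (r k) x) \<longlonglongrightarrow> u x)"
proof -
  note [measurable] = meas
  define d where "d k x = indicator \<Omega> x * \<bar>f k x - u x\<bar> powr q" for k x
  have dm [measurable]: "d k \<in> borel_measurable lebesgue" for k unfolding d_def[abs_def] by measurable
  have d0: "0 \<le> d k x" for k x unfolding d_def by simp
  have dn: "(\<integral>\<^sup>+x. ennreal (d k x) \<partial>lebesgue) = (\<integral>\<^sup>+x\<in>\<Omega>. ennreal (\<bar>f k x - u x\<bar> powr q) \<partial>lebesgue)" for k
    unfolding d_def by (intro nn_integral_cong) (simp add: indicator_def)
  have lim': "(\<lambda>k. \<integral>\<^sup>+x. ennreal (d k x) \<partial>lebesgue) \<longlonglongrightarrow> 0" unfolding dn by (rule lim)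
  have "\<forall>\<^sub>F k in sequentially. (\<integral>\<^sup>+x. ennreal (d k x) \<partial>lebesgue) < 1" using lim' by (rule order_tendstoD) simp
  \<comment> \<open>The first integrals may be infinite; shifting by \<open>K\<close> makes all
    differences integrable, so that the subsequence theorem for L^1 applies to their q-th
    powers.\<close>
  then obtain K where K: "\<And>k. K \<le> k \<Longrightarrow> (\<integral>\<^sup>+x. ennreal (d k x) \<partial>lebesgue) < 1" by (auto simp: eventually_sequentially)
  have int: "integrable lebesgue (d (k + K))" for k
    using K[of "k + K"] d0 by (intro integrableI_nonneg) (auto intro: less_trans)
  have "(\<lambda>k. \<integral>x. norm (d (k + K) x) \<partial>lebesgue) \<longlonglongrightarrow> 0"
  proof -
    have "(\<integral>x. norm (d (k + K) x) \<partial>lebesgue) = enn2real (\<integral>\<^sup>+x. ennreal (d (k + K) x) \<partial>lebesgue)" for k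
      using d0 by (subst integral_eq_nn_integral) auto
    moreover have "(\<lambda>k. enn2real (\<integral>\<^sup>+x. ennreal (d (k + K) x) \<partial>lebesgue)) \<longlonglongrightarrow> 0"
    proof (rule tendsto_enn2real)
      show "(\<lambda>k. \<integral>\<^sup>+x. ennreal (d (k + K) x) \<partial>lebesgue) \<longlonglongrightarrow> ennreal 0"
        unfolding ennreal_0 by (rule LIMSEQ_ignore_initial_segment[OF lim'])
    qed simp
    ultimately show ?thesis by simp
  qed
  from tendsto_L1_AE_subseq[OF int this] obtain r where r: "strict_mono r" "AE x in lebesgue. (\<lambda>k. d (r k + K) x) \<longlonglongrightarrow> 0" by blast
  have "AE x in lebesgue. x \<in> \<Omega> \<longrightarrow> (\<lambda>k. f (r k + K) x) \<longlonglongrightarrow> u x"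
    using r(2)
  proof eventually_elim
    case (elim x)
    show ?case
    proof
      assume x: "x \<in> \<Omega>"
      have "(\<lambda>k. \<bar>f (r k + K) x - u x\<bar> powr q) \<longlonglongrightarrow> 0" using elim x unfolding d_def by simp
      hence "(\<lambda>k. (\<bar>f (r k + K) x - u x\<bar> powr q) powr (1 / q)) \<longlonglongrightarrow> 0 powr (1 / q)"
        by (rule tendsto_powr') (use q in auto)
      hence "(\<lambda>k. \<bar>f (r k + K) x - u x\<bar>) \<longlonglongrightarrow> 0" using q by (simp add: powr_powr)
      thus "(\<lambda>k. f (r k + K) x) \<longlonglongrightarrow> u x" using LIM_zero_cancel tendsto_rabs_zero_iff by blast
    qed
  qed
  moreover have "strict_mono (\<lambda>k. r k + K)" using r(1) by (simp add: strict_mono_def)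
  ultimately show ?thesis by (intro exI[of _ "\<lambda>k. r k + K"]) auto
qed

lemma test_fun_scale:
  assumes "test_fun \<Omega> \<phi>"
  shows "test_fun \<Omega> (\<lambda>x. c * \<phi> x)" "grad (\<lambda>x. c * \<phi> x) x = c *\<^sub>R grad \<phi> x"
proof -
  have "smooth_alg \<phi>" using assms smooth_alg.base unfolding test_fun_def by blast
  hence "smooth_on UNIV (\<lambda>x. c * \<phi> x)" by (intro smooth_alg_smooth smooth_alg.mult smooth_alg.const)
  thus "test_fun \<Omega> (\<lambda>x. c * \<phi> x)" by (rule test_fun_support_subset[OF assms]) auto
  have "((\<lambda>x. c * \<phi> x) has_derivative (\<lambda>h. c * (grad \<phi> x \<bullet> h))) (at x)"
    by (intro has_derivative_mult_right test_fun_has_derivative[OF assms])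
  thus "grad (\<lambda>x. c * \<phi> x) x = c *\<^sub>R grad \<phi> x" by (rule grad_unique) simp
qed

context anisotropic begin

text \<open>Subadditivity of \<open>F\<close> and \<open>power_add_split\<close> with small
  \<theta>: the energy of the limit is multiplied by at most 1 + \<eta>/2, and the error is a
  constant times the N-th power of the distance of the gradients, which tends to 0.\<close>

lemma energy_limsup:
  fixes \<phi> :: "nat \<Rightarrow> 'a \<Rightarrow> real"
  assumes \<phi>: "\<And>k. test_fun \<Omega> (\<phi> k)" and \<Omega>: "open \<Omega>" and Du: "Du \<in> borel_measurable lebesgue"
    and lim: "(\<lambda>k. \<integral>\<^sup>+x\<in>\<Omega>. ennreal (norm (grad (\<phi> k) x - Du x) powr real DIM('a)) \<partial>lebesgue) \<longlonglongrightarrow> 0"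
    and E: "(\<integral>\<^sup>+x\<in>\<Omega>. ennreal (F (Du x) ^ DIM('a)) \<partial>lebesgue) \<le> 1" and \<eta>: "0 < \<eta>"
  shows "\<forall>\<^sub>F k in sequentially. (\<integral>x. F (grad (\<phi> k) x) ^ DIM('a) \<partial>lborel) \<le> 1 + \<eta>"
proof -
  let ?N = "DIM('a)"
  obtain \<theta> where \<theta>: "0 < \<theta>" "\<theta> < 1" "1 / (1 - \<theta>) ^ (?N - 1) \<le> 1 + \<eta> / 2"
    using ex_split_parameter[of 1 "1 + \<eta> / 2" ?N] \<eta> by auto
  obtain C where C: "0 < C" "\<And>x. F x \<le> C * norm x" using F_bounds by blast
  define B where "B = C ^ ?N / \<theta> ^ (?N - 1)"
  have B: "0 < B" unfolding B_def using C \<theta> by simp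
  define \<epsilon> where "\<epsilon> k = (\<integral>\<^sup>+x\<in>\<Omega>. ennreal (norm (grad (\<phi> k) x - Du x) powr real ?N) \<partial>lebesgue)" for k
  have [measurable]: "F \<in> borel_measurable borel" "\<Omega> \<in> sets lebesgue" using \<Omega> by auto
  have gm [measurable]: "grad (\<phi> k) \<in> borel_measurable lebesgue" for k
    using test_fun_measurable(2)[OF \<phi>] by (intro measurable_completion) simp
  note [measurable] = Du
  have key: "ennreal (\<integral>x. F (grad (\<phi> k) x) ^ ?N \<partial>lborel) \<le> ennreal (1 + \<eta> / 2) + ennreal B * \<epsilon> k" for k
  proof -
    have "ennreal (\<integral>x. F (grad (\<phi> k) x) ^ ?N \<partial>lborel) = (\<integral>\<^sup>+x. ennreal (F (grad (\<phi> k) x) ^ ?N) \<partial>lborel)"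
      by (rule nn_integral_eq_integral[symmetric]) (use F_grad_integrable[OF \<phi>] F_nonneg in auto)
    also have "\<dots> = (\<integral>\<^sup>+x. ennreal (F (grad (\<phi> k) x) ^ ?N) \<partial>lebesgue)" by (rule nn_integral_completion[symmetric])
    also have "\<dots> \<le> (\<integral>\<^sup>+x. ennreal (1 / (1 - \<theta>) ^ (?N - 1)) * (ennreal (F (Du x) ^ ?N) * indicator \<Omega> x)
        + ennreal B * (ennreal (norm (grad (\<phi> k) x - Du x) powr real ?N) * indicator \<Omega> x) \<partial>lebesgue)"
    proof (rule nn_integral_mono)
      fix x
      show "ennreal (F (grad (\<phi> k) x) ^ ?N) \<le> ennreal (1 / (1 - \<theta>) ^ (?N - 1)) * (ennreal (F (Du x) ^ ?N) * indicator \<Omega> x)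
        + ennreal B * (ennreal (norm (grad (\<phi> k) x - Du x) powr real ?N) * indicator \<Omega> x)"
      proof (cases "x \<in> \<Omega>")
        case True
        let ?d = "norm (grad (\<phi> k) x - Du x)"
        have dN: "?d powr real ?N = ?d ^ ?N" by (simp add: powr_realpow')
        have "F (grad (\<phi> k) x) \<le> F (Du x) + F (grad (\<phi> k) x - Du x)" using F_triangle[of "Du x" "grad (\<phi> k) x - Du x"] by simp
        also have "\<dots> \<le> F (Du x) + C * ?d" using C(2) by simp
        finally have "F (grad (\<phi> k) x) ^ ?N \<le> (F (Du x) + C * ?d) ^ ?N" using F_nonneg by (intro power_mono)
        also have "\<dots> \<le> F (Du x) ^ ?N / (1 - \<theta>) ^ (?N - 1) + (C * ?d) ^ ?N / \<theta> ^ (?N - 1)"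
          by (rule power_add_split) (use F_nonneg C \<theta> in auto)
        also have "\<dots> = 1 / (1 - \<theta>) ^ (?N - 1) * F (Du x) ^ ?N + B * ?d ^ ?N" unfolding B_def by (simp add: power_mult_distrib)
        finally have "ennreal (F (grad (\<phi> k) x) ^ ?N) \<le> ennreal (1 / (1 - \<theta>) ^ (?N - 1) * F (Du x) ^ ?N + B * ?d ^ ?N)" by (rule ennreal_leI)
        also have "\<dots> = ennreal (1 / (1 - \<theta>) ^ (?N - 1)) * ennreal (F (Du x) ^ ?N) + ennreal B * ennreal (?d ^ ?N)"
          using \<theta> B F_nonneg by (subst ennreal_plus) (auto simp: ennreal_mult[symmetric])
        finally show ?thesis unfolding dN using True by simp
      next
        case False
        thus ?thesis using test_fun_zero_outside(2)[OF \<phi> False] by (simp add: zero_power)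
      qed
    qed
    also have "\<dots> = ennreal (1 / (1 - \<theta>) ^ (?N - 1)) * (\<integral>\<^sup>+x\<in>\<Omega>. ennreal (F (Du x) ^ ?N) \<partial>lebesgue) + ennreal B * \<epsilon> k"
      unfolding \<epsilon>_def by (subst nn_integral_add, measurable, subst nn_integral_cmult, measurable, subst nn_integral_cmult, measurable) 
    also have "\<dots> \<le> ennreal (1 + \<eta> / 2) * 1 + ennreal B * \<epsilon> k"
      using \<theta>(3) E by (intro add_right_mono mult_mono ennreal_leI) auto
    finally show ?thesis by simp
  qed
  have "(\<lambda>k. ennreal B * \<epsilon> k) \<longlonglongrightarrow> ennreal B * 0"
    by (rule ennreal_tendsto_cmult[OF _ lim[folded \<epsilon>_def]]) simp
  hence "(\<lambda>k. ennreal B * \<epsilon> k) \<longlonglongrightarrow> 0" by simp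
  hence "\<forall>\<^sub>F k in sequentially. ennreal B * \<epsilon> k < ennreal (\<eta> / 2)" by (rule order_tendstoD) (use \<eta> in simp)
  thus ?thesis
  proof eventually_elim
    case (elim k)
    have "ennreal (\<integral>x. F (grad (\<phi> k) x) ^ ?N \<partial>lborel) \<le> ennreal (1 + \<eta> / 2) + ennreal (\<eta> / 2)"
      using key[of k] elim by (meson add_left_mono less_imp_le order_trans)
    also have "\<dots> = ennreal (1 + \<eta>)" using \<eta> by (subst ennreal_plus[symmetric]) auto
    finally show ?case using \<eta> by (subst (asm) ennreal_le_iff) auto
  qed
qed

text \<open>The approximants may violate the constraint slightly. Dividing by the N-th root of the
  maximum of 1 and their energy restores it; by \<open>energy_limsup\<close> this divisor tends to
  1, so the pointwise limit is unchanged. The maximum with 1 is taken because the energies are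
  controlled from above only.\<close>

lemma W0_approximation:
  fixes u :: "'a \<Rightarrow> real"
  assumes W: "W0 (real DIM('a)) \<Omega> u Du" and \<Omega>: "open \<Omega>"
    and E: "(\<integral>\<^sup>+x\<in>\<Omega>. ennreal (F (Du x) ^ DIM('a)) \<partial>lebesgue) \<le> 1"
  shows "\<exists>\<psi>. (\<forall>k::nat. test_fun \<Omega> (\<psi> k) \<and> (\<integral>x. F (grad (\<psi> k) x) ^ DIM('a) \<partial>lborel) \<le> 1)
    \<and> (AE x in lebesgue. x \<in> \<Omega> \<longrightarrow> (\<lambda>k. \<psi> k x) \<longlonglongrightarrow> u x)"
proof -
  let ?N = "DIM('a)"
  obtain \<phi> where u: "u \<in> borel_measurable lebesgue" and Du: "Du \<in> borel_measurable lebesgue"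
    and \<phi>: "\<And>k. test_fun \<Omega> (\<phi> k)"
    and lim: "(\<lambda>k. \<integral>\<^sup>+x\<in>\<Omega>. ennreal (\<bar>\<phi> k x - u x\<bar> powr real ?N) \<partial>lebesgue) \<longlonglongrightarrow> 0"
      "(\<lambda>k. \<integral>\<^sup>+x\<in>\<Omega>. ennreal (norm (grad (\<phi> k) x - Du x) powr real ?N) \<partial>lebesgue) \<longlonglongrightarrow> 0"
    using W unfolding W0_def by blast
  have \<phi>m: "\<phi> k \<in> borel_measurable lebesgue" for k
    using test_fun_measurable(1)[OF \<phi>] by (intro measurable_completion) simp
  have \<Omega>m: "\<Omega> \<in> sets lebesgue" using \<Omega> by auto
  obtain r :: "nat \<Rightarrow> nat" where r: "strict_mono r" "AE x in lebesgue. x \<in> \<Omega> \<longrightarrow> (\<lambda>k. \<phi> (r k) x) \<longlonglongrightarrow> u x"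
    using AE_subseq_of_Lq_tendsto[OF _ \<phi>m u \<Omega>m lim(1)] by auto
  define en where "en k = (\<integral>x. F (grad (\<phi> k) x) ^ ?N \<partial>lborel)" for k
  define c where "c k = root ?N (max 1 (en k))" for k
  have c1: "1 \<le> c k" "c k ^ ?N = max 1 (en k)" for k unfolding c_def by (auto simp: real_root_pow_pos2)
  have "(\<lambda>k. max 1 (en k)) \<longlonglongrightarrow> 1"
  proof (rule tendstoI)
    fix \<eta> :: real assume "0 < \<eta>"
    hence "\<forall>\<^sub>F k in sequentially. en k \<le> 1 + \<eta> / 2" unfolding en_def by (intro energy_limsup[OF \<phi> \<Omega> Du lim(2) E]) simp
    thus "\<forall>\<^sub>F k in sequentially. dist (max 1 (en k)) 1 < \<eta>"
      by eventually_elim (use \<open>0 < \<eta>\<close> in \<open>auto simp: dist_real_def max_def\<close>)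
  qed
  hence "(\<lambda>k. max 1 (en (r k))) \<longlonglongrightarrow> 1" using LIMSEQ_subseq_LIMSEQ[OF _ r(1), of "\<lambda>k. max 1 (en k)"] by (simp add: o_def)
  hence cl: "(\<lambda>k. c (r k)) \<longlonglongrightarrow> 1" unfolding c_def using tendsto_real_root[of _ 1 _ ?N] by fastforce
  define \<psi> where "\<psi> k = (\<lambda>x. (1 / c (r k)) * \<phi> (r k) x)" for k
  have "test_fun \<Omega> (\<psi> k)" for k unfolding \<psi>_def by (rule test_fun_scale(1)[OF \<phi>])
  moreover have "(\<integral>x. F (grad (\<psi> k) x) ^ ?N \<partial>lborel) \<le> 1" for k
  proof -
    have c0: "0 < c (r k)" using c1(1)[of "r k"] by linarith
    have "(\<integral>x. F (grad (\<psi> k) x) ^ ?N \<partial>lborel) = (\<integral>x. (1 / c (r k)) ^ ?N * F (grad (\<phi> (r k)) x) ^ ?N \<partial>lborel)"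
      unfolding \<psi>_def test_fun_scale(2)[OF \<phi>] using c0 by (simp add: F_scale power_divide)
    also have "\<dots> = (1 / c (r k)) ^ ?N * en (r k)" unfolding en_def by simp
    also have "\<dots> = en (r k) / max 1 (en (r k))" unfolding c1(2)[symmetric] by (simp add: power_divide)
    also have "\<dots> \<le> 1" by (simp add: divide_le_eq)
    finally show ?thesis .
  qed
  moreover have "AE x in lebesgue. x \<in> \<Omega> \<longrightarrow> (\<lambda>k. \<psi> k x) \<longlonglongrightarrow> u x"
    using r(2)
  proof eventually_elim
    case (elim x)
    show ?case
    proof
      assume "x \<in> \<Omega>"
      hence "(\<lambda>k. (1 / c (r k)) * \<phi> (r k) x) \<longlonglongrightarrow> (1 / 1) * u x" using elim cl by (intro tendsto_intros) auto
      thus "(\<lambda>k. \<psi> k x) \<longlonglongrightarrow> u x" unfolding \<psi>_def by simp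
    qed
  qed
  ultimately show ?thesis by blast
qed

text \<open>Fatou's lemma is used twice. The constraint and \<open>gamma1\<close> bound the norms of
  the approximants, so along a subsequence they tend to some \<open>l\<close>. Fatou for the p-th
  powers shows that the norm of \<open>u\<close> is at most \<open>l\<close>; as the integrand
  increases with the norm, Fatou for the integrands, whose limit contains \<open>l\<close>, gives
  the bound for \<open>u\<close>.\<close>

lemma TM_W0_bound:
  fixes u :: "'a \<Rightarrow> real"
  assumes N: "2 \<le> DIM('a)" and \<Omega>: "open \<Omega>" "bounded \<Omega>"
    and \<gamma>: "0 \<le> \<gamma>" "\<gamma> < gamma1 F \<Omega> p" and \<beta>: "0 \<le> \<beta>" "\<beta> < real DIM('a)" and p: "1 < p"
    and Q: "\<And>\<phi>. test_fun \<Omega> \<phi> \<Longrightarrow> (\<integral>x. F (grad \<phi> x) ^ DIM('a) \<partial>lborel) \<le> 1 \<Longrightarrow>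
      (\<integral>\<^sup>+x\<in>\<Omega>. ennreal (TM_integrand \<gamma> \<beta> (Lp_norm p \<Omega> \<phi>) (\<phi> x) x) \<partial>lborel) \<le> ennreal Q"
    and W: "W0 (real DIM('a)) \<Omega> u Du"
    and E: "(\<integral>\<^sup>+x\<in>\<Omega>. ennreal (F (Du x) ^ DIM('a)) \<partial>lebesgue) \<le> 1"
  shows "(\<integral>\<^sup>+x\<in>\<Omega>. ennreal (TM_integrand \<gamma> \<beta> (Lp_norm p \<Omega> u) (u x) x) \<partial>lebesgue) \<le> ennreal Q"
proof -
  let ?N = "DIM('a)"
  obtain \<psi> where \<psi>: "\<And>k::nat. test_fun \<Omega> (\<psi> k)" "\<And>k. (\<integral>x. F (grad (\<psi> k) x) ^ ?N \<partial>lborel) \<le> 1"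
    and ae: "AE x in lebesgue. x \<in> \<Omega> \<longrightarrow> (\<lambda>k. \<psi> k x) \<longlonglongrightarrow> u x"
    using W0_approximation[OF W \<Omega>(1) E] by blast
  define S where "S k = Lp_norm p \<Omega> (\<psi> k)" for k
  define M where "M = root ?N (1 / gamma1 F \<Omega> p)"
  have g: "0 < gamma1 F \<Omega> p" using \<gamma> by simp
  have S: "S k \<in> {0..M}" for k
  proof -
    have "gamma1 F \<Omega> p * S k ^ ?N \<le> 1"
      unfolding S_def using gamma1_le[OF \<psi>(1) \<Omega>, of p k] \<psi>(2)[of k] p by simp
    hence "S k ^ ?N \<le> 1 / gamma1 F \<Omega> p" using g by (simp add: field_simps)
    hence "root ?N (S k ^ ?N) \<le> M" unfolding M_def by simp
    thus ?thesis using Lp_norm_nonneg[of p \<Omega> "\<psi> k"] unfolding S_def by (simp add: real_root_power_cancel)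
  qed
  obtain l r where l: "l \<in> {0..M}" and r: "strict_mono (r :: nat \<Rightarrow> nat)" and Sl: "(S \<circ> r) \<longlonglongrightarrow> l"
    using compact_Icc[of 0 M] S unfolding compact_def by blast
  have ae': "AE x in lebesgue. x \<in> \<Omega> \<longrightarrow> (\<lambda>k. \<psi> (r k) x) \<longlonglongrightarrow> u x"
    using ae
  proof eventually_elim
    case (elim x)
    thus ?case using LIMSEQ_subseq_LIMSEQ[OF _ r, of "\<lambda>k. \<psi> k x"] by (auto simp: o_def)
  qed
  have [measurable]: "\<Omega> \<in> sets borel" "\<psi> k \<in> borel_measurable borel" for k using \<Omega> test_fun_measurable(1)[OF \<psi>(1)] by auto
  have \<psi>m [measurable]: "\<psi> k \<in> borel_measurable lebesgue" and \<Omega>m [measurable]: "\<Omega> \<in> sets lebesgue" for k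
    using \<Omega>(1) by (auto intro: measurable_completion)
  have p0: "0 < p" using p by simp
  have ul: "Lp_norm p \<Omega> u \<le> l"
  proof (rule Lp_norm_le[OF p0])
    have "(\<integral>\<^sup>+x\<in>\<Omega>. ennreal (\<bar>u x\<bar> powr p) \<partial>lborel) = (\<integral>\<^sup>+x\<in>\<Omega>. ennreal (\<bar>u x\<bar> powr p) \<partial>lebesgue)"
      by (rule nn_integral_completion[symmetric])
    also have "\<dots> \<le> (\<integral>\<^sup>+x. liminf (\<lambda>k. ennreal (\<bar>\<psi> (r k) x\<bar> powr p) * indicator \<Omega> x) \<partial>lebesgue)"
    proof (rule nn_integral_mono_AE)
      show "AE x in lebesgue. ennreal (\<bar>u x\<bar> powr p) * indicator \<Omega> x \<le> liminf (\<lambda>k. ennreal (\<bar>\<psi> (r k) x\<bar> powr p) * indicator \<Omega> x)"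
        using ae'
      proof eventually_elim
        case (elim x)
        show ?case
        proof (cases "x \<in> \<Omega>")
          case True
          hence "(\<lambda>k. \<bar>\<psi> (r k) x\<bar>) \<longlonglongrightarrow> \<bar>u x\<bar>" using elim by (intro tendsto_rabs) auto
          hence "(\<lambda>k. \<bar>\<psi> (r k) x\<bar> powr p) \<longlonglongrightarrow> \<bar>u x\<bar> powr p" by (rule tendsto_powr') (use p in auto)
          hence "(\<lambda>k. ennreal (\<bar>\<psi> (r k) x\<bar> powr p)) \<longlonglongrightarrow> ennreal (\<bar>u x\<bar> powr p)" by (rule tendsto_ennrealI)
          hence "liminf (\<lambda>k. ennreal (\<bar>\<psi> (r k) x\<bar> powr p)) = ennreal (\<bar>u x\<bar> powr p)" by (intro lim_imp_Liminf) auto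
          thus ?thesis using True by simp
        qed simp
      qed
    qed
    also have "\<dots> \<le> liminf (\<lambda>k. \<integral>\<^sup>+x\<in>\<Omega>. ennreal (\<bar>\<psi> (r k) x\<bar> powr p) \<partial>lebesgue)"
      by (rule nn_integral_liminf) measurable
    also have "(\<lambda>k. \<integral>\<^sup>+x\<in>\<Omega>. ennreal (\<bar>\<psi> (r k) x\<bar> powr p) \<partial>lebesgue) = (\<lambda>k. ennreal (S (r k) powr p))"
    proof
      fix k
      obtain B where B: "\<And>x. \<bar>\<psi> (r k) x\<bar> < B" using test_fun_bounded[OF \<psi>(1)] by blast
      have "(\<integral>\<^sup>+x\<in>\<Omega>. ennreal (\<bar>\<psi> (r k) x\<bar> powr p) \<partial>lborel) = ennreal (S (r k) powr p)"
        unfolding S_def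
        by (intro nn_integral_eq_Lp_norm[OF p0] nn_integral_bounded_finite[OF p0, where M=B] emeasure_bounded_finite \<Omega>)
          (use B in \<open>auto intro: less_imp_le\<close>)
      thus "(\<integral>\<^sup>+x\<in>\<Omega>. ennreal (\<bar>\<psi> (r k) x\<bar> powr p) \<partial>lebesgue) = ennreal (S (r k) powr p)" unfolding nn_integral_completion .
    qed
    also have "liminf (\<lambda>k. ennreal (S (r k) powr p)) = ennreal (l powr p)"
    proof (rule lim_imp_Liminf)
      have "(\<lambda>k. S (r k) powr p) \<longlonglongrightarrow> l powr p"
        using Sl S by (intro tendsto_powr') (use p in \<open>auto simp: o_def\<close>)
      thus "(\<lambda>k. ennreal (S (r k) powr p)) \<longlonglongrightarrow> ennreal (l powr p)" by (rule tendsto_ennrealI)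
    qed simp
    finally show "(\<integral>\<^sup>+x\<in>\<Omega>. ennreal (\<bar>u x\<bar> powr p) \<partial>lborel) \<le> ennreal (l powr p)" .
  qed (use l in simp)
  have N1: "0 < real ?N - 1" using N by simp
  have lam: "0 < lambdaN F" by (rule lambdaN_power(1)[OF N])
  have mono: "TM_integrand \<gamma> \<beta> (Lp_norm p \<Omega> u) t x \<le> TM_integrand \<gamma> \<beta> l t x" for t x
  proof -
    have "Lp_norm p \<Omega> u ^ ?N \<le> l ^ ?N" using ul Lp_norm_nonneg by (intro power_mono)
    hence "1 + \<gamma> * Lp_norm p \<Omega> u ^ ?N \<le> 1 + \<gamma> * l ^ ?N" using \<gamma> by (simp add: mult_left_mono)
    moreover have "0 \<le> \<gamma> * Lp_norm p \<Omega> u ^ ?N" by (intro mult_nonneg_nonneg zero_le_power Lp_norm_nonneg \<gamma>(1))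
    ultimately have "(1 + \<gamma> * Lp_norm p \<Omega> u ^ ?N) powr (1 / (real ?N - 1)) \<le> (1 + \<gamma> * l ^ ?N) powr (1 / (real ?N - 1))"
      using N1 by (intro powr_mono2) auto
    moreover have "0 \<le> lambdaN F * (1 - \<beta> / real ?N) * \<bar>t\<bar> powr (real ?N / (real ?N - 1))"
      using lam \<beta> by (intro mult_nonneg_nonneg) auto
    ultimately show ?thesis unfolding TM_integrand_def by (intro divide_right_mono iffD2[OF exp_le_cancel_iff] mult_left_mono) auto
  qed
  have conv: "(\<lambda>k. TM_integrand \<gamma> \<beta> (S (r k)) (\<psi> (r k) x) x) \<longlonglongrightarrow> TM_integrand \<gamma> \<beta> l (u x) x"
    if "(\<lambda>k. \<psi> (r k) x) \<longlonglongrightarrow> u x" for x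
  proof -
    have "(\<lambda>k. \<bar>\<psi> (r k) x\<bar> powr (real ?N / (real ?N - 1))) \<longlonglongrightarrow> \<bar>u x\<bar> powr (real ?N / (real ?N - 1))"
      by (rule tendsto_powr'[OF tendsto_rabs[OF that] tendsto_const]) (use N1 in auto)
    moreover have "0 \<le> \<gamma> * l ^ ?N" using \<gamma> l by simp
    hence "1 + \<gamma> * l ^ ?N \<noteq> 0" by linarith
    hence "(\<lambda>k. (1 + \<gamma> * S (r k) ^ ?N) powr (1 / (real ?N - 1))) \<longlonglongrightarrow> (1 + \<gamma> * l ^ ?N) powr (1 / (real ?N - 1))"
      using Sl unfolding o_def by (intro tendsto_powr[OF _ tendsto_const] tendsto_intros)
    ultimately show ?thesis
      unfolding TM_integrand_def divide_inverse by (intro tendsto_mult_right tendsto_exp tendsto_mult tendsto_const)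
  qed
  have TMm: "(\<lambda>x. TM_integrand \<gamma> \<beta> s (\<psi> k x) x) \<in> borel_measurable borel" for s k
    unfolding TM_integrand_def by measurable
  have TMl [measurable]: "(\<lambda>x. TM_integrand \<gamma> \<beta> s (\<psi> k x) x) \<in> borel_measurable lebesgue" for s k
    by (rule measurable_completion) (use TMm in simp)
  have "(\<integral>\<^sup>+x\<in>\<Omega>. ennreal (TM_integrand \<gamma> \<beta> (Lp_norm p \<Omega> u) (u x) x) \<partial>lebesgue)
    \<le> (\<integral>\<^sup>+x. liminf (\<lambda>k. ennreal (TM_integrand \<gamma> \<beta> (S (r k)) (\<psi> (r k) x) x) * indicator \<Omega> x) \<partial>lebesgue)"
  proof (rule nn_integral_mono_AE)
    show "AE x in lebesgue. ennreal (TM_integrand \<gamma> \<beta> (Lp_norm p \<Omega> u) (u x) x) * indicator \<Omega> x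
      \<le> liminf (\<lambda>k. ennreal (TM_integrand \<gamma> \<beta> (S (r k)) (\<psi> (r k) x) x) * indicator \<Omega> x)"
      using ae'
    proof eventually_elim
      case (elim x)
      show ?case
      proof (cases "x \<in> \<Omega>")
        case True
        hence "(\<lambda>k. ennreal (TM_integrand \<gamma> \<beta> (S (r k)) (\<psi> (r k) x) x)) \<longlonglongrightarrow> ennreal (TM_integrand \<gamma> \<beta> l (u x) x)"
          using elim by (intro tendsto_ennrealI conv) auto
        hence "liminf (\<lambda>k. ennreal (TM_integrand \<gamma> \<beta> (S (r k)) (\<psi> (r k) x) x)) = ennreal (TM_integrand \<gamma> \<beta> l (u x) x)"
          by (intro lim_imp_Liminf) auto
        thus ?thesis using True ennreal_leI[OF mono] by simp
      qed simp
    qed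
  qed
  also have "\<dots> \<le> liminf (\<lambda>k. \<integral>\<^sup>+x\<in>\<Omega>. ennreal (TM_integrand \<gamma> \<beta> (S (r k)) (\<psi> (r k) x) x) \<partial>lebesgue)"
    by (rule nn_integral_liminf) measurable
  also have "\<dots> \<le> liminf (\<lambda>k. ennreal Q)"
    using Q[OF \<psi>] unfolding S_def nn_integral_completion by (intro Liminf_mono) simp
  also have "\<dots> = ennreal Q" by (simp add: Liminf_const)
  finally show ?thesis .
qed

end

theorem theorem1p3:
  fixes F :: "'a::euclidean_space \<Rightarrow> real" and \<Omega> :: "'a set"
    and \<gamma> \<beta> p :: real
  assumes "DIM('a) \<ge> 2"
    and "anisotropic_F F"
    and "smooth_bounded_domain \<Omega>" and "0 \<in> \<Omega>"
    and "0 \<le> \<gamma>" and "\<gamma> < gamma1 F \<Omega> p"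
    and "0 \<le> \<beta>" and "\<beta> < real DIM('a)"
    and "p > 1"
  shows "(SUP uDu \<in> {(u, Du). W0 (real DIM('a)) \<Omega> u Du \<and>
              (\<integral>\<^sup>+ x\<in>\<Omega>. ennreal (F (Du x) ^ DIM('a)) \<partial>lebesgue) \<le> 1}.
           \<integral>\<^sup>+ x\<in>\<Omega>. ennreal
             (exp (lambdaN F * (1 - \<beta> / real DIM('a)) * \<bar>fst uDu x\<bar> powr (real DIM('a) / (real DIM('a) - 1))
                   * (1 + \<gamma> * Lp_norm p \<Omega> (fst uDu) ^ DIM('a)) powr (1 / (real DIM('a) - 1)))
              / Fo F x powr \<beta>) \<partial>lebesgue) < \<infinity>"
proof -
  interpret anisotropic F by unfold_locales (rule assms(2))
  have \<Omega>: "open \<Omega>" "bounded \<Omega>" "\<Omega> \<noteq> {}" using assms(3) unfolding smooth_bounded_domain_def by auto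
  obtain Q where Q: "\<And>\<phi>. test_fun \<Omega> \<phi> \<Longrightarrow> (\<integral>x. F (grad \<phi> x) ^ DIM('a) \<partial>lborel) \<le> 1 \<Longrightarrow>
      (\<integral>\<^sup>+x\<in>\<Omega>. ennreal (TM_integrand \<gamma> \<beta> (Lp_norm p \<Omega> \<phi>) (\<phi> x) x) \<partial>lborel) \<le> ennreal Q"
    using TM_test_fun_bound[OF assms(1) \<Omega> assms(5-9)] by blast
  have "(SUP uDu \<in> {(u, Du). W0 (real DIM('a)) \<Omega> u Du \<and>
              (\<integral>\<^sup>+ x\<in>\<Omega>. ennreal (F (Du x) ^ DIM('a)) \<partial>lebesgue) \<le> 1}.
           \<integral>\<^sup>+ x\<in>\<Omega>. ennreal (TM_integrand \<gamma> \<beta> (Lp_norm p \<Omega> (fst uDu)) (fst uDu x) x) \<partial>lebesgue) \<le> ennreal Q"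
  proof (rule SUP_least)
    fix uDu :: "('a \<Rightarrow> real) \<times> ('a \<Rightarrow> 'a)"
    assume "uDu \<in> {(u, Du). W0 (real DIM('a)) \<Omega> u Du \<and> (\<integral>\<^sup>+ x\<in>\<Omega>. ennreal (F (Du x) ^ DIM('a)) \<partial>lebesgue) \<le> 1}"
    hence W: "W0 (real DIM('a)) \<Omega> (fst uDu) (snd uDu)" "(\<integral>\<^sup>+ x\<in>\<Omega>. ennreal (F (snd uDu x) ^ DIM('a)) \<partial>lebesgue) \<le> 1" by auto
    show "(\<integral>\<^sup>+ x\<in>\<Omega>. ennreal (TM_integrand \<gamma> \<beta> (Lp_norm p \<Omega> (fst uDu)) (fst uDu x) x) \<partial>lebesgue) \<le> ennreal Q"
      by (rule TM_W0_bound[OF assms(1) \<Omega>(1,2) assms(5-9) Q W])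
  qed
  also have "ennreal Q < \<infinity>" by simp
  finally show ?thesis unfolding TM_integrand_def .
qed

end
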